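(* Suppose $(\mathbf{u},\mathbf{B})$ is a smooth axisymmetric self-similar solution in $\mathbb{R}^3\setminus\{0\}$ of the stationary MHD system $$-\Delta \mathbf{u} + (\mathbf{u}\cdot\nabla)\mathbf{u} - (\mathbf{B}\cdot\nabla)\mathbf{B} + \nabla p = 0,\qquad -\Delta \mathbf{B} + (\mathbf{u}\cdot\nabla)\mathbf{B} - (\mathbf{B}\cdot\nabla)\mathbf{u} = 0,\qquad \nabla\cdot\mathbf{u}=\nabla\cdot\mathbf{B}=0,$$ of the form $\mathbf{u}=u^r(r,z)\mathbf{e}_r+u^\theta(r,z)\mathbf{e}_\theta+u^z(r,z)\mathbf{e}_z$ and $\mathbf{B}=B^\theta(r,z)\mathbf{e}_\theta$, where $(r,\theta,z)$ are cylindrical coordinates. If $u^r(x)\le\alpha$ on the unit sphere $\partial B_1=\{x\in\mathbb{R}^3:|x|=1\}$ with $\alpha<\frac{2\sqrt2}{3}$, then $\mathbf{u}$ is a Landau solution and $\mathbf{B}\equiv0$.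
   Context: In the system, $\mathbf{u}$ is the fluid velocity, $\mathbf{B}$ the magnetic field and $p$ the scalar pressure; $\alpha$ is a real constant. Cylindrical coordinates $(r,\theta,z)$: $(x_1,x_2,x_3)=(r\cos\theta,r\sin\theta,z)$, with $\mathbf{e}_r=(\cos\theta,\sin\theta,0)$, $\mathbf{e}_\theta=(-\sin\theta,\cos\theta,0)$, $\mathbf{e}_z=(0,0,1)$. A vector field $\mathbf{w}$ is axisymmetric if $\mathbf{w}=w^r(r,z)\mathbf{e}_r+w^\theta(r,z)\mathbf{e}_\theta+w^z(r,z)\mathbf{e}_z$. Self-similar: a solution $(\mathbf{u},\mathbf{B},p)$ is self-similar if $\mathbf{u}(x)=\lambda\mathbf{u}(\lambda x)$, $\mathbf{B}(x)=\lambda\mathbf{B}(\lambda x)$, $p(x)=\lambda^2p(\lambda x)$ for any $\lambda>0$. Landau solutions: a function $f$ is $(-k)$-homogeneous if $f(\lambda x)=\lambda^{-k}f(x)$ for all $\lambda>0$. For any $0\ne\mathbf{b}\in\mathbb{R}^3$ there exist a unique $(-1)$-homogeneous $\mathbf{U}^{\mathbf{b}}$ and a corresponding $(-2)$-homogeneous $P^{\mathbf{b}}$ such that $(\mathbf{U}^{\mathbf{b}},P^{\mathbf{b}})$ are smooth in $\mathbb{R}^3\setminus\{0\}$ and solve $-\Delta\mathbf{U}^{\mathbf{b}}+\mathbf{U}^{\mathbf{b}}\cdot\nabla\mathbf{U}^{\mathbf{b}}+\nabla P^{\mathbf{b}}=\mathbf{b}\delta$, $\nabla\cdot\mathbf{U}^{\mathbf{b}}=0$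 in the distributional sense on $\mathbb{R}^3$, where $\delta$ is the Dirac delta function. The fields $\mathbf{U}^{\mathbf{b}}$ are the Landau solutions. When $\mathbf{b}=(0,0,\beta)$ with $\beta>0$, in spherical coordinates $(x_1,x_2,x_3)=(\rho\sin\varphi\cos\theta,\rho\sin\varphi\sin\theta,\rho\cos\varphi)$ with $\mathbf{e}_\rho=x/\rho$, $\mathbf{e}_\theta=(-\sin\theta,\cos\theta,0)$, $\mathbf{e}_\varphi=\mathbf{e}_\theta\times\mathbf{e}_\rho$, they have the explicit form $$\mathbf{U}^{\mathbf{b}}=\frac{2}{\rho}\Big(\frac{a^2-1}{(a-\cos\varphi)^2}-1\Big)\mathbf{e}_\rho-\frac{2\sin\varphi}{\rho(a-\cos\varphi)}\mathbf{e}_\varphi,\qquad P^{\mathbf{b}}=\frac{4(a\cos\varphi-1)}{\rho^2(a-\cos\varphi)^2},$$ where $\beta>0$ and $a>1$ are related by $\beta=16\pi\big(a+\frac12a^2\log\frac{a-1}{a+1}+\frac{4a}{3(a^2-1)}\big)$.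
   Formalization: The conclusion reads "u is a Landau solution or u ≡ 0", since the trivial solution u = 0, B = 0, p = 0 meets all the hypotheses (with α = 0) but is not a Landau solution, these being defined only for b ≠ 0. *)

theory Defs
  imports "HOL-Analysis.Analysis"
begin

definition partial :: "'n \<Rightarrow> (real^'n::finite \<Rightarrow> 'b::real_normed_vector) \<Rightarrow> real^'n \<Rightarrow> 'b" where
  "partial i f x = frechet_derivative f (at x) (axis i 1)"

text \<open>Only meant for open \<open>S\<close>.\<close>

primrec Ck_on :: "nat \<Rightarrow> (real^'n::finite) set \<Rightarrow> (real^'n \<Rightarrow> 'b::real_normed_vector) \<Rightarrow> bool" where
  "Ck_on 0 S f \<longleftrightarrow> continuous_on S f"
| "Ck_on (Suc k) S f \<longleftrightarrow> (\<forall>x\<in>S. f differentiable (at x)) \<and> (\<forall>i. Ck_on k S (partial i f))"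

definition smooth_on :: "(real^'n::finite) set \<Rightarrow> (real^'n \<Rightarrow> 'b::real_normed_vector) \<Rightarrow> bool" where
  "smooth_on S f \<longleftrightarrow> (\<forall>k. Ck_on k S f)"

definition gradient :: "(real^'n::finite \<Rightarrow> real) \<Rightarrow> real^'n \<Rightarrow> real^'n" where
  "gradient p x = (\<chi> i. partial i p x)"

definition divergence :: "(real^'n::finite \<Rightarrow> real^'n) \<Rightarrow> real^'n \<Rightarrow> real" where
  "divergence w x = (\<Sum>i\<in>UNIV. partial i w x $ i)"

definition laplacian :: "(real^'n::finite \<Rightarrow> 'b::real_normed_vector) \<Rightarrow> real^'n \<Rightarrow> 'b" where
  "laplacian f x = (\<Sum>i\<in>UNIV. partial i (partial i f) x)"

text \<open>\<open>advect v w\<close> is \<open>(v \<cdot> \<nabla>) w\<close>.\<close>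

definition advect ::
  "(real^'n::finite \<Rightarrow> real^'n) \<Rightarrow> (real^'n \<Rightarrow> 'b::real_normed_vector) \<Rightarrow> real^'n \<Rightarrow> 'b" where
  "advect v w x = (\<Sum>i\<in>UNIV. (v x $ i) *\<^sub>R partial i w x)"

text \<open>
  Fields on \<open>\<real>\<^sup>3\<close> without the origin are total functions whose value at \<open>0\<close> is never constrained.
\<close>

definition homogeneous :: "int \<Rightarrow> (real^3 \<Rightarrow> 'b::real_vector) \<Rightarrow> bool" where
  "homogeneous k f \<longleftrightarrow> (\<forall>c>0. \<forall>x. x \<noteq> 0 \<longrightarrow> f (c *\<^sub>R x) = (c powi k) *\<^sub>R f x)"

definition self_similar ::
  "(real^3 \<Rightarrow> real^3) \<Rightarrow> (real^3 \<Rightarrow> real^3) \<Rightarrow> (real^3 \<Rightarrow> real) \<Rightarrow> bool" where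
  "self_similar u B p \<longleftrightarrow>
     (\<forall>c>0. \<forall>x. x \<noteq> 0 \<longrightarrow>
        u x = c *\<^sub>R u (c *\<^sub>R x) \<and> B x = c *\<^sub>R B (c *\<^sub>R x) \<and> p x = c\<^sup>2 * p (c *\<^sub>R x))"

definition stationary_mhd ::
  "(real^3 \<Rightarrow> real^3) \<Rightarrow> (real^3 \<Rightarrow> real^3) \<Rightarrow> (real^3 \<Rightarrow> real) \<Rightarrow> bool" where
  "stationary_mhd u B p \<longleftrightarrow>
     (\<forall>x. x \<noteq> 0 \<longrightarrow>
        - laplacian u x + advect u u x - advect B B x + gradient p x = 0 \<and>
        - laplacian B x + advect u B x - advect B u x = 0 \<and>
        divergence u x = 0 \<and> divergence B x = 0)"

definition cyl :: "real \<Rightarrow> real \<Rightarrow> real \<Rightarrow> real^3" where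
  "cyl r \<theta> z = vector [r * cos \<theta>, r * sin \<theta>, z]"

definition cyl_radius :: "real^3 \<Rightarrow> real" where
  "cyl_radius x = sqrt ((x $ 1)\<^sup>2 + (x $ 2)\<^sup>2)"

definition e_r :: "real \<Rightarrow> real^3" where
  "e_r \<theta> = vector [cos \<theta>, sin \<theta>, 0]"

definition e_theta :: "real \<Rightarrow> real^3" where
  "e_theta \<theta> = vector [- sin \<theta>, cos \<theta>, 0]"

definition e_z :: "real^3" where
  "e_z = vector [0, 0, 1]"

text \<open>
  At \<open>r = 0\<close> the angle is arbitrary, so the identity for all \<open>\<theta>\<close> makes \<open>wr\<close> and \<open>wt\<close> vanish
  on the axis; for continuous \<open>w\<close> this is no restriction.
\<close>

definition axisymmetric_with ::
  "(real \<Rightarrow> real \<Rightarrow> real) \<Rightarrow> (real \<Rightarrow> real \<Rightarrow> real) \<Rightarrow> (real \<Rightarrow> real \<Rightarrow> real) \<Rightarrow>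
   (real^3 \<Rightarrow> real^3) \<Rightarrow> bool" where
  "axisymmetric_with wr wt wz w \<longleftrightarrow>
     (\<forall>r \<theta> z. r \<ge> 0 \<and> (r, z) \<noteq> (0, 0) \<longrightarrow>
        w (cyl r \<theta> z) = wr r z *\<^sub>R e_r \<theta> + wt r z *\<^sub>R e_theta \<theta> + wz r z *\<^sub>R e_z)"

definition test_function :: "(real^3 \<Rightarrow> 'b::real_normed_vector) \<Rightarrow> bool" where
  "test_function f \<longleftrightarrow> smooth_on UNIV f \<and> compact (closure {x. f x \<noteq> 0})"

text \<open>
  The equation \<open>- \<Delta> U + U \<cdot> \<nabla> U + \<nabla> P = b \<delta>\<close>, \<open>\<nabla> \<cdot> U = 0\<close> on all of \<open>\<real>\<^sup>3\<close>, tested against vector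
  fields \<open>\<phi>\<close> and scalars \<open>\<psi>\<close>. The convection term is read as \<open>\<nabla> \<cdot> (U \<otimes> U)\<close>, since
  \<open>U \<cdot> \<nabla> U\<close> is of size \<open>\<bar>x\<bar>\<^sup>-\<^sup>3\<close> and hence not locally integrable; \<open>advect U \<phi> x \<bullet> U x\<close> is
  \<open>U \<otimes> U : \<nabla> \<phi>\<close>.
\<close>

definition distributional_ns ::
  "real^3 \<Rightarrow> (real^3 \<Rightarrow> real^3) \<Rightarrow> (real^3 \<Rightarrow> real) \<Rightarrow> bool" where
  "distributional_ns b U P \<longleftrightarrow>
     (\<forall>\<phi> :: real^3 \<Rightarrow> real^3. test_function \<phi> \<longrightarrow>
        has_bochner_integral lborel
          (\<lambda>x. - (U x \<bullet> laplacian \<phi> x) - advect U \<phi> x \<bullet> U x - P x * divergence \<phi> x)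
          (b \<bullet> \<phi> 0)) \<and>
     (\<forall>\<psi> :: real^3 \<Rightarrow> real. test_function \<psi> \<longrightarrow>
        has_bochner_integral lborel (\<lambda>x. U x \<bullet> gradient \<psi> x) 0)"

text \<open>
  The trivial field \<open>U = 0\<close>, which belongs to \<open>b = 0\<close>, is excluded here; where it can occur it has to
  be allowed for separately.
\<close>

definition landau_solution :: "(real^3 \<Rightarrow> real^3) \<Rightarrow> bool" where
  "landau_solution U \<longleftrightarrow>
     (\<exists>b P. b \<noteq> 0 \<and> homogeneous (-1) U \<and> homogeneous (-2) P \<and>
        smooth_on (- {0}) U \<and> smooth_on (- {0}) P \<and> distributional_ns b U P)"

end

theory Submission
  imports Defs "HOL-Real_Asymp.Real_Asymp"
begin

text \<open>
  By self-similarity and axisymmetry everything is determined by the line \<open>(1, 0, z)\<close>, where the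
  system becomes ordinary differential equations in \<open>z\<close> for the components \<open>v j\<close> of \<open>u\<close>, with
  \<open>M = v 3 - z * v 1\<close> and, by incompressibility, \<open>M' = - v 1\<close>.

  Multiplying the equation of \<open>b = B\<^sup>\<theta>\<close> by \<open>b\<close> exhibits a quantity that tends to \<open>0\<close> at both ends
  and has derivative at least \<open>b\<^sup>2 * (1/2 + 1/(1 + z\<^sup>2) - 3/2 * v 1)\<close>. Since
  \<open>v 1 \<le> \<alpha> / sqrt (1 + z\<^sup>2)\<close>, this is positive for \<open>\<alpha> < 2 * sqrt 2 / 3\<close> by the inequality of
  arithmetic and geometric means, so \<open>b = 0\<close>. The swirl \<open>v 2\<close> then satisfies a maximum principle and
  vanishes. The vertical momentum equation integrates to a formula for the pressure, and the
  radial one turns into a homogeneous second-order equation for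
  \<open>Q = (1 + z\<^sup>2) * v 1 + M\<^sup>2 / 2 - z * M\<close>, whose solutions of linear growth vanish. The Riccati
  equation \<open>Q = 0\<close> has the bounded solutions \<open>M = 0\<close> and \<open>M = 2 / (a * sqrt (1 + z\<^sup>2) - z)\<close>
  with \<open>\<bar>a\<bar> > 1\<close>.

  The divergence theorem applies to fields of size \<open>1 / \<bar>x\<bar>\<close> with derivatives of size \<open>1 / \<bar>x\<bar>\<^sup>2\<close>,
  hence the distribution given by the Navier-Stokes operator annihilates test functions that vanish
  at the origin: it is \<open>force * \<delta>\<close>. Testing with \<open>(1 - \<bar>x\<bar>\<^sup>2)\<^sup>3\<close>, cut off at the unit sphere, and
  subtracting a suitable divergence leaves an integrand of constant sign, so \<open>force \<noteq> 0\<close> when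
  \<open>M \<noteq> 0\<close>.
\<close>

section \<open>Partial derivatives and smoothness\<close>

text \<open>The limits z -> +infinity and z -> -infinity of the slice are the two halves of the
  axis, so regularity of the fields across the axis survives only as decay: a continuous
  (-k)-homogeneous function is O((1 + z^2)^(-k/2)) on the slice. These bounds fix every constant of
  integration and serve as boundary conditions in the maximum principles.

  The pressure is given as self-similar but not as axisymmetric; its invariance under rotations has
  to be derived from the vertical momentum equation.

  The constant 2 sqrt 2 / 3 is 2/3 of the minimum of s/2 + 1/s over s = sqrt (1 + z^2), attained at
  z = 1 and z = -1.

  The Landau property is read off from the distributional equation of u itself, with
  \<open>force\<close> as b. What remains is b \<noteq> 0, and for this a sign suffices in place of
  the value of the integral. Both signs of a occur, according to the direction of the force along
  the axis; multiplying the density by a treats them together.\<close>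

lemma partial_eqI:
  assumes "(f has_derivative f') (at x)"
  shows "partial i f x = f' (axis i 1)"
  using frechet_derivative_at[OF assms] by (simp add: partial_def)

lemma has_derivative_partials:
  fixes f :: "real^'n::finite \<Rightarrow> 'b::real_normed_vector"
  assumes "f differentiable (at x)"
  shows "(f has_derivative (\<lambda>h. \<Sum>i\<in>UNIV. (h $ i) *\<^sub>R partial i f x)) (at x)"
proof -
  define f' where "f' = frechet_derivative f (at x)"
  have d: "(f has_derivative f') (at x)"
    using assms frechet_derivative_works f'_def by blast
  interpret bounded_linear f' using d by (rule has_derivative_bounded_linear)
  have "f' h = (\<Sum>i\<in>UNIV. (h $ i) *\<^sub>R partial i f x)" for h
  proof -
    have "h = (\<Sum>i\<in>UNIV. (h $ i) *\<^sub>R axis i 1)"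
      by (subst basis_expansion[symmetric]) (simp add: scalar_mult_eq_scaleR)
    then have "f' h = f' (\<Sum>i\<in>UNIV. (h $ i) *\<^sub>R axis i 1)" by simp
    also have "\<dots> = (\<Sum>i\<in>UNIV. (h $ i) *\<^sub>R partial i f x)"
      by (simp add: sum scaleR partial_def f'_def[symmetric])
    finally show ?thesis .
  qed
  then have "f' = (\<lambda>h. \<Sum>i\<in>UNIV. (h $ i) *\<^sub>R partial i f x)" by blast
  with d show ?thesis by simp
qed

lemma has_real_derivative_along:
  fixes f :: "real^'n::finite \<Rightarrow> real"
  assumes "f differentiable (at (c t))" and "(c has_vector_derivative c') (at t)"
  shows "((\<lambda>t. f (c t)) has_real_derivative (\<Sum>i\<in>UNIV. c' $ i * partial i f (c t))) (at t)"
proof -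
  have "((\<lambda>t. f (c t)) has_derivative
      (\<lambda>s. \<Sum>i\<in>UNIV. ((s *\<^sub>R c') $ i) *\<^sub>R partial i f (c t))) (at t)"
    using has_derivative_compose[OF assms(2)[unfolded has_vector_derivative_def]
        has_derivative_partials[OF assms(1)]] .
  moreover have "(\<lambda>s. \<Sum>i\<in>UNIV. ((s *\<^sub>R c') $ i) *\<^sub>R partial i f (c t)) =
      (*) (\<Sum>i\<in>UNIV. c' $ i * partial i f (c t))"
    by (auto simp: fun_eq_iff sum_distrib_left algebra_simps)
  ultimately show ?thesis
    by (simp only: has_field_derivative_def)
qed

lemma has_real_derivative_partial:
  fixes f :: "real^'n::finite \<Rightarrow> real"
  assumes "f differentiable (at (x + s *\<^sub>R axis i 1))"
  shows "((\<lambda>s. f (x + s *\<^sub>R axis i 1)) has_real_derivative partial i f (x + s *\<^sub>R axis i 1)) (at s)"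
proof -
  have "((\<lambda>s. x + s *\<^sub>R axis i 1) has_vector_derivative (axis i 1 :: real^'n)) (at s)"
    by (auto intro!: derivative_eq_intros)
  from has_real_derivative_along[of f "\<lambda>s. x + s *\<^sub>R axis i 1", OF assms this] show ?thesis
    by (simp add: axis_def if_distrib[of "\<lambda>u. u * _"] cong: if_cong)
qed

lemma partial_eq_deriv:
  fixes f :: "real^'n::finite \<Rightarrow> real"
  assumes "f differentiable (at x)" and "((\<lambda>s. f (x + s *\<^sub>R axis i 1)) has_real_derivative d) (at 0)"
  shows "partial i f x = d"
  using has_real_derivative_partial[of f x 0 i] assms by (auto dest: DERIV_unique)

text \<open>Identities between the fields hold only off the origin. A derivative depends on the
  values near the point alone, so such identities may be differentiated on the open set
  \<open>- {0}\<close>.\<close>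

lemma partial_cong_open:
  assumes "open S" "x \<in> S" "\<And>y. y \<in> S \<Longrightarrow> f y = g y"
  shows "partial i f x = partial i g x"
proof -
  have "(f has_derivative D) (at x) \<longleftrightarrow> (g has_derivative D) (at x)" for D
    using has_derivative_transform_within_open[OF _ assms(1,2), of f D UNIV g]
      has_derivative_transform_within_open[OF _ assms(1,2), of g D UNIV f] assms(3) by auto
  then show ?thesis unfolding partial_def frechet_derivative_def by simp
qed

lemma differentiable_cong_open:
  assumes "open S" "x \<in> S" "\<And>y. y \<in> S \<Longrightarrow> f y = g y" "f differentiable (at x)"
  shows "g differentiable (at x)"
  using has_derivative_transform_within_open[OF _ assms(1,2), of f _ UNIV g] assms(3,4)
  unfolding differentiable_def by blast

lemma Ck_on_cong_open:
  assumes "open S"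
  shows "(\<And>y. y \<in> S \<Longrightarrow> f y = g y) \<Longrightarrow> Ck_on k S f \<Longrightarrow> Ck_on k S g"
proof (induction k arbitrary: f g)
  case 0
  then show ?case by (simp cong: continuous_on_cong)
next
  case (Suc k)
  have "Ck_on k S (partial i g)" for i
    using Suc.IH[of "partial i f" "partial i g"] partial_cong_open[OF assms, of _ f g] Suc.prems by simp
  then show ?case using Suc.prems differentiable_cong_open[OF assms, of _ f g] by simp
qed

lemma smooth_on_differentiable: "smooth_on S f \<Longrightarrow> x \<in> S \<Longrightarrow> f differentiable (at x)"
  unfolding smooth_on_def by (metis Ck_on.simps(2))

lemma smooth_on_partial: "smooth_on S f \<Longrightarrow> smooth_on S (partial i f)"
  unfolding smooth_on_def by (metis Ck_on.simps(2))

lemma smooth_on_continuous: "smooth_on S f \<Longrightarrow> continuous_on S f"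
  unfolding smooth_on_def by (metis Ck_on.simps(1))

lemma partial_linear:
  assumes "bounded_linear L" "f differentiable (at x)"
  shows "partial i (\<lambda>x. L (f x)) x = L (partial i f x)"
proof -
  interpret bounded_linear L by fact
  have "((\<lambda>x. L (f x)) has_derivative (\<lambda>h. L (\<Sum>i\<in>UNIV. (h $ i) *\<^sub>R partial i f x))) (at x)"
    using has_derivative[OF has_derivative_partials[OF assms(2)]] .
  from partial_eqI[OF this, of i] show ?thesis
    by (simp add: axis_def if_distrib[of "\<lambda>u. u *\<^sub>R _"] cong: if_cong)
qed

lemma Ck_on_linear:
  assumes "open S" "bounded_linear L"
  shows "Ck_on k S f \<Longrightarrow> Ck_on k S (\<lambda>x. L (f x))"
proof (induction k arbitrary: f)
  case 0
  then show ?case using assms(2) by (simp add: bounded_linear.continuous_on)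
next
  case (Suc k)
  have "Ck_on k S (partial i (\<lambda>x. L (f x)))" for i
  proof (rule Ck_on_cong_open[OF assms(1) _ Suc.IH[of "partial i f"]])
    show "Ck_on k S (partial i f)" using Suc.prems by simp
  qed (rule partial_linear[OF assms(2), symmetric], use Suc.prems in simp)
  moreover have "(\<lambda>x. L (f x)) differentiable (at x)" if "x \<in> S" for x
    using Suc.prems that bounded_linear.has_derivative[OF assms(2)] unfolding differentiable_def
    by (metis Ck_on.simps(2) differentiable_def)
  ultimately show ?case by simp
qed

lemma smooth_on_linear:
  assumes "open S" "bounded_linear L" "smooth_on S f"
  shows "smooth_on S (\<lambda>x. L (f x))"
  using assms Ck_on_linear unfolding smooth_on_def by blast

lemma smooth_on_component: "open S \<Longrightarrow> smooth_on S u \<Longrightarrow> smooth_on S (\<lambda>x. u x $ j)"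
  by (rule smooth_on_linear[OF _ bounded_linear_vec_nth])

lemma partial_component:
  "u differentiable (at x) \<Longrightarrow> partial i (\<lambda>x. u x $ j) x = partial i u x $ j"
  by (rule partial_linear[OF bounded_linear_vec_nth])

lemma laplacian_component:
  assumes "open S" "x \<in> S" "smooth_on S u"
  shows "laplacian (\<lambda>x. u x $ j) x = laplacian u x $ j"
proof -
  have "partial i (partial i (\<lambda>x. u x $ j)) x = partial i (partial i u) x $ j" for i
  proof -
    have "partial i (partial i (\<lambda>x. u x $ j)) x = partial i (\<lambda>x. partial i u x $ j) x"
      by (rule partial_cong_open[OF assms(1,2)])
        (simp add: partial_component smooth_on_differentiable[OF assms(3)])
    also have "\<dots> = partial i (partial i u) x $ j"
      by (rule partial_component)
        (simp add: smooth_on_differentiable[OF smooth_on_partial[OF assms(3)]] assms(2))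
    finally show ?thesis .
  qed
  then show ?thesis by (simp add: laplacian_def)
qed

section \<open>Homogeneity and rotations\<close>

lemma homogeneousD: "homogeneous k f \<Longrightarrow> c > 0 \<Longrightarrow> x \<noteq> 0 \<Longrightarrow> f (c *\<^sub>R x) = (c powi k) *\<^sub>R f x"
  unfolding homogeneous_def by blast

text \<open>Two functions with coefficients appear because a first derivative of a rotated function
  is a combination of two rotated derivatives; the rule then applies once more to reach the
  Laplacian.\<close>

lemma partial_compose_linear:
  fixes A :: "real^3 \<Rightarrow> real^3" and F :: "real^3 \<Rightarrow> real"
  assumes "bounded_linear A" "F differentiable (at (A x))" "G differentiable (at (A x))"
  shows "partial i (\<lambda>x. a * F (A x) + b * G (A x)) x =
    a * (\<Sum>j\<in>UNIV. A (axis i 1) $ j * partial j F (A x)) +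
    b * (\<Sum>j\<in>UNIV. A (axis i 1) $ j * partial j G (A x))"
proof -
  note A = bounded_linear.has_derivative[OF assms(1) has_derivative_ident]
  have F: "((\<lambda>x. F (A x)) has_derivative (\<lambda>h. \<Sum>j\<in>UNIV. (A h $ j) *\<^sub>R partial j F (A x))) (at x)"
    using has_derivative_compose[OF A has_derivative_partials[OF assms(2)]] .
  have G: "((\<lambda>x. G (A x)) has_derivative (\<lambda>h. \<Sum>j\<in>UNIV. (A h $ j) *\<^sub>R partial j G (A x))) (at x)"
    using has_derivative_compose[OF A has_derivative_partials[OF assms(3)]] .
  show ?thesis
    using partial_eqI[OF has_derivative_add[OF has_derivative_mult_right[OF F, of a]
        has_derivative_mult_right[OF G, of b]], of i] by simp
qed

lemma homogeneous_partial:
  fixes f :: "real^3 \<Rightarrow> real"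
  assumes "homogeneous k f" "\<And>x. x \<noteq> 0 \<Longrightarrow> f differentiable (at x)"
  shows "homogeneous (k - 1) (partial i f)"
  unfolding homogeneous_def
proof (intro allI impI)
  fix c :: real and x :: "real^3" assume c: "c > 0" and x: "x \<noteq> 0"
  have cx: "c *\<^sub>R x \<noteq> 0" using c x by simp
  have "c * partial i f (c *\<^sub>R x) = partial i (\<lambda>y. 1 * f (c *\<^sub>R y) + 0 * f (c *\<^sub>R y)) x"
    using partial_compose_linear[of "\<lambda>y. c *\<^sub>R y" f x f i 1 0] assms(2)[OF cx]
    by (simp add: bounded_linear_scaleR_right axis_def if_distrib[of "\<lambda>u. c * u * _"] cong: if_cong)
  also have "\<dots> = partial i (\<lambda>y. (c powi k) *\<^sub>R f y) x"
    by (rule partial_cong_open[of "- {0}"]) (use x homogeneousD[OF assms(1) c] in auto)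
  also have "\<dots> = (c powi k) * partial i f x"
    using partial_linear[OF bounded_linear_scaleR_right assms(2)[OF x]] by simp
  finally show "partial i f (c *\<^sub>R x) = (c powi (k - 1)) *\<^sub>R partial i f x"
    using c by (simp add: power_int_diff field_simps)
qed

lemma euler_homogeneous:
  fixes f :: "real^3 \<Rightarrow> real"
  assumes "homogeneous k f" "f differentiable (at x)" "x \<noteq> 0"
  shows "x $ 1 * partial 1 f x + x $ 2 * partial 2 f x + x $ 3 * partial 3 f x = of_int k * f x"
proof -
  have "((\<lambda>t. t *\<^sub>R x) has_vector_derivative x) (at 1)"
    by (auto intro!: derivative_eq_intros)
  then have "((\<lambda>t. f (t *\<^sub>R x)) has_real_derivative (\<Sum>i\<in>UNIV. x $ i * partial i f x)) (at 1)"
    using has_real_derivative_along[of f "\<lambda>t. t *\<^sub>R x" 1 x] assms(2) by simp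
  moreover have "((\<lambda>t. f (t *\<^sub>R x)) has_real_derivative of_int k * f x) (at 1)"
  proof (rule DERIV_cong_ev[OF refl _ refl, THEN iffD2])
    show "((\<lambda>t. (t powi k) * f x) has_real_derivative of_int k * f x) (at 1)"
      by (auto intro!: derivative_eq_intros)
    have "eventually (\<lambda>t::real. t > 0) (nhds 1)"
      using eventually_nhds_in_open[of "{0<..}" "1::real"] by simp
    then show "eventually (\<lambda>t. f (t *\<^sub>R x) = (t powi k) * f x) (nhds 1)"
      by eventually_elim (use homogeneousD[OF assms(1) _ assms(3)] in auto)
  qed
  ultimately show ?thesis
    using DERIV_unique by (fastforce simp: sum_3)
qed

text \<open>The constant is the maximum over the compact unit sphere, carried along rays by scaling.
  This is the only source of decay and growth bounds in the proof.\<close>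

lemma homogeneous_bound:
  fixes f :: "real^3 \<Rightarrow> real"
  assumes "homogeneous k f" "continuous_on (- {0}) f"
  obtains C where "C > 0" "\<And>x. x \<noteq> 0 \<Longrightarrow> \<bar>f x\<bar> \<le> C * norm x powi k"
proof -
  have "continuous_on (sphere 0 1) f"
    by (rule continuous_on_subset[OF assms(2)]) auto
  then have "bounded (f ` sphere 0 1)"
    using compact_continuous_image compact_imp_bounded compact_sphere by blast
  then obtain C where C: "C > 0" "\<And>x. norm x = 1 \<Longrightarrow> \<bar>f x\<bar> \<le> C"
    unfolding bounded_pos by (auto simp: sphere_def dist_norm)
  have "\<bar>f x\<bar> \<le> C * norm x powi k" if "x \<noteq> 0" for x
  proof -
    define e where "e = inverse (norm x) *\<^sub>R x"
    have e: "norm e = 1" "x = norm x *\<^sub>R e" using that by (auto simp: e_def)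
    then have "e \<noteq> 0" by auto
    then have "f x = (norm x powi k) * f e"
      using homogeneousD[OF assms(1), of "norm x" e] that e(2) by simp
    then show ?thesis using C(2)[OF e(1)] by (simp add: abs_mult mult.commute mult_right_mono)
  qed
  with C(1) show ?thesis using that by blast
qed

section \<open>Rotations about the vertical axis\<close>

definition rot :: "real \<Rightarrow> real^3 \<Rightarrow> real^3" where
  "rot \<theta> x = vector [cos \<theta> * x $ 1 - sin \<theta> * x $ 2, sin \<theta> * x $ 1 + cos \<theta> * x $ 2, x $ 3]"

lemma rot_nth [simp]:
  "rot \<theta> x $ 1 = cos \<theta> * x $ 1 - sin \<theta> * x $ 2"
  "rot \<theta> x $ 2 = sin \<theta> * x $ 1 + cos \<theta> * x $ 2"
  "rot \<theta> x $ 3 = x $ 3"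
  by (simp_all add: rot_def)

lemma vec3_eq_iff: "x = y \<longleftrightarrow> x $ 1 = y $ 1 \<and> x $ 2 = y $ 2 \<and> x $ 3 = (y :: 'a^3) $ 3"
  by (simp add: vec_eq_iff forall_3)

lemma norm3: "norm (x :: real^3) = sqrt ((x $ 1)\<^sup>2 + (x $ 2)\<^sup>2 + (x $ 3)\<^sup>2)"
  by (simp add: norm_vec_def L2_set_def sum_3)

lemma norm_rot [simp]: "norm (rot \<theta> x) = norm x"
proof -
  have "(c * a - s * b)\<^sup>2 + (s * a + c * b)\<^sup>2 = (c\<^sup>2 + s\<^sup>2) * (a\<^sup>2 + b\<^sup>2)"
    for c s a b :: real
    by (simp add: power2_eq_square algebra_simps)
  then show ?thesis by (simp add: norm3)
qed

lemma rot_eq_0_iff [simp]: "rot \<theta> x = 0 \<longleftrightarrow> x = 0"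
  using norm_rot[of \<theta> x] by (metis norm_eq_zero)

lemma rot_0: "rot 0 x = x"
  by (simp add: vec3_eq_iff)

lemma bounded_linear_rot: "bounded_linear (rot \<theta>)"
proof (rule bounded_linear_intro[where K = 1])
  show "rot \<theta> (x + y) = rot \<theta> x + rot \<theta> y" for x y
    by (simp add: vec3_eq_iff algebra_simps)
  show "rot \<theta> (r *\<^sub>R x) = r *\<^sub>R rot \<theta> x" for r x
    by (simp add: vec3_eq_iff algebra_simps)
qed simp

lemma has_real_derivative_rot:
  fixes f :: "real^3 \<Rightarrow> real"
  assumes "f differentiable (at x)"
  shows "((\<lambda>\<theta>. f (rot \<theta> x)) has_real_derivative - x $ 2 * partial 1 f x + x $ 1 * partial 2 f x) (at 0)"
proof -
  have "((\<lambda>\<theta>. rot \<theta> x) has_vector_derivative vector [- x $ 2, x $ 1, 0]) (at 0)"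
  proof -
    have "((\<lambda>\<theta>. cos \<theta> *\<^sub>R vector [x $ 1, x $ 2, 0] + sin \<theta> *\<^sub>R vector [- x $ 2, x $ 1, 0]
        + vector [0, 0, x $ 3]) has_vector_derivative vector [- x $ 2, x $ 1, 0]) (at 0)"
      by (auto intro!: derivative_eq_intros)
    also have "(\<lambda>\<theta>. cos \<theta> *\<^sub>R vector [x $ 1, x $ 2, 0] + sin \<theta> *\<^sub>R vector [- x $ 2, x $ 1, 0]
        + vector [0, 0, x $ 3]) = (\<lambda>\<theta>. rot \<theta> x)"
      by (auto simp: vec3_eq_iff fun_eq_iff)
    finally show ?thesis .
  qed
  from has_real_derivative_along[of f "\<lambda>\<theta>. rot \<theta> x", OF _ this] assms show ?thesis
    by (simp add: sum_3 rot_0)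
qed

lemma partial_compose_rot:
  fixes F G :: "real^3 \<Rightarrow> real"
  assumes "F differentiable (at (rot \<theta> x))" "G differentiable (at (rot \<theta> x))"
  shows "partial 1 (\<lambda>x. a * F (rot \<theta> x) + b * G (rot \<theta> x)) x =
      a * (cos \<theta> * partial 1 F (rot \<theta> x) + sin \<theta> * partial 2 F (rot \<theta> x)) +
      b * (cos \<theta> * partial 1 G (rot \<theta> x) + sin \<theta> * partial 2 G (rot \<theta> x))"
    "partial 2 (\<lambda>x. a * F (rot \<theta> x) + b * G (rot \<theta> x)) x =
      a * (- sin \<theta> * partial 1 F (rot \<theta> x) + cos \<theta> * partial 2 F (rot \<theta> x)) +
      b * (- sin \<theta> * partial 1 G (rot \<theta> x) + cos \<theta> * partial 2 G (rot \<theta> x))"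
    "partial 3 (\<lambda>x. a * F (rot \<theta> x) + b * G (rot \<theta> x)) x =
      a * partial 3 F (rot \<theta> x) + b * partial 3 G (rot \<theta> x)"
  by (simp_all add: partial_compose_linear[OF bounded_linear_rot assms] sum_3 axis_def)

lemma partial_rot_invariant:
  fixes w :: "real^3 \<Rightarrow> real"
  assumes "\<And>x. x \<noteq> 0 \<Longrightarrow> w (rot \<theta> x) = w x" "\<And>x. x \<noteq> 0 \<Longrightarrow> w differentiable (at x)" "x \<noteq> 0"
  shows "partial 1 w x = cos \<theta> * partial 1 w (rot \<theta> x) + sin \<theta> * partial 2 w (rot \<theta> x)"
    "partial 2 w x = - sin \<theta> * partial 1 w (rot \<theta> x) + cos \<theta> * partial 2 w (rot \<theta> x)"
    "partial 3 w x = partial 3 w (rot \<theta> x)"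
proof -
  have "partial i w x = partial i (\<lambda>x. 1 * w (rot \<theta> x) + 0 * w (rot \<theta> x)) x" for i
    by (rule partial_cong_open[of "- {0}"]) (use assms in auto)
  then show "partial 1 w x = cos \<theta> * partial 1 w (rot \<theta> x) + sin \<theta> * partial 2 w (rot \<theta> x)"
    "partial 2 w x = - sin \<theta> * partial 1 w (rot \<theta> x) + cos \<theta> * partial 2 w (rot \<theta> x)"
    "partial 3 w x = partial 3 w (rot \<theta> x)"
    using partial_compose_rot[of w \<theta> x w 1 0] assms(2)[of "rot \<theta> x"] assms(3) by simp_all
qed

lemma laplacian_rot_invariant:
  fixes w :: "real^3 \<Rightarrow> real"
  assumes inv: "\<And>x. x \<noteq> 0 \<Longrightarrow> w (rot \<theta> x) = w x" and w: "smooth_on (- {0}) w" and x: "x \<noteq> 0"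
  shows "laplacian w (rot \<theta> x) = laplacian w x"
proof -
  have d: "w differentiable (at y)" "partial i w differentiable (at y)" if "y \<noteq> 0" for i y
    using that w smooth_on_partial smooth_on_differentiable by blast+
  note p = partial_rot_invariant[OF inv d(1)]
  have *: "partial i (partial 1 w) x =
      partial i (\<lambda>x. cos \<theta> * partial 1 w (rot \<theta> x) + sin \<theta> * partial 2 w (rot \<theta> x)) x" for i
    by (rule partial_cong_open[of "- {0}", OF _ _ p(1)]) (use x in auto)
  have **: "partial i (partial 2 w) x =
      partial i (\<lambda>x. - sin \<theta> * partial 1 w (rot \<theta> x) + cos \<theta> * partial 2 w (rot \<theta> x)) x" for i
    by (rule partial_cong_open[of "- {0}", OF _ _ p(2)]) (use x in auto)
  have ***: "partial i (partial 3 w) x =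
      partial i (\<lambda>x. 1 * partial 3 w (rot \<theta> x) + 0 * partial 3 w (rot \<theta> x)) x" for i
    by (rule partial_cong_open[of "- {0}"]) (use x p(3)[symmetric] in auto)
  have rx: "rot \<theta> x \<noteq> 0" using x by simp
  note pc = partial_compose_rot[OF d(2)[OF rx] d(2)[OF rx]]
  \<comment> \<open>Here a, a' stand for the pure second derivatives and b, b' for the two mixed
    ones. Each of b and b' cancels by itself, and a, a' collect cos^2 + sin^2.\<close>
  have ring: "c * (c * a + s * b) + s * (c * b' + s * a') + (- s * (- s * a + c * b) + c * (- s * b' + c * a'))
      = (c\<^sup>2 + s\<^sup>2) * (a + a')" for a b a' b' c s :: real
    by (simp add: power2_eq_square algebra_simps)
  have "partial 1 (partial 1 w) x + partial 2 (partial 2 w) x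
      = ((cos \<theta>)\<^sup>2 + (sin \<theta>)\<^sup>2) * (partial 1 (partial 1 w) (rot \<theta> x) + partial 2 (partial 2 w) (rot \<theta> x))"
    by (simp only: *[of 1] **[of 2] pc ring)
  moreover have "partial 3 (partial 3 w) x = partial 3 (partial 3 w) (rot \<theta> x)"
    by (simp only: ***[of 3] pc)
  ultimately show ?thesis
    by (simp add: laplacian_def sum_3)
qed

section \<open>The line (1, 0, z) as a section of dilations and rotations\<close>

definition slice :: "real \<Rightarrow> real^3" where
  "slice z = vector [1, 0, z]"

lemma slice_nth [simp]: "slice z $ 1 = 1" "slice z $ 2 = 0" "slice z $ 3 = z"
  by (simp_all add: slice_def)

lemma slice_nonzero [simp]: "slice z \<noteq> 0"
  proof
  assume "slice z = 0"
  then have "slice z $ 1 = (0 :: real^3) $ 1" by (rule arg_cong)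
  then show False by simp
qed

lemma norm_slice: "norm (slice z) = sqrt (1 + z\<^sup>2)"
  by (simp add: norm3)

lemma has_real_derivative_slice:
  fixes f :: "real^3 \<Rightarrow> real"
  assumes "f differentiable (at (slice z))"
  shows "((\<lambda>z. f (slice z)) has_real_derivative partial 3 f (slice z)) (at z)"
proof -
  have "slice 0 + z' *\<^sub>R axis 3 1 = slice z'" for z'
    by (simp add: vec3_eq_iff axis_def)
  then show ?thesis
    using has_real_derivative_partial[of f "slice 0" z 3] assms by simp
qed

lemma polar_slice:
  assumes "x $ 1 \<noteq> 0 \<or> x $ 2 \<noteq> 0"
  obtains \<theta> where "x = cyl_radius x *\<^sub>R rot \<theta> (slice (x $ 3 / cyl_radius x))" "cyl_radius x > 0"
proof -
  define r where "r = cyl_radius x"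
  have pos: "(x $ 1)\<^sup>2 + (x $ 2)\<^sup>2 > 0"
    using assms unfolding sum_power2_gt_zero_iff .
  have r: "r > 0" "r\<^sup>2 = (x $ 1)\<^sup>2 + (x $ 2)\<^sup>2"
    using assms using pos unfolding r_def cyl_radius_def by simp_all
  have "(x $ 1 / r)\<^sup>2 + (x $ 2 / r)\<^sup>2 = 1"
    using r(1) by (simp add: power_divide add_divide_distrib[symmetric] r(2)[symmetric])
  then obtain \<theta> where "x $ 1 / r = cos \<theta>" "x $ 2 / r = sin \<theta>"
    by (rule sincos_total_2pi)
  then have "x = r *\<^sub>R rot \<theta> (slice (x $ 3 / r))"
    using r by (simp add: vec3_eq_iff field_simps)
  with r(1) that show ?thesis unfolding r_def by blast
qed

text \<open>Euler's identity expresses the derivative in direction 1, and the infinitesimal rotation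
  law the one in direction 2, so only z-derivatives remain. For the Laplacian, Euler's identity is
  used again for \<open>partial 1 w\<close>, of degree -2, after its own formula has been
  differentiated along the slice; differentiating the rotation law in direction 2 supplies the
  second derivative there.\<close>

lemma slice_identities:
  fixes w g :: "real^3 \<Rightarrow> real"
  assumes w: "smooth_on (- {0}) w" and hom: "homogeneous (-1) w"
    and spin: "\<And>x. x \<noteq> 0 \<Longrightarrow> - x $ 2 * partial 1 w x + x $ 1 * partial 2 w x = g x"
    and g: "g differentiable (at (slice z))"
  shows "partial 1 w (slice z) = - w (slice z) - z * partial 3 w (slice z)"
    "partial 2 w (slice z) = g (slice z)"
    "laplacian w (slice z) = (1 + z\<^sup>2) * partial 3 (partial 3 w) (slice z)
       + 3 * z * partial 3 w (slice z) + w (slice z) + partial 2 g (slice z)"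
proof -
  have d: "w differentiable (at y)" "partial i w differentiable (at y)" if "y \<noteq> 0" for i y
    using that w smooth_on_partial smooth_on_differentiable by blast+
  have 1: "partial 1 w (slice z) = - w (slice z) - z * partial 3 w (slice z)" for z
    using euler_homogeneous[OF hom d(1), of "slice z"] by simp
  then show "partial 1 w (slice z) = - w (slice z) - z * partial 3 w (slice z)" .
  show "partial 2 w (slice z) = g (slice z)"
    using spin[of "slice z"] by simp
  have "((\<lambda>z. - w (slice z) - z * partial 3 w (slice z)) has_real_derivative
      - partial 3 w (slice z) - (partial 3 w (slice z) + z * partial 3 (partial 3 w) (slice z))) (at z)"
    by (auto intro!: derivative_eq_intros has_real_derivative_slice d)
  then have 31: "partial 3 (partial 1 w) (slice z)
      = - 2 * partial 3 w (slice z) - z * partial 3 (partial 3 w) (slice z)"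
    using DERIV_unique[OF has_real_derivative_slice[of "partial 1 w" z, OF d(2)]] 1 by simp
  have "homogeneous (-1 - 1) (partial 1 w)"
    using homogeneous_partial[OF hom d(1)] .
  from euler_homogeneous[OF this d(2), of "slice z"]
  have 11: "partial 1 (partial 1 w) (slice z) = 2 * w (slice z) + 4 * z * partial 3 w (slice z)
      + z\<^sup>2 * partial 3 (partial 3 w) (slice z)"
    by (simp add: 31 1 algebra_simps power2_eq_square)
  have ax: "(slice z + s *\<^sub>R axis 2 1) $ 1 = 1" "(slice z + s *\<^sub>R axis 2 1) $ 2 = s" for s
    by (simp_all add: axis_def)
  have nz: "slice z + s *\<^sub>R axis 2 1 \<noteq> 0" for s
  proof
    assume "slice z + s *\<^sub>R axis 2 1 = 0"
    then have "(slice z + s *\<^sub>R axis 2 1) $ 1 = (0 :: real^3) $ 1" by (rule arg_cong)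
    then show False unfolding ax by simp
  qed
  have "((\<lambda>s. - s * partial 1 w (slice z + s *\<^sub>R axis 2 1) + partial 2 w (slice z + s *\<^sub>R axis 2 1))
      has_real_derivative - partial 1 w (slice z) + partial 2 (partial 2 w) (slice z)) (at 0)"
    using has_real_derivative_partial[OF d(2)[OF nz[of 0]], of 1]
      has_real_derivative_partial[OF d(2)[OF nz[of 0]], of 2]
    by (auto intro!: derivative_eq_intros)
  moreover have "- s * partial 1 w (slice z + s *\<^sub>R axis 2 1) + partial 2 w (slice z + s *\<^sub>R axis 2 1)
      = g (slice z + s *\<^sub>R axis 2 1)" for s
    using spin[OF nz[of s]] unfolding ax by simp
  ultimately have "partial 2 (partial 2 w) (slice z) = partial 2 g (slice z) + partial 1 w (slice z)"
    using partial_eq_deriv[OF g, of 2] by fastforce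
  then show "laplacian w (slice z) = (1 + z\<^sup>2) * partial 3 (partial 3 w) (slice z)
       + 3 * z * partial 3 w (slice z) + w (slice z) + partial 2 g (slice z)"
    by (simp add: laplacian_def sum_3 11 1 algebra_simps)
qed

section \<open>Ordinary differential equations on the line\<close>

lemma DERIV_imp_continuous_on_UNIV:
  fixes f :: "real \<Rightarrow> real"
  assumes "\<And>x. (f has_real_derivative f' x) (at x)"
  shows "continuous_on UNIV f"
  by (rule DERIV_continuous_on) (use assms in simp)

lemma linear_ode_zero:
  fixes y g :: "real \<Rightarrow> real"
  assumes y: "\<And>z. (y has_real_derivative g z * y z) (at z)" and g: "continuous_on UNIV g"
    and z0: "y z0 = 0"
  shows "y z = 0"
proof -
  define a b where "a = min z z0" and "b = max z z0"
  have "continuous_on {a..b} g" using g continuous_on_subset by blast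
  then obtain G where G: "\<And>x. x \<in> {a..b} \<Longrightarrow> (G has_vector_derivative g x) (at x within {a..b})"
    using antiderivative_continuous by blast
  have "((\<lambda>x. y x * exp (- G x)) has_real_derivative 0) (at x within {a..b})" if "x \<in> {a..b}" for x
    by (rule derivative_eq_intros DERIV_subset[OF y] refl subset_UNIV
        G[OF that, folded has_real_derivative_iff_has_vector_derivative])+ simp
  then obtain c where "\<And>x. x \<in> {a..b} \<Longrightarrow> y x * exp (- G x) = c"
    using has_field_derivative_zero_constant[of "{a..b}" "\<lambda>x. y x * exp (- G x)"] by auto
  from this[of z0] this[of z] z0 show ?thesis by (auto simp: a_def b_def)
qed

lemma attains_max_on_line:
  fixes f :: "real \<Rightarrow> real"
  assumes "continuous_on UNIV f" "\<And>z. \<bar>z\<bar> \<ge> R \<Longrightarrow> f z \<le> f z1"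
  obtains z0 where "\<And>z. f z \<le> f z0"
proof -
  define A where "A = max R \<bar>z1\<bar>"
  have "{-A..A} \<noteq> {}" by (simp add: A_def)
  moreover have "continuous_on {-A..A} f" using continuous_on_subset[OF assms(1)] by simp
  ultimately obtain z0 where "\<forall>y\<in>{-A..A}. f y \<le> f z0"
    using continuous_attains_sup[OF compact_Icc] by metis
  then have z0: "\<And>y. \<bar>y\<bar> \<le> A \<Longrightarrow> f y \<le> f z0" by (auto simp: abs_le_iff)
  have "f z \<le> f z0" for z
  proof (cases "\<bar>z\<bar> \<le> A")
    case False
    then have "f z \<le> f z1" using assms(2)[of z] by (simp add: A_def)
    also have "\<dots> \<le> f z0" using z0[of z1] by (simp add: A_def)
    finally show ?thesis .
  qed (rule z0)
  then show ?thesis using that by blast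
qed

lemma abs_le_sqrt_1_plus_square: "\<bar>z\<bar> \<le> sqrt (1 + z\<^sup>2)" for z :: real
  by (rule real_le_rsqrt) simp

lemma sqrt_1_plus_square_ge_1: "1 \<le> sqrt (1 + z\<^sup>2)" for z :: real
  by simp

lemma has_real_derivative_sqrt_1_plus_square:
  "((\<lambda>z. sqrt (1 + z\<^sup>2)) has_real_derivative z / sqrt (1 + z\<^sup>2)) (at z)" for z :: real
  using add_pos_nonneg[of 1 "z\<^sup>2"]
  by (auto intro!: derivative_eq_intros simp: field_simps)

text \<open>A positive value together with the decay forces an interior maximum. There y = f'
  vanishes, and since y solves a homogeneous linear first-order equation it vanishes identically; a
  constant that decays is 0.\<close>

lemma linear_ode_decay_nonpos:
  fixes f y g :: "real \<Rightarrow> real"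
  assumes f: "\<And>z. (f has_real_derivative y z) (at z)"
    and y: "\<And>z. (y has_real_derivative g z * y z) (at z)" and g: "continuous_on UNIV g"
    and bd: "\<And>z. \<bar>f z\<bar> \<le> C / sqrt (1 + z\<^sup>2)"
  shows "f z \<le> 0"
proof (rule ccontr)
  assume "\<not> f z \<le> 0"
  then have pos: "f z > 0" by simp
  have far: "f x < f z" if "\<bar>x\<bar> \<ge> C / f z + 1" for x
  proof -
    have s: "C / f z + 1 \<le> sqrt (1 + x\<^sup>2)" using abs_le_sqrt_1_plus_square[of x] that by linarith
    then have "C / f z < sqrt (1 + x\<^sup>2)" by linarith
    then have "C < sqrt (1 + x\<^sup>2) * f z" using pos by (simp add: divide_less_eq)
    moreover have "sqrt (1 + x\<^sup>2) > 0" using sqrt_1_plus_square_ge_1[of x] by linarith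
    ultimately have "C / sqrt (1 + x\<^sup>2) < f z" by (simp only: pos_divide_less_eq mult.commute)
    then show ?thesis using bd[of x] by linarith
  qed
  have "continuous_on UNIV f"
    by (rule DERIV_imp_continuous_on_UNIV[OF f])
  then obtain z0 where z0: "\<And>x. f x \<le> f z0"
    using attains_max_on_line[of f "C / f z + 1" z] far by (metis less_imp_le)
  then have "y z0 = 0" using DERIV_local_max[OF f, of 1 z0] by simp
  then have "y x = 0" for x using linear_ode_zero[OF y g] by blast
  then have "f (\<bar>C / f z\<bar> + 1) = f z"
    using f DERIV_isconst_all by metis
  moreover have "C / f z + 1 \<le> \<bar>\<bar>C / f z\<bar> + 1\<bar>" by linarith
  ultimately show False using far[of "\<bar>C / f z\<bar> + 1"] by linarith
qed

lemma linear_ode_decay_zero: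
  fixes f y g :: "real \<Rightarrow> real"
  assumes f: "\<And>z. (f has_real_derivative y z) (at z)"
    and y: "\<And>z. (y has_real_derivative g z * y z) (at z)" and g: "continuous_on UNIV g"
    and bd: "\<And>z. \<bar>f z\<bar> \<le> C / sqrt (1 + z\<^sup>2)"
  shows "f z = 0"
proof -
  have "- f z \<le> 0"
    by (rule linear_ode_decay_nonpos[where f = "\<lambda>z. - f z" and y = "\<lambda>z. - y z" and g = g and C = C])
      (use bd in \<open>auto intro!: derivative_eq_intros f y g\<close>)
  with linear_ode_decay_nonpos[OF assms] show ?thesis by (simp add: antisym)
qed

text \<open>With z = sinh \<tau> the equation becomes Q'' = 4 Q in \<tau>, whose solutions exp (2
  \<tau>) and exp (-2 \<tau>) grow quadratically in z at one end. The barrier 1 + 2 z^2 = cosh (2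
  \<tau>) is itself a solution, so \<open>D\<close> satisfies the same equation, and it outgrows the
  linear bound on Q. A positive maximum of \<open>D\<close> would have a positive second
  derivative.\<close>

lemma second_order_max_principle_nonpos:
  fixes Q Q1 Q2 :: "real \<Rightarrow> real"
  assumes Q: "\<And>z. (Q has_real_derivative Q1 z) (at z)" "\<And>z. (Q1 has_real_derivative Q2 z) (at z)"
    and eq: "\<And>z. (1 + z\<^sup>2) * Q2 z + z * Q1 z - 4 * Q z = 0"
    and bd: "\<And>z. \<bar>Q z\<bar> \<le> C * sqrt (1 + z\<^sup>2)"
  shows "Q z \<le> 0"
proof (rule field_le_epsilon)
  fix e' :: real assume e': "e' > 0"
  \<comment> \<open>Scaled so that the barrier takes exactly the value e' at the given z.\<close>
  define e where "e = e' / (1 + 2 * z\<^sup>2)"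
  have pz: "1 + 2 * z\<^sup>2 > 0" by (simp add: add_pos_nonneg)
  have e: "e > 0" using e' pz by (simp add: e_def)
  define D where "D = (\<lambda>x. Q x - e * (1 + 2 * x\<^sup>2))"
  have D: "(D has_real_derivative Q1 x - 4 * e * x) (at x)" for x
    unfolding D_def by (auto intro!: derivative_eq_intros Q)
  have D1: "((\<lambda>x. Q1 x - 4 * e * x) has_real_derivative Q2 x - 4 * e) (at x)" for x
    by (auto intro!: derivative_eq_intros Q)
  have "D z \<le> 0"
  proof (rule ccontr)
    assume "\<not> D z \<le> 0"
    then have pos: "D z > 0" by simp
    have far: "D x \<le> D z" if "\<bar>x\<bar> \<ge> C / e" for x
    proof -
      let ?s = "sqrt (1 + x\<^sup>2)"
      have "C \<le> e * ?s"
        using that abs_le_sqrt_1_plus_square[of x] e by (simp add: divide_le_eq mult.commute)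
          (smt (verit) mult_left_mono)
      then have "C * ?s \<le> e * ?s * ?s" using sqrt_1_plus_square_ge_1[of x] mult_right_mono by force
      also have "\<dots> = e * (1 + x\<^sup>2)" by (simp add: mult.assoc)
      also have "\<dots> \<le> e * (1 + 2 * x\<^sup>2)" using e by simp
      finally show ?thesis using bd[of x] pos unfolding D_def by linarith
    qed
    have "continuous_on UNIV D"
      by (rule DERIV_imp_continuous_on_UNIV[OF D])
    then obtain z0 where z0: "\<And>x. D x \<le> D z0"
      using attains_max_on_line[of D "C / e" z] far by metis
    have crit: "Q1 z0 - 4 * e * z0 = 0" using DERIV_local_max[OF D, of 1 z0] z0 by simp
    have "(1 + z0\<^sup>2) * (Q2 z0 - 4 * e) + z0 * (Q1 z0 - 4 * e * z0) - 4 * D z0 = 0"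
      using eq[of z0] unfolding D_def by (simp add: algebra_simps power2_eq_square)
    then have "(1 + z0\<^sup>2) * (Q2 z0 - 4 * e) = 4 * D z0" by (simp add: crit)
    moreover have "D z0 > 0" using z0[of z] pos by simp
    ultimately have "(1 + z0\<^sup>2) * (Q2 z0 - 4 * e) > 0" by simp
    \<comment> \<open>The first derivative of D is 0 at z0 and strictly increasing there, so D
      exceeds its maximum just to the right.\<close>
    then have "Q2 z0 - 4 * e > 0" by (rule zero_less_mult_pos) (simp add: add_pos_nonneg)
    then obtain d where d: "d > 0" "\<And>h. 0 < h \<Longrightarrow> h < d \<Longrightarrow> Q1 (z0 + h) - 4 * e * (z0 + h) > 0"
      using DERIV_pos_inc_right[OF D1[of z0]] crit by auto
    have "\<exists>w>z0. w < z0 + d / 2 \<and> D (z0 + d / 2) - D z0 = (z0 + d / 2 - z0) * (Q1 w - 4 * e * w)"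
      using MVT2[of z0 "z0 + d / 2" D "\<lambda>x. Q1 x - 4 * e * x"] D d(1) by simp
    then obtain w where w: "w > z0" "w < z0 + d / 2"
      "D (z0 + d / 2) - D z0 = d / 2 * (Q1 w - 4 * e * w)" by auto
    have "Q1 w - 4 * e * w > 0" using d(2)[of "w - z0"] w d(1) by simp
    then have "D (z0 + d / 2) > D z0" using w(3) d(1) by (smt (verit) half_gt_zero mult_pos_pos)
    then show False using z0[of "z0 + d / 2"] by simp
  qed
  then show "Q z \<le> 0 + e'" using pz by (simp add: D_def e_def)
qed

lemma second_order_max_principle:
  fixes Q Q1 Q2 :: "real \<Rightarrow> real"
  assumes Q: "\<And>z. (Q has_real_derivative Q1 z) (at z)" "\<And>z. (Q1 has_real_derivative Q2 z) (at z)"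
    and eq: "\<And>z. (1 + z\<^sup>2) * Q2 z + z * Q1 z - 4 * Q z = 0"
    and bd: "\<And>z. \<bar>Q z\<bar> \<le> C * sqrt (1 + z\<^sup>2)"
  shows "Q z = 0"
proof -
  have eq': "(1 + z\<^sup>2) * - Q2 z + z * - Q1 z - 4 * - Q z = 0" for z
    using eq[of z] by simp
  have "- Q z \<le> 0"
    by (rule second_order_max_principle_nonpos[where Q = "\<lambda>z. - Q z" and ?Q1.0 = "\<lambda>z. - Q1 z"
          and ?Q2.0 = "\<lambda>z. - Q2 z" and C = C])
      (use bd eq' in \<open>auto intro!: derivative_eq_intros Q\<close>)
  with second_order_max_principle_nonpos[OF assms] show ?thesis by (simp add: antisym)
qed

text \<open>A monotone function lies between its limits at the two ends, and both are 0.\<close>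

lemma mono_decay_zero:
  fixes F :: "real \<Rightarrow> real"
  assumes "mono F" and bd: "\<And>z. \<bar>F z\<bar> \<le> C / sqrt (1 + z\<^sup>2)"
  shows "F z = 0"
proof -
  have lim: "((\<lambda>z::real. C / sqrt (1 + z\<^sup>2)) \<longlongrightarrow> 0) at_top" "((\<lambda>z::real. C / sqrt (1 + z\<^sup>2)) \<longlongrightarrow> 0) at_bot"
    by real_asymp+
  have "(F \<longlongrightarrow> 0) at_top"
    by (rule Lim_null_comparison[OF _ lim(1)]) (use bd in simp)
  then have "F z \<le> 0"
    by (rule tendsto_lowerbound) (use assms(1) in \<open>auto intro!: eventually_mono[OF eventually_ge_at_top[of z]] dest: monoD\<close>)
  have "(F \<longlongrightarrow> 0) at_bot"
    by (rule Lim_null_comparison[OF _ lim(2)]) (use bd in simp)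
  then have "0 \<le> F z"
    by (rule tendsto_upperbound) (use assms(1) in \<open>auto intro!: eventually_mono[OF eventually_le_at_bot[of z]] dest: monoD\<close>)
  with \<open>F z \<le> 0\<close> show ?thesis by simp
qed

lemma magnetic_ode_zero:
  fixes b b1 b2 M v :: "real \<Rightarrow> real"
  assumes b: "\<And>z. (b has_real_derivative b1 z) (at z)" "\<And>z. (b1 has_real_derivative b2 z) (at z)"
    and M: "\<And>z. (M has_real_derivative - v z) (at z)"
    and eq: "\<And>z. (1 + z\<^sup>2) * b2 z + 3 * z * b1 z = M z * b1 z - 2 * v z * b z"
    and v: "\<And>z. v z \<le> \<alpha> / sqrt (1 + z\<^sup>2)" and \<alpha>: "\<alpha> < 2 * sqrt 2 / 3"
    and bd: "\<And>z. \<bar>b z\<bar> \<le> C / sqrt (1 + z\<^sup>2)" "\<And>z. \<bar>b1 z\<bar> \<le> C / (1 + z\<^sup>2)" "\<And>z. \<bar>M z\<bar> \<le> C"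
  shows "b z = 0"
proof -
  \<comment> \<open>The term with M removes the cross term M b b', and the multiple of z b^2
    produces a positive multiple of b^2. With c in place of 3/2, completing the square leaves b^2
    with the coefficient c - k^2 + k^2 / (1 + z^2) - 3/2 v, where k = c - 1/2. The product k^2 (k +
    1/2 - k^2), which governs the inequality of the means, is largest at k = 1, that is c =
    3/2.\<close>
  define F where "F = (\<lambda>z. (1 + z\<^sup>2) * b z * b1 z + 3 / 2 * z * (b z)\<^sup>2 - M z * (b z)\<^sup>2 / 2)"
  define F1 where "F1 = (\<lambda>z. (1 + z\<^sup>2) * (b1 z + z * b z / (1 + z\<^sup>2))\<^sup>2
    + (b z)\<^sup>2 * (1 / (1 + z\<^sup>2) + 1 / 2 - 3 / 2 * v z))"
  have p: "1 + z\<^sup>2 > 0" "1 + z\<^sup>2 \<noteq> 0" for z :: real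
    using add_pos_nonneg[of 1 "z\<^sup>2"] by auto
  have coef: "1 / (1 + z\<^sup>2) + 1 / 2 - 3 / 2 * v z > 0" for z
  proof -
    define s where "s = sqrt (1 + z\<^sup>2)"
    have s: "s > 0" "s\<^sup>2 = 1 + z\<^sup>2" using p[of z] by (auto simp: s_def)
    \<comment> \<open>The inequality of the means for 1 / s^2 and 1/2, with equality at s = sqrt
      2.\<close>
    have "0 \<le> (1 / s - sqrt 2 / 2)\<^sup>2" by simp
    then have "sqrt 2 / s \<le> 1 / s\<^sup>2 + 1 / 2" by (simp add: power2_diff power_divide)
    moreover have "3 / 2 * v z < sqrt 2 / s"
    proof -
      have "3 / 2 * \<alpha> < sqrt 2" using \<alpha> by simp
      then have "3 / 2 * (\<alpha> / s) < sqrt 2 / s" using divide_strict_right_mono[OF _ s(1), of "3 / 2 * \<alpha>" "sqrt 2"] by simp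
      then show ?thesis using v[of z] unfolding s_def by linarith
    qed
    ultimately show ?thesis unfolding s(2)[symmetric] by linarith
  qed
  have dF: "(F has_real_derivative F1 z) (at z)" for z
  proof -
    have sq: "(1 + z\<^sup>2) * (b1 z + z * b z / (1 + z\<^sup>2))\<^sup>2 + (b z)\<^sup>2 * (1 / (1 + z\<^sup>2) + 1 / 2 - 3 / 2 * v z)
      = (1 + z\<^sup>2) * (b1 z)\<^sup>2 + 2 * z * b z * b1 z + 3 / 2 * (1 - v z) * (b z)\<^sup>2"
    proof -
      have "(1 + z\<^sup>2) * (b1 z + z * b z / (1 + z\<^sup>2))\<^sup>2
        = (1 + z\<^sup>2) * (b1 z)\<^sup>2 + 2 * z * b z * b1 z + z\<^sup>2 / (1 + z\<^sup>2) * (b z)\<^sup>2"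
      proof -
        have "t * (x + y / t)\<^sup>2 = t * x\<^sup>2 + 2 * x * y + y\<^sup>2 / t" if "t \<noteq> 0" for t x y :: real
          using that by (simp add: power2_eq_square field_simps)
        from this[OF p(2), of z "b1 z" "z * b z"] show ?thesis by (simp add: power_mult_distrib)
      qed
      moreover have "z\<^sup>2 / (1 + z\<^sup>2) = 1 - 1 / (1 + z\<^sup>2)"
        using p[of z] by (simp add: field_simps)
      moreover have "(y + (1 - q) * c) + c * (q + 1 / 2 - 3 / 2 * w) = y + 3 / 2 * (1 - w) * c"
        for y q c w :: real by (simp add: field_simps)
      ultimately show ?thesis by (simp only:)
    qed
    have d: "(F has_real_derivative 2 * z * b z * b1 z + (1 + z\<^sup>2) * b1 z * b1 z + b z * ((1 + z\<^sup>2) * b2 z)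
        + 3 / 2 * (b z)\<^sup>2 + 3 * z * b z * b1 z + v z * (b z)\<^sup>2 / 2 - M z * b z * b1 z) (at z)"
      unfolding F_def
      by (auto intro!: derivative_eq_intros b M simp: power2_eq_square field_simps)
    have e: "b z * ((1 + z\<^sup>2) * b2 z) = b z * (M z * b1 z - 2 * v z * b z - 3 * z * b1 z)"
      using eq[of z] by (metis add_diff_cancel_right')
    have "2 * z * b z * b1 z + (1 + z\<^sup>2) * b1 z * b1 z + b z * ((1 + z\<^sup>2) * b2 z)
        + 3 / 2 * (b z)\<^sup>2 + 3 * z * b z * b1 z + v z * (b z)\<^sup>2 / 2 - M z * b z * b1 z = F1 z"
      unfolding F1_def sq e by (simp add: power2_eq_square field_simps)
    with d show ?thesis by (simp only:)
  qed
  have nonneg: "F1 z \<ge> 0" for z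
    unfolding F1_def using coef[of z] p[of z] by (simp add: less_imp_le)
  have "mono F"
    by (rule monoI, rule DERIV_nonneg_imp_nondecreasing) (use dF nonneg in auto)
  moreover have "\<bar>F z\<bar> \<le> (C\<^sup>2 + 3 / 2 * C\<^sup>2 + C * C\<^sup>2 / 2) / sqrt (1 + z\<^sup>2)" for z
  proof -
    define s where "s = sqrt (1 + z\<^sup>2)"
    have s: "s \<ge> 1" "s\<^sup>2 = 1 + z\<^sup>2" "\<bar>z\<bar> \<le> s"
      using p[of z] abs_le_sqrt_1_plus_square[of z] by (auto simp: s_def)
    have C: "C \<ge> 0" using bd(3)[of z] by linarith
    have b0: "\<bar>b z\<bar> \<le> C / s" and b1: "\<bar>b1 z\<bar> \<le> C / s\<^sup>2" using bd[of z] by (auto simp: s_def)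
    have "(b z)\<^sup>2 \<le> (C / s)\<^sup>2" using power_mono[OF b0, of 2] by simp
    have "\<bar>(1 + z\<^sup>2) * b z * b1 z\<bar> = s\<^sup>2 * (\<bar>b z\<bar> * \<bar>b1 z\<bar>)"
      using p[of z] by (simp add: abs_mult s(2))
    also have "\<dots> \<le> s\<^sup>2 * (C / s * (C / s\<^sup>2))"
      using b0 b1 s(1) C by (intro mult_left_mono mult_mono) auto
    finally have 1: "\<bar>(1 + z\<^sup>2) * b z * b1 z\<bar> \<le> C\<^sup>2 / s"
      using s(1) by (simp add: power2_eq_square)
    have "\<bar>3 / 2 * z * (b z)\<^sup>2\<bar> \<le> 3 / 2 * s * (C / s)\<^sup>2"
      unfolding abs_mult using s \<open>(b z)\<^sup>2 \<le> (C / s)\<^sup>2\<close> by (intro mult_mono) auto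
    then have 2: "\<bar>3 / 2 * z * (b z)\<^sup>2\<bar> \<le> 3 / 2 * C\<^sup>2 / s"
      using s(1) by (simp add: power2_eq_square)
    have "\<bar>M z * (b z)\<^sup>2 / 2\<bar> = \<bar>M z\<bar> * (b z)\<^sup>2 / 2" by (simp add: abs_mult)
    also have "\<dots> \<le> C * (C / s)\<^sup>2 / 2"
      using bd(3)[of z] \<open>(b z)\<^sup>2 \<le> (C / s)\<^sup>2\<close> C by (intro divide_right_mono mult_mono) auto
    also have "\<dots> \<le> C * C\<^sup>2 / 2 / s"
    proof -
      have "C\<^sup>2 / s\<^sup>2 \<le> C\<^sup>2 / s"
        using s(1) by (intro divide_left_mono) (auto simp: power2_eq_square)
      then show ?thesis using C mult_left_mono[of "C\<^sup>2 / s\<^sup>2" "C\<^sup>2 / s" "C / 2"]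
        by (simp add: power_divide)
    qed
    finally have 3: "\<bar>M z * (b z)\<^sup>2 / 2\<bar> \<le> C * C\<^sup>2 / 2 / s" .
    show ?thesis
      using 1 2 3 unfolding F_def s_def[symmetric] add_divide_distrib by linarith
  qed
  ultimately have "F z = 0" for z using mono_decay_zero by blast
  then have "F = (\<lambda>_. 0)" by blast
  then have "F1 z = 0" using dF[of z] DERIV_unique[OF _ DERIV_const] by metis
  moreover have "(1 + z\<^sup>2) * (b1 z + z * b z / (1 + z\<^sup>2))\<^sup>2 \<ge> 0" using p[of z] by simp
  moreover have "(b z)\<^sup>2 * (1 / (1 + z\<^sup>2) + 1 / 2 - 3 / 2 * v z) \<ge> 0" using coef[of z] by simp
  ultimately have "(b z)\<^sup>2 * (1 / (1 + z\<^sup>2) + 1 / 2 - 3 / 2 * v z) = 0" unfolding F1_def by linarith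
  then show "b z = 0" using coef[of z] by simp
qed

text \<open>Every term on the right contains M, so M vanishes identically or nowhere. In the second
  case boundedness of M keeps the denominator a s - z, with s = sqrt (1 + z^2), away from 0. For
  \<bar>a\<bar> < 1 it has the zero z = a / sqrt (1 - a^2); for a = 1 it tends to 0 at +infinity,
  and for a = -1 at -infinity.\<close>

lemma landau_ode_solutions:
  fixes M M1 :: "real \<Rightarrow> real"
  assumes M: "\<And>z. (M has_real_derivative M1 z) (at z)"
    and eq: "\<And>z. (1 + z\<^sup>2) * M1 z = (M z)\<^sup>2 / 2 - z * M z"
    and bd: "\<And>z. \<bar>M z\<bar> \<le> C"
  shows "(\<forall>z. M z = 0) \<or> (\<exists>a. \<bar>a\<bar> > 1 \<and> (\<forall>z. M z = 2 / (a * sqrt (1 + z\<^sup>2) - z)))"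
proof (cases "\<exists>z. M z = 0")
  case True
  then obtain z0 where z0: "M z0 = 0" by blast
  have p: "1 + z\<^sup>2 > 0" for z :: real using add_pos_nonneg[of 1 "z\<^sup>2"] by auto
  have "continuous_on UNIV M" by (rule DERIV_imp_continuous_on_UNIV[OF M])
  then have "continuous_on UNIV (\<lambda>z. (M z / 2 - z) / (1 + z\<^sup>2))"
    using p by (auto intro!: continuous_intros simp: less_imp_neq[symmetric])
  moreover have "(M has_real_derivative ((M z / 2 - z) / (1 + z\<^sup>2)) * M z) (at z)" for z
  proof -
    have "M1 z = ((M z)\<^sup>2 / 2 - z * M z) / (1 + z\<^sup>2)"
      using eq[of z] p[of z] by (simp add: field_simps)
    then have "M1 z = ((M z / 2 - z) / (1 + z\<^sup>2)) * M z"
      by (simp add: power2_eq_square algebra_simps)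
    then show ?thesis using M[of z] by simp
  qed
  ultimately have "M z = 0" for z
    using linear_ode_zero[of M "\<lambda>z. (M z / 2 - z) / (1 + z\<^sup>2)" z0] z0 by blast
  then show ?thesis by blast
next
  case False
  then have nz: "M z \<noteq> 0" for z by blast
  define s where "s = (\<lambda>z::real. sqrt (1 + z\<^sup>2))"
  have s: "s z \<ge> 1" "(s z)\<^sup>2 = 1 + z\<^sup>2" "\<bar>z\<bar> \<le> s z" "s z > 0" for z
    using add_pos_nonneg[of 1 "z\<^sup>2"] abs_le_sqrt_1_plus_square[of z] by (auto simp: s_def)
  have ds: "(s has_real_derivative z / s z) (at z)" for z
    unfolding s_def by (rule has_real_derivative_sqrt_1_plus_square)
  \<comment> \<open>Bernoulli substitution: y = 1 / (M s) satisfies y' = - 1 / (2 s^3), which is the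
    negative of the derivative of z / (2 s).\<close>
  have "((\<lambda>z. 1 / (M z * s z) + z / s z / 2) has_real_derivative 0) (at z)" for z
  proof -
    have "M1 z * s z + M z * (z / s z) = ((s z)\<^sup>2 * M1 z + z * M z) / s z"
      using s(4)[of z] by (simp add: field_simps power2_eq_square)
    also have "\<dots> = (M z)\<^sup>2 / (2 * s z)" using eq[of z] by (simp add: s(2))
    finally have 1: "M1 z * s z + M z * (z / s z) = (M z)\<^sup>2 / (2 * s z)" .
    have 2: "s z * s z - z * z = 1" using s(2)[of z] by (simp add: power2_eq_square)
    have 3: "(s z - z * (z / s z)) / (s z * s z) = 1 / (s z * (s z * s z))"
      using s(4)[of z] 2 by (simp add: field_simps)
    have "((\<lambda>z. 1 / (M z * s z) + z / s z / 2) has_real_derivative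
      - (M1 z * s z + M z * (z / s z)) / ((M z * s z) * (M z * s z))
        + (s z - z * (z / s z)) / (s z * s z) / 2) (at z)"
      using nz[of z] s(4)[of z]
      by (intro DERIV_add DERIV_cdivide) (auto intro!: derivative_eq_intros M ds)
    then show ?thesis unfolding 1 3
      using nz[of z] s(4)[of z] by (simp add: power2_eq_square)
  qed
  then have const: "1 / (M z * s z) + z / s z / 2 = 1 / (M 0 * s 0) + 0 / s 0 / 2" for z
    using DERIV_isconst_all[of "\<lambda>z. 1 / (M z * s z) + z / s z / 2" z 0] by blast
  define a where "a = 2 / (M 0 * s 0)"
  have a: "1 / (M z * s z) + z / s z / 2 = a / 2" for z
    using const[of z] by (simp add: a_def)
  have eqM: "(a * s z - z) * M z = 2" for z
    using a[of z] nz[of z] s(4)[of z] by (simp add: field_simps)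
  have ne: "a * s z - z \<noteq> 0" for z using eqM[of z] by auto
  have form: "M z = 2 / (a * s z - z)" for z
    using eqM[of z] ne[of z] by (simp add: field_simps)
  have "C > 0" using bd[of 0] nz[of 0] by linarith
  have far: "\<bar>a * s z - z\<bar> \<ge> 2 / C" for z
  proof -
    have "2 = \<bar>a * s z - z\<bar> * \<bar>M z\<bar>" using eqM[of z] by (simp add: abs_mult[symmetric])
    also have "\<dots> \<le> \<bar>a * s z - z\<bar> * C" using bd[of z] by (simp add: mult_left_mono)
    finally show ?thesis using \<open>C > 0\<close> by (simp add: field_simps)
  qed
  have "\<bar>a\<bar> > 1"
  proof (rule ccontr)
    assume "\<not> \<bar>a\<bar> > 1"
    then consider "\<bar>a\<bar> < 1" | "a = 1" | "a = -1" by linarith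
    then show False
    proof cases
      case 1
      define z where "z = a / sqrt (1 - a\<^sup>2)"
      have a2: "1 - a\<^sup>2 > 0" using 1 by (simp add: abs_square_less_1)
      have "1 + z\<^sup>2 = 1 / (1 - a\<^sup>2)"
        using a2 by (simp add: z_def power_divide field_simps)
      then have "s z = 1 / sqrt (1 - a\<^sup>2)" by (simp add: s_def real_sqrt_divide)
      then have "a * s z - z = 0" by (simp add: z_def)
      then show False using ne by blast
    next
      case 2
      have "((\<lambda>z. sqrt (1 + z\<^sup>2) - z) \<longlongrightarrow> 0) at_top" by real_asymp
      then have "eventually (\<lambda>z. dist (sqrt (1 + z\<^sup>2) - z) 0 < 2 / C) at_top"
        using \<open>C > 0\<close> by (intro tendstoD) auto
      then obtain z where "\<bar>s z - z\<bar> < 2 / C"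
        unfolding eventually_at_top_linorder s_def by (auto simp: dist_real_def)
      then show False using far[of z] 2 by simp
    next
      case 3
      have "((\<lambda>z. - sqrt (1 + z\<^sup>2) - z) \<longlongrightarrow> 0) at_bot" by real_asymp
      then have "eventually (\<lambda>z. dist (- sqrt (1 + z\<^sup>2) - z) 0 < 2 / C) at_bot"
        using \<open>C > 0\<close> by (intro tendstoD) auto
      then obtain z where "\<bar>- s z - z\<bar> < 2 / C"
        unfolding eventually_at_bot_linorder s_def by (auto simp: dist_real_def)
      then show False using far[of z] 3 by simp
    qed
  qed
  with form show ?thesis unfolding s_def by blast
qed

section \<open>Reduction to the slice\<close>

lemma cyl_nth [simp]: "cyl r \<theta> z $ 1 = r * cos \<theta>" "cyl r \<theta> z $ 2 = r * sin \<theta>" "cyl r \<theta> z $ 3 = z"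
  by (simp_all add: cyl_def)

lemma cyl_polar:
  obtains \<theta> where "x = cyl (cyl_radius x) \<theta> (x $ 3)"
proof (cases "x $ 1 \<noteq> 0 \<or> x $ 2 \<noteq> 0")
  case True
  then obtain \<theta> where *: "x = cyl_radius x *\<^sub>R rot \<theta> (slice (x $ 3 / cyl_radius x))" "cyl_radius x > 0"
    by (rule polar_slice)
  have "x = cyl (cyl_radius x) \<theta> (x $ 3)"
    using *(2) by (subst *(1)) (simp add: vec3_eq_iff)
  then show ?thesis by (rule that)
next
  case False
  then have "x = cyl (cyl_radius x) 0 (x $ 3)"
    by (simp add: vec3_eq_iff cyl_radius_def)
  then show ?thesis by (rule that)
qed

lemma axisymmetric_with_components:
  assumes "axisymmetric_with wr wt wz w" "r \<ge> 0" "(r, z) \<noteq> (0, 0)"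
  shows "w (cyl r \<theta> z) $ 1 = wr r z * cos \<theta> - wt r z * sin \<theta>"
    "w (cyl r \<theta> z) $ 2 = wr r z * sin \<theta> + wt r z * cos \<theta>"
    "w (cyl r \<theta> z) $ 3 = wz r z"
  using assms unfolding axisymmetric_with_def by (simp_all add: e_r_def e_theta_def e_z_def)

lemma axisymmetric_with_rot:
  assumes "axisymmetric_with wr wt wz w" "x \<noteq> 0"
  shows "w (rot \<theta> x) = rot \<theta> (w x)"
proof -
  obtain \<phi> where x: "x = cyl (cyl_radius x) \<phi> (x $ 3)" by (rule cyl_polar)
  define r z where "r = cyl_radius x" and "z = x $ 3"
  have x': "x = cyl r \<phi> z" using x unfolding r_def z_def .
  have r: "r \<ge> 0" by (simp add: r_def cyl_radius_def)
  have rz: "(r, z) \<noteq> (0, 0)"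
    using assms(2) x' by (auto simp: vec3_eq_iff)
  have R: "rot \<theta> x = cyl r (\<phi> + \<theta>) z"
    by (simp add: x' vec3_eq_iff cos_add sin_add algebra_simps)
  show ?thesis unfolding R
    by (simp add: x' vec3_eq_iff axisymmetric_with_components[OF assms(1) r rz] cos_add sin_add algebra_simps)
qed

text \<open>The operator - x_2 d_1 + x_1 d_2 generates the rotations about the axis; the identity is
  the rotation law differentiated at angle 0.\<close>

lemma spin_identity:
  fixes w :: "real^3 \<Rightarrow> real"
  assumes "w differentiable (at x)" "\<And>\<theta>. w (rot \<theta> x) = cos \<theta> * a + sin \<theta> * b"
  shows "- x $ 2 * partial 1 w x + x $ 1 * partial 2 w x = b"
proof -
  have "((\<lambda>\<theta>. w (rot \<theta> x)) has_real_derivative b) (at 0)"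
    unfolding assms(2) by (auto intro!: derivative_eq_intros)
  then show ?thesis using has_real_derivative_rot[OF assms(1)] DERIV_unique by blast
qed

lemma homogeneous_bound_slice:
  fixes f :: "real^3 \<Rightarrow> real"
  assumes "homogeneous (- int n) f" "continuous_on (- {0}) f"
  obtains C where "C > 0" "\<And>z. \<bar>f (slice z)\<bar> \<le> C / sqrt (1 + z\<^sup>2) ^ n"
proof -
  obtain C where C: "C > 0" "\<And>x. x \<noteq> 0 \<Longrightarrow> \<bar>f x\<bar> \<le> C * norm x powi - int n"
    using homogeneous_bound[OF assms] by blast
  have "\<bar>f (slice z)\<bar> \<le> C / sqrt (1 + z\<^sup>2) ^ n" for z
    using C(2)[of "slice z"] by (simp add: norm_slice power_int_minus divide_inverse)
  with C(1) show ?thesis by (rule that)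
qed

section \<open>The MHD system on the slice and the vanishing of the magnetic field\<close>

locale self_similar_mhd =
  fixes u B :: "real^3 \<Rightarrow> real^3" and p :: "real^3 \<Rightarrow> real"
    and ur ut uz Bt :: "real \<Rightarrow> real \<Rightarrow> real"
  assumes smooth_u: "smooth_on (- {0}) u" and smooth_B: "smooth_on (- {0}) B"
    and smooth_p: "smooth_on (- {0}) p"
    and mhd: "stationary_mhd u B p"
    and similar: "self_similar u B p"
    and axisym_u: "axisymmetric_with ur ut uz u"
    and axisym_B: "axisymmetric_with (\<lambda>r z. 0) Bt (\<lambda>r z. 0) B"
begin

lemma homogeneous_u: "homogeneous (-1) u"
  and homogeneous_B: "homogeneous (-1) B"
  and homogeneous_p: "homogeneous (-2) p"
  unfolding homogeneous_def
proof safe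
  fix c :: real and x :: "real^3" assume c: "c > 0" and x: "x \<noteq> 0"
  have "u x = c *\<^sub>R u (c *\<^sub>R x)" "B x = c *\<^sub>R B (c *\<^sub>R x)" "p x = c\<^sup>2 * p (c *\<^sub>R x)"
    using similar c x unfolding self_similar_def by blast+
  then show "u (c *\<^sub>R x) = c powi - 1 *\<^sub>R u x" "B (c *\<^sub>R x) = c powi - 1 *\<^sub>R B x"
    "p (c *\<^sub>R x) = c powi - 2 *\<^sub>R p x"
    using c by (simp_all add: power_int_minus)
qed

abbreviation U where "U j x \<equiv> u x $ j"
abbreviation H where "H j x \<equiv> B x $ j"

lemma smooth_U: "smooth_on (- {0}) (U j)" and smooth_H: "smooth_on (- {0}) (H j)"
  by (auto intro: smooth_on_component smooth_u smooth_B)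

lemma homogeneous_U: "homogeneous (-1) (U j)" and homogeneous_H: "homogeneous (-1) (H j)"
  using homogeneous_u homogeneous_B by (simp_all add: homogeneous_def)

lemma differentiable:
  assumes "x \<noteq> 0"
  shows "U j differentiable (at x)" "H j differentiable (at x)" "p differentiable (at x)"
    "partial i (U j) differentiable (at x)" "partial i (H j) differentiable (at x)"
  using assms smooth_U smooth_H smooth_p smooth_on_partial smooth_on_differentiable by blast+

lemma U_rot:
  assumes "x \<noteq> 0"
  shows "U 1 (rot \<theta> x) = cos \<theta> * U 1 x - sin \<theta> * U 2 x"
    "U 2 (rot \<theta> x) = sin \<theta> * U 1 x + cos \<theta> * U 2 x" "U 3 (rot \<theta> x) = U 3 x"
  using axisymmetric_with_rot[OF axisym_u assms] by simp_all

lemma H_rot: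
  assumes "x \<noteq> 0"
  shows "H 1 (rot \<theta> x) = cos \<theta> * H 1 x - sin \<theta> * H 2 x"
    "H 2 (rot \<theta> x) = sin \<theta> * H 1 x + cos \<theta> * H 2 x" "H 3 (rot \<theta> x) = H 3 x"
  using axisymmetric_with_rot[OF axisym_B assms] by simp_all

lemma slice_eq_cyl: "slice z = cyl 1 0 z"
  by (simp add: vec3_eq_iff)

lemma H_slice: "H 1 (slice z) = 0" "H 3 (slice z) = 0"
  using axisymmetric_with_components[OF axisym_B, of 1 z 0] by (simp_all add: slice_eq_cyl)

lemma U_spin:
  assumes "x \<noteq> 0"
  shows "- x $ 2 * partial 1 (U 1) x + x $ 1 * partial 2 (U 1) x = - U 2 x"
    "- x $ 2 * partial 1 (U 2) x + x $ 1 * partial 2 (U 2) x = U 1 x"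
    "- x $ 2 * partial 1 (U 3) x + x $ 1 * partial 2 (U 3) x = 0"
proof -
  show "- x $ 2 * partial 1 (U 1) x + x $ 1 * partial 2 (U 1) x = - U 2 x"
    by (rule spin_identity[where a = "U 1 x"]) (simp_all add: differentiable U_rot assms)
  show "- x $ 2 * partial 1 (U 2) x + x $ 1 * partial 2 (U 2) x = U 1 x"
    by (rule spin_identity[where a = "U 2 x"]) (simp_all add: differentiable U_rot assms)
  have "((\<lambda>\<theta>. U 3 (rot \<theta> x)) has_real_derivative 0) (at 0)"
    by (simp add: U_rot assms)
  then show "- x $ 2 * partial 1 (U 3) x + x $ 1 * partial 2 (U 3) x = 0"
    using has_real_derivative_rot[OF differentiable(1)[OF assms, of 3]] DERIV_unique by blast
qed

lemma H_spin:
  assumes "x \<noteq> 0"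
  shows "- x $ 2 * partial 1 (H 1) x + x $ 1 * partial 2 (H 1) x = - H 2 x"
    "- x $ 2 * partial 1 (H 2) x + x $ 1 * partial 2 (H 2) x = H 1 x"
proof -
  show "- x $ 2 * partial 1 (H 1) x + x $ 1 * partial 2 (H 1) x = - H 2 x"
    by (rule spin_identity[where a = "H 1 x"]) (simp_all add: differentiable H_rot assms)
  show "- x $ 2 * partial 1 (H 2) x + x $ 1 * partial 2 (H 2) x = H 1 x"
    by (rule spin_identity[where a = "H 2 x"]) (simp_all add: differentiable H_rot assms)
qed

lemma partial_uminus_U: "x \<noteq> 0 \<Longrightarrow> partial i (\<lambda>x. - U 2 x) x = - partial i (U 2) x"
  by (rule partial_linear[OF bounded_linear_minus[OF bounded_linear_ident]]) (rule differentiable)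

text \<open>The undifferentiated term in the Laplacian of \<open>slice_identities\<close> is
  cancelled for the components 1 and 2 by the angular derivative that couples them. Component 3 is
  rotation invariant, so there the term stays.\<close>

lemma U_slice:
  shows "partial 1 (U j) (slice z) = - U j (slice z) - z * partial 3 (U j) (slice z)"
    "partial 2 (U 1) (slice z) = - U 2 (slice z)"
    "partial 2 (U 2) (slice z) = U 1 (slice z)"
    "partial 2 (U 3) (slice z) = 0"
    "laplacian (U 1) (slice z) = (1 + z\<^sup>2) * partial 3 (partial 3 (U 1)) (slice z)
       + 3 * z * partial 3 (U 1) (slice z)"
    "laplacian (U 2) (slice z) = (1 + z\<^sup>2) * partial 3 (partial 3 (U 2)) (slice z)
       + 3 * z * partial 3 (U 2) (slice z)"
    "laplacian (U 3) (slice z) = (1 + z\<^sup>2) * partial 3 (partial 3 (U 3)) (slice z)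
       + 3 * z * partial 3 (U 3) (slice z) + U 3 (slice z)"
proof -
  have d: "(\<lambda>x. - U 2 x) differentiable (at (slice z))"
    by (intro derivative_intros differentiable) simp
  note s1 = slice_identities[OF smooth_U homogeneous_U U_spin(1) d]
  note s2 = slice_identities[OF smooth_U homogeneous_U U_spin(2) differentiable(1)[OF slice_nonzero]]
  note s3 = slice_identities[OF smooth_U homogeneous_U U_spin(3) differentiable_const]
  have "j = 1 \<or> j = 2 \<or> j = 3" using exhaust_3 by blast
  then show "partial 1 (U j) (slice z) = - U j (slice z) - z * partial 3 (U j) (slice z)"
    using s1(1) s2(1) s3(1) by blast
  show p21: "partial 2 (U 1) (slice z) = - U 2 (slice z)" by (rule s1(2))
  show p22: "partial 2 (U 2) (slice z) = U 1 (slice z)" by (rule s2(2))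
  show "partial 2 (U 3) (slice z) = 0" by (rule s3(2))
  show "laplacian (U 1) (slice z) = (1 + z\<^sup>2) * partial 3 (partial 3 (U 1)) (slice z)
       + 3 * z * partial 3 (U 1) (slice z)"
    using s1(3) partial_uminus_U[OF slice_nonzero, of 2 z] p22 by simp
  show "laplacian (U 2) (slice z) = (1 + z\<^sup>2) * partial 3 (partial 3 (U 2)) (slice z)
       + 3 * z * partial 3 (U 2) (slice z)"
    using s2(3) p21 by simp
  have "partial 2 (\<lambda>x::real^3. 0::real) (slice z) = 0"
    using partial_eqI[OF has_derivative_const, of 2 "0::real" "slice z"] by simp
  then show "laplacian (U 3) (slice z) = (1 + z\<^sup>2) * partial 3 (partial 3 (U 3)) (slice z)
       + 3 * z * partial 3 (U 3) (slice z) + U 3 (slice z)"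
    using s3(3) by simp
qed

lemma H2_slice:
  shows "partial 1 (H 2) (slice z) = - H 2 (slice z) - z * partial 3 (H 2) (slice z)"
    "partial 2 (H 2) (slice z) = 0"
    "laplacian (H 2) (slice z) = (1 + z\<^sup>2) * partial 3 (partial 3 (H 2)) (slice z)
       + 3 * z * partial 3 (H 2) (slice z)"
proof -
  note s2 = slice_identities[OF smooth_H homogeneous_H H_spin(2) differentiable(2)[OF slice_nonzero]]
  show "partial 1 (H 2) (slice z) = - H 2 (slice z) - z * partial 3 (H 2) (slice z)"
    "partial 2 (H 2) (slice z) = 0"
    using s2(1,2) H_slice by simp_all
  have "partial 2 (H 1) (slice z) = - H 2 (slice z)"
    using H_spin(1)[of "slice z"] by simp
  with s2(3) show "laplacian (H 2) (slice z) = (1 + z\<^sup>2) * partial 3 (partial 3 (H 2)) (slice z)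
       + 3 * z * partial 3 (H 2) (slice z)" by simp
qed

lemma momentum:
  assumes "x \<noteq> 0"
  shows "- laplacian (U j) x + (\<Sum>i\<in>UNIV. U i x * partial i (U j) x)
    - (\<Sum>i\<in>UNIV. H i x * partial i (H j) x) + partial j p x = 0"
proof -
  have x: "x \<in> - {0}" and o: "open (- {0} :: (real^3) set)" using assms by auto
  have "(- laplacian u x + advect u u x - advect B B x + gradient p x) $ j = 0"
    using mhd assms unfolding stationary_mhd_def by simp
  then show ?thesis
    by (simp add: laplacian_component[OF o x smooth_u] advect_def gradient_def
        partial_component[OF smooth_on_differentiable[OF smooth_u x]]
        partial_component[OF smooth_on_differentiable[OF smooth_B x]])
qed

lemma induction_equation:
  assumes "x \<noteq> 0"
  shows "- laplacian (H j) x + (\<Sum>i\<in>UNIV. U i x * partial i (H j) x)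
    - (\<Sum>i\<in>UNIV. H i x * partial i (U j) x) = 0"
proof -
  have x: "x \<in> - {0}" and o: "open (- {0} :: (real^3) set)" using assms by auto
  have "(- laplacian B x + advect u B x - advect B u x) $ j = 0"
    using mhd assms unfolding stationary_mhd_def by simp
  then show ?thesis
    by (simp add: laplacian_component[OF o x smooth_B] advect_def
        partial_component[OF smooth_on_differentiable[OF smooth_u x]]
        partial_component[OF smooth_on_differentiable[OF smooth_B x]])
qed

lemma incompressible:
  assumes "x \<noteq> 0"
  shows "partial 1 (U 1) x + partial 2 (U 2) x + partial 3 (U 3) x = 0"
proof -
  have "divergence u x = 0" using mhd assms unfolding stationary_mhd_def by blast
  then show ?thesis
    using smooth_on_differentiable[OF smooth_u, of x] assms
    by (simp add: divergence_def sum_3 partial_component)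
qed

definition v where "v j z = u (slice z) $ j"
definition v' where "v' j z = partial 3 (U j) (slice z)"
definition v'' where "v'' j z = partial 3 (partial 3 (U j)) (slice z)"
text \<open>On the slice, Euler's identity turns the derivative of a (-1)-homogeneous w along u into
  M w' - v_1 w, up to the swirl term. M is therefore the transport coefficient in all the equations
  that follow.\<close>

definition M where "M z = v 3 z - z * v 1 z"

lemma v_deriv: "(v j has_real_derivative v' j z) (at z)" "(v' j has_real_derivative v'' j z) (at z)"
  unfolding v_def v'_def v''_def
  by (auto intro!: has_real_derivative_slice differentiable)

lemma v3': "v' 3 z = z * v' 1 z"
  using incompressible[of "slice z"] by (simp add: U_slice v'_def)

lemma M_deriv: "(M has_real_derivative - v 1 z) (at z)"
proof -
  have "((\<lambda>z. v 3 z - z * v 1 z) has_real_derivative v' 3 z - (v 1 z + z * v' 1 z)) (at z)"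
    by (auto intro!: derivative_eq_intros v_deriv)
  then show ?thesis by (simp add: v3' M_def[abs_def])
qed

lemma v_bound: obtains C where "C > 0" "\<And>j z. \<bar>v j z\<bar> \<le> C / sqrt (1 + z\<^sup>2)"
  "\<And>j z. \<bar>v' j z\<bar> \<le> C / (1 + z\<^sup>2)" "\<And>z. \<bar>M z\<bar> \<le> C"
proof -
  have "\<exists>C>0. \<forall>z. \<bar>v j z\<bar> \<le> C / sqrt (1 + z\<^sup>2) \<and> \<bar>v' j z\<bar> \<le> C / (1 + z\<^sup>2)" for j
  proof -
    have "homogeneous (- int 1) (U j)" using homogeneous_U by simp
    then obtain C1 where C1: "C1 > 0" "\<And>z. \<bar>U j (slice z)\<bar> \<le> C1 / sqrt (1 + z\<^sup>2) ^ 1"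
      using homogeneous_bound_slice smooth_on_continuous[OF smooth_U] by blast
    have "homogeneous (- int 2) (partial 3 (U j))"
      using homogeneous_partial[OF homogeneous_U differentiable(1)] by simp
    then obtain C2 where C2: "C2 > 0" "\<And>z. \<bar>partial 3 (U j) (slice z)\<bar> \<le> C2 / sqrt (1 + z\<^sup>2) ^ 2"
      using homogeneous_bound_slice smooth_on_continuous[OF smooth_on_partial[OF smooth_U]] by blast
    have "\<bar>v j z\<bar> \<le> (C1 + C2) / sqrt (1 + z\<^sup>2) \<and> \<bar>v' j z\<bar> \<le> (C1 + C2) / (1 + z\<^sup>2)" for z
    proof -
      have "1 + z\<^sup>2 \<ge> 0" by simp
      then have "C1 / sqrt (1 + z\<^sup>2) \<le> (C1 + C2) / sqrt (1 + z\<^sup>2)" "C2 / (1 + z\<^sup>2) \<le> (C1 + C2) / (1 + z\<^sup>2)"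
        using C1(1) C2(1) by (auto intro!: divide_right_mono)
      then show ?thesis using C1(2)[of z] C2(2)[of z] by (simp add: v_def v'_def)
    qed
    then show ?thesis using C1(1) C2(1) by (metis add_pos_pos)
  qed
  then obtain C where C: "\<And>j. C j > 0" "\<And>j z. \<bar>v j z\<bar> \<le> C j / sqrt (1 + z\<^sup>2)"
    "\<And>j z. \<bar>v' j z\<bar> \<le> C j / (1 + z\<^sup>2)" by metis
  define K where "K = C 1 + C 2 + C 3"
  have K: "C j \<le> K" for j
    using C(1)[of 1] C(1)[of 2] C(1)[of 3] exhaust_3[of j] by (auto simp: K_def)
  have "\<bar>M z\<bar> \<le> 2 * K" for z
  proof -
    have s: "sqrt (1 + z\<^sup>2) > 0" using sqrt_1_plus_square_ge_1[of z] by linarith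
    have "\<bar>v 3 z\<bar> \<le> C 3 / 1"
      using C(2)[of 3 z] divide_left_mono[OF sqrt_1_plus_square_ge_1[of z], of "C 3"] C(1)[of 3] s
      by simp
    moreover have "\<bar>z * v 1 z\<bar> \<le> sqrt (1 + z\<^sup>2) * (C 1 / sqrt (1 + z\<^sup>2))"
      unfolding abs_mult using C(2)[of 1 z] abs_le_sqrt_1_plus_square[of z] s by (intro mult_mono) auto
    ultimately show ?thesis using K[of 1] K[of 3] s unfolding M_def by simp
  qed
  moreover have "\<bar>v j z\<bar> \<le> 2 * K / sqrt (1 + z\<^sup>2)" "\<bar>v' j z\<bar> \<le> 2 * K / (1 + z\<^sup>2)" for j z
  proof -
    have "C j \<le> 2 * K" using K[of j] C(1)[of j] by linarith
    moreover have "1 + z\<^sup>2 \<ge> 0" by simp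
    ultimately have "C j / sqrt (1 + z\<^sup>2) \<le> 2 * K / sqrt (1 + z\<^sup>2)" "C j / (1 + z\<^sup>2) \<le> 2 * K / (1 + z\<^sup>2)"
      by (auto intro!: divide_right_mono)
    then show "\<bar>v j z\<bar> \<le> 2 * K / sqrt (1 + z\<^sup>2)" "\<bar>v' j z\<bar> \<le> 2 * K / (1 + z\<^sup>2)"
      using C(2)[of j z] C(3)[of j z] by linarith+
  qed
  moreover have "2 * K > 0" using K[of 1] C(1)[of 1] by linarith
  ultimately show ?thesis using that[of "2 * K"] by blast
qed

text \<open>The point \<open>slice z\<close> lies at distance sqrt (1 + z^2) from the origin;
  dividing by this distance moves it to the unit sphere and multiplies u by it.\<close>

lemma v1_le:
  assumes "\<forall>x \<in> sphere 0 1. ur (cyl_radius x) (x $ 3) \<le> \<alpha>"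
  shows "v 1 z \<le> \<alpha> / sqrt (1 + z\<^sup>2)"
proof -
  define s where "s = sqrt (1 + z\<^sup>2)"
  have s: "s > 0" using sqrt_1_plus_square_ge_1[of z] unfolding s_def by linarith
  define y where "y = inverse s *\<^sub>R slice z"
  have y: "y \<noteq> 0" "norm y = 1" "y = cyl (1 / s) 0 (z / s)" "cyl_radius y = 1 / s"
    using s by (simp_all add: y_def norm_slice s_def[symmetric] vec3_eq_iff divide_inverse cyl_radius_def)
  have "slice z = s *\<^sub>R y" using s by (simp add: y_def)
  then have "v 1 z = U 1 y / s"
    using homogeneousD[OF homogeneous_U s y(1), of 1] by (simp add: v_def power_int_minus divide_inverse)
  moreover have "U 1 y = ur (1 / s) (z / s)"
    using axisymmetric_with_components(1)[OF axisym_u, of "1 / s" "z / s" 0] s by (simp add: y(3))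
  moreover have "ur (1 / s) (z / s) \<le> \<alpha>"
    using assms y s by (metis (no_types) cyl_nth(3) mem_sphere_0)
  ultimately show ?thesis using s by (simp add: divide_right_mono s_def)
qed

lemma H2_slice_zero:
  assumes "\<forall>x \<in> sphere 0 1. ur (cyl_radius x) (x $ 3) \<le> \<alpha>" "\<alpha> < 2 * sqrt 2 / 3"
  shows "H 2 (slice z) = 0"
proof -
  define b b1 b2 where "b = (\<lambda>z. H 2 (slice z))" and "b1 = (\<lambda>z. partial 3 (H 2) (slice z))"
    and "b2 = (\<lambda>z. partial 3 (partial 3 (H 2)) (slice z))"
  have "homogeneous (- int 1) (H 2)" using homogeneous_H by simp
  then obtain C1 where C1: "C1 > 0" "\<And>z. \<bar>H 2 (slice z)\<bar> \<le> C1 / sqrt (1 + z\<^sup>2) ^ 1"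
    using homogeneous_bound_slice smooth_on_continuous[OF smooth_H] by blast
  have "homogeneous (- int 2) (partial 3 (H 2))"
    using homogeneous_partial[OF homogeneous_H differentiable(2)] by simp
  then obtain C2 where C2: "C2 > 0" "\<And>z. \<bar>partial 3 (H 2) (slice z)\<bar> \<le> C2 / sqrt (1 + z\<^sup>2) ^ 2"
    using homogeneous_bound_slice smooth_on_continuous[OF smooth_on_partial[OF smooth_H]] by blast
  obtain C3 where C3: "C3 > 0" "\<And>z. \<bar>M z\<bar> \<le> C3" using v_bound by metis
  define C where "C = C1 + C2 + C3"
  have bd: "\<bar>b z\<bar> \<le> C / sqrt (1 + z\<^sup>2)" "\<bar>b1 z\<bar> \<le> C / (1 + z\<^sup>2)" "\<bar>M z\<bar> \<le> C" for z
  proof -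
    have "1 + z\<^sup>2 \<ge> 0" by simp
    then have "C1 / sqrt (1 + z\<^sup>2) \<le> C / sqrt (1 + z\<^sup>2)" "C2 / (1 + z\<^sup>2) \<le> C / (1 + z\<^sup>2)"
      using C1(1) C2(1) C3(1) by (auto intro!: divide_right_mono simp: C_def)
    then show "\<bar>b z\<bar> \<le> C / sqrt (1 + z\<^sup>2)" "\<bar>b1 z\<bar> \<le> C / (1 + z\<^sup>2)" "\<bar>M z\<bar> \<le> C"
      using C1(1) C2(1) C1(2)[of z] C2(2)[of z] C3(2)[of z] by (simp_all add: C_def b_def b1_def)
  qed
  have "b z = 0"
  proof (rule magnetic_ode_zero[OF _ _ M_deriv _ v1_le[OF assms(1)] assms(2) bd])
    show "(b has_real_derivative b1 z) (at z)" "(b1 has_real_derivative b2 z) (at z)" for z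
      unfolding b_def b1_def b2_def by (auto intro!: has_real_derivative_slice differentiable)
    \<comment> \<open>One of the two copies of v_1 b comes from the radial derivative of B by
      Euler's identity, the other from the stretching term, where the angular derivative of
      \<open>U 2\<close> is v_1.\<close>
    show "(1 + z\<^sup>2) * b2 z + 3 * z * b1 z = M z * b1 z - 2 * v 1 z * b z" for z
      using induction_equation[of "slice z" 2]
      by (simp add: sum_3 H_slice H2_slice U_slice b_def b1_def b2_def M_def v_def algebra_simps)
  qed
  then show ?thesis by (simp add: b_def)
qed

lemma B_zero:
  assumes "\<And>z. H 2 (slice z) = 0" "x \<noteq> 0"
  shows "B x = 0"
proof (cases "x $ 1 \<noteq> 0 \<or> x $ 2 \<noteq> 0")
  case True
  define z where "z = x $ 3 / cyl_radius x"
  obtain \<theta> where x: "x = cyl_radius x *\<^sub>R rot \<theta> (slice z)" "cyl_radius x > 0"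
    using polar_slice[OF True] unfolding z_def by blast
  have "B (slice z) = 0" by (simp add: vec3_eq_iff H_slice assms(1))
  then have "B (rot \<theta> (slice z)) = 0"
    using axisymmetric_with_rot[OF axisym_B, of "slice z" \<theta>] by (simp add: vec3_eq_iff)
  then show ?thesis
    using homogeneousD[OF homogeneous_B x(2), of "rot \<theta> (slice z)"] x(1) by simp
next
  case False
  \<comment> \<open>On the axis every angle describes the same point; the angles 0 and pi give the
    azimuthal component opposite signs.\<close>
  then have x: "x = cyl 0 0 (x $ 3)" "x = cyl 0 pi (x $ 3)" "x $ 3 \<noteq> 0"
    using assms(2) by (auto simp: vec3_eq_iff)
  have "B x $ 1 = 0" "B x $ 3 = 0" "B x $ 2 = Bt 0 (x $ 3)"
    using axisymmetric_with_components[OF axisym_B, of 0 "x $ 3" 0] x(3) x(1)[symmetric] by simp_all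
  moreover have "B x $ 2 = - Bt 0 (x $ 3)"
    using axisymmetric_with_components[OF axisym_B, of 0 "x $ 3" pi] x(3) x(2)[symmetric] by simp
  ultimately show ?thesis by (simp add: vec3_eq_iff)
qed

end

section \<open>The remaining Navier-Stokes system: pressure, swirl and the Riccati equation\<close>

locale self_similar_ns = self_similar_mhd +
  assumes no_field: "\<And>x. x \<noteq> 0 \<Longrightarrow> B x = 0"
begin

lemma ns_momentum:
  assumes "x \<noteq> 0"
  shows "partial j p x = laplacian (U j) x - (U 1 x * partial 1 (U j) x + U 2 x * partial 2 (U j) x
    + U 3 x * partial 3 (U j) x)"
  using momentum[OF assms, of j] no_field[OF assms] by (simp add: sum_3)

text \<open>The vertical momentum equation expresses this derivative through u alone, and each term
  on its right-hand side is rotation invariant.\<close>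

lemma partial3_p_rot:
  assumes "x \<noteq> 0"
  shows "partial 3 p (rot \<theta> x) = partial 3 p x"
proof -
  have rx: "rot \<theta> x \<noteq> 0" using assms by simp
  note inv = partial_rot_invariant[of "U 3" \<theta>, OF U_rot(3) differentiable(1) assms]
  have lap: "laplacian (U 3) (rot \<theta> x) = laplacian (U 3) x"
    by (rule laplacian_rot_invariant[OF U_rot(3) smooth_U assms])
  have *: "(c * a - s * b) * d + (s * a + c * b) * e + f = a * (c * d + s * e) + b * (- s * d + c * e) + f"
    for a b c d e f s :: real by (simp add: algebra_simps)
  show ?thesis
    unfolding ns_momentum[OF rx] ns_momentum[OF assms] lap U_rot[OF assms] *
    by (simp add: inv)
qed

text \<open>By invariance of the vertical derivative, p and its rotated copy differ by a constant
  along each vertical line, and both decay like 1 / s^2 at height s. A point off the axis is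
  required so that the line misses the origin.\<close>

lemma p_rot:
  assumes "x $ 1 \<noteq> 0 \<or> x $ 2 \<noteq> 0"
  shows "p (rot \<theta> x) = p x"
proof -
  define y :: "real^3" where "y = vector [x $ 1, x $ 2, 0]"
  define h where "h = (\<lambda>s. p (rot \<theta> y + s *\<^sub>R axis 3 1) - p (y + s *\<^sub>R axis 3 1))"
  have yn: "(y + s *\<^sub>R axis 3 1) $ 1 = x $ 1" "(y + s *\<^sub>R axis 3 1) $ 2 = x $ 2" "(y + s *\<^sub>R axis 3 1) $ 3 = s" for s
    by (simp_all add: y_def axis_def)
  have ry: "rot \<theta> y + s *\<^sub>R axis 3 1 = rot \<theta> (y + s *\<^sub>R axis 3 1)" for s
    by (simp add: vec3_eq_iff axis_def)
  have nz: "y + s *\<^sub>R axis 3 1 \<noteq> 0" for s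
    using assms yn[of s] by (auto simp: vec3_eq_iff)
  then have nz': "rot \<theta> y + s *\<^sub>R axis 3 1 \<noteq> 0" for s
    unfolding ry by simp
  have "(h has_real_derivative partial 3 p (rot \<theta> y + s *\<^sub>R axis 3 1) - partial 3 p (y + s *\<^sub>R axis 3 1)) (at s)" for s
    unfolding h_def
    by (intro DERIV_diff has_real_derivative_partial differentiable nz nz')
  then have "(h has_real_derivative 0) (at s)" for s
    unfolding ry partial3_p_rot[OF nz] by simp
  then have const: "h s = h t" for s t using DERIV_isconst_all by blast
  obtain C where C: "C > 0" "\<And>x. x \<noteq> 0 \<Longrightarrow> \<bar>p x\<bar> \<le> C * norm x powi - 2"
    using homogeneous_bound[OF homogeneous_p smooth_on_continuous[OF smooth_p]] by blast
  have pb: "\<bar>p w\<bar> \<le> C / s\<^sup>2" if "w \<noteq> 0" "norm w \<ge> s" "s > 0" for w s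
  proof -
    have "C / (norm w)\<^sup>2 \<le> C / s\<^sup>2"
      using that C(1) by (intro divide_left_mono) (auto simp: power_mono)
    then show ?thesis using C(2)[OF that(1)] by (simp add: power_int_minus divide_inverse)
  qed
  have "\<bar>h s\<bar> \<le> C / s\<^sup>2 + C / s\<^sup>2" if "s > 0" for s
  proof -
    have "norm (y + s *\<^sub>R axis 3 1) \<ge> s"
      unfolding norm3 yn by (rule real_le_rsqrt) simp
    then show ?thesis
      using pb[OF nz[of s] _ that] pb[OF nz'[of s] _ that] unfolding h_def ry by (simp del: ry)
  qed
  then have "norm (h 0) \<le> C / s\<^sup>2 + C / s\<^sup>2" if "s > 0" for s
    using that unfolding real_norm_def const[of 0 s] .
  then have "eventually (\<lambda>s. norm (h 0) \<le> C / s\<^sup>2 + C / s\<^sup>2) at_top"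
    by (rule eventually_mono[OF eventually_gt_at_top[of 0]])
  moreover have "((\<lambda>s. C / s\<^sup>2 + C / s\<^sup>2) \<longlongrightarrow> 0) at_top" by real_asymp
  ultimately have "((\<lambda>s::real. h 0) \<longlongrightarrow> 0) at_top" by (rule Lim_null_comparison)
  then have "h 0 = 0" by (simp add: tendsto_const_iff)
  then have "h (x $ 3) = 0" using const by metis
  moreover have "y + (x $ 3) *\<^sub>R axis 3 1 = x" using yn[of "x $ 3"] by (simp add: vec3_eq_iff)
  ultimately show ?thesis unfolding h_def ry by simp
qed

lemma partial2_p_slice: "partial 2 p (slice z) = 0"
proof -
  have "((\<lambda>\<theta>. p (rot \<theta> (slice z))) has_real_derivative 0) (at 0)"
    by (simp add: p_rot)
  then show ?thesis
    using has_real_derivative_rot[OF differentiable(3)[OF slice_nonzero, of z]] DERIV_unique by fastforce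
qed

definition P where "P z = p (slice z)"
definition P' where "P' z = partial 3 p (slice z)"

lemma P_deriv: "(P has_real_derivative P' z) (at z)"
  unfolding P_def P'_def by (auto intro!: has_real_derivative_slice differentiable)

lemma partial1_p_slice: "partial 1 p (slice z) = - 2 * P z - z * P' z"
  using euler_homogeneous[OF homogeneous_p differentiable(3)[OF slice_nonzero] slice_nonzero, of z]
  by (simp add: P_def P'_def)

text \<open>In the azimuthal momentum equation the term - v_1 v_2 from Euler's identity cancels
  against v_2 times the angular derivative v_1 of \<open>U 2\<close>. What is left contains only
  derivatives of v_2 and is a linear first-order equation for v_2'.\<close>

lemma v2_zero: "v 2 z = 0"
proof -
  obtain C where C: "C > 0" "\<And>j z. \<bar>v j z\<bar> \<le> C / sqrt (1 + z\<^sup>2)" using v_bound by metis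
  have p: "1 + z\<^sup>2 > 0" for z :: real using add_pos_nonneg[of 1 "z\<^sup>2"] by auto
  have eq: "(1 + z\<^sup>2) * v'' 2 z = (M z - 3 * z) * v' 2 z" for z
    using ns_momentum[OF slice_nonzero, of 2 z] partial2_p_slice[of z]
    by (simp add: U_slice v_def v'_def v''_def M_def algebra_simps)
  show ?thesis
  proof (rule linear_ode_decay_zero[OF v_deriv(1) _ _ C(2)])
    show "(v' 2 has_real_derivative (M z - 3 * z) / (1 + z\<^sup>2) * v' 2 z) (at z)" for z
    proof -
      have "v'' 2 z = (M z - 3 * z) / (1 + z\<^sup>2) * v' 2 z"
        using eq[of z] p[of z] by (simp add: field_simps)
      then show ?thesis using v_deriv(2)[of 2 z] by simp
    qed
    have "continuous_on UNIV M" by (rule DERIV_imp_continuous_on_UNIV[OF M_deriv])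
    then show "continuous_on UNIV (\<lambda>z. (M z - 3 * z) / (1 + z\<^sup>2))"
      using p by (auto intro!: continuous_intros simp: less_imp_neq[symmetric])
  qed
qed

text \<open>The right-hand side is an antiderivative of the vertical momentum equation, because M' =
  - v_1. The constant of integration is 0 since both sides decay.\<close>

lemma P_eq: "P z = - M z * v 3 z + (1 + z\<^sup>2) * v' 3 z + z * v 3 z"
proof -
  define E where "E = (\<lambda>z. - M z * v 3 z + (1 + z\<^sup>2) * v' 3 z + z * v 3 z)"
  have dE: "(E has_real_derivative P' z) (at z)" for z
  proof -
    have "(E has_real_derivative v 1 z * v 3 z - M z * v' 3 z + 2 * z * v' 3 z + (1 + z\<^sup>2) * v'' 3 z
        + v 3 z + z * v' 3 z) (at z)"
      unfolding E_def by (auto intro!: derivative_eq_intros v_deriv M_deriv)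
    moreover have "P' z = v 1 z * v 3 z - M z * v' 3 z + 2 * z * v' 3 z + (1 + z\<^sup>2) * v'' 3 z
        + v 3 z + z * v' 3 z"
      using ns_momentum[OF slice_nonzero, of 3 z]
      by (simp add: U_slice v_def v'_def v''_def M_def P'_def algebra_simps)
    ultimately show ?thesis by simp
  qed
  have "((\<lambda>z. P z - E z) has_real_derivative 0) (at z)" for z
    using DERIV_diff[OF P_deriv dE, of z] by simp
  then have "P z - E z = P 0 - E 0" for z using DERIV_isconst_all[of "\<lambda>z. P z - E z" z 0] by blast
  \<comment> \<open>The difference is constant, in particular monotone, which makes the decay lemma
    applicable.\<close>
  then have mono: "mono (\<lambda>z. P z - E z)" by (intro monoI) (metis order_refl)
  obtain C where C: "C > 0" "\<And>j z. \<bar>v j z\<bar> \<le> C / sqrt (1 + z\<^sup>2)" "\<And>j z. \<bar>v' j z\<bar> \<le> C / (1 + z\<^sup>2)"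
    "\<And>z. \<bar>M z\<bar> \<le> C" using v_bound by metis
  have "homogeneous (- int 2) p" using homogeneous_p by simp
  then obtain C' where C': "C' > 0" "\<And>z. \<bar>p (slice z)\<bar> \<le> C' / sqrt (1 + z\<^sup>2) ^ 2"
    using homogeneous_bound_slice smooth_on_continuous[OF smooth_p] by blast
  have "homogeneous (- int 2) (partial 1 (U 3))"
    using homogeneous_partial[OF homogeneous_U differentiable(1)] by simp
  then obtain D where D: "D > 0" "\<And>z. \<bar>partial 1 (U 3) (slice z)\<bar> \<le> D / sqrt (1 + z\<^sup>2) ^ 2"
    using homogeneous_bound_slice smooth_on_continuous[OF smooth_on_partial[OF smooth_U]] by blast
  have bd: "\<bar>P z - E z\<bar> \<le> (C' + C * C + C + D) / sqrt (1 + z\<^sup>2)" for z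
  proof -
    define s where "s = sqrt (1 + z\<^sup>2)"
    have s: "s \<ge> 1" "s\<^sup>2 = 1 + z\<^sup>2" "\<bar>z\<bar> \<le> s"
      using abs_le_sqrt_1_plus_square[of z] by (auto simp: s_def)
    have le: "x / s\<^sup>2 \<le> x / s" if "x > 0" for x
      using s(1) that by (intro divide_left_mono) (auto simp: power2_eq_square)
    have 1: "\<bar>P z\<bar> \<le> C' / s" using C'(2)[of z] le[OF C'(1)] by (simp add: P_def s_def)
    have 2: "\<bar>M z * v 3 z\<bar> \<le> C * (C / s)"
      unfolding abs_mult using C(4)[of z] C(2)[of 3 z] C(1) by (intro mult_mono) (auto simp: s_def)
    have 3: "\<bar>v' 3 z\<bar> \<le> C / s" using C(3)[of 3 z] le[OF C(1)] by (simp add: s(2))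
    have "\<bar>z * partial 1 (U 3) (slice z)\<bar> \<le> s * (D / s\<^sup>2)"
      unfolding abs_mult using D(2)[of z] s by (intro mult_mono) (auto simp: s_def)
    then have 4: "\<bar>z * partial 1 (U 3) (slice z)\<bar> \<le> D / s"
      using s(1) by (simp add: power2_eq_square)
    \<comment> \<open>Termwise, (1 + z^2) v_3' and z v_3 are only bounded. By Euler's identity their
      sum is v_3' minus z times a derivative of \<open>U 3\<close>, which is (-2)-homogeneous; both
      of these decay.\<close>
    have "E z = - M z * v 3 z + v' 3 z - z * partial 1 (U 3) (slice z)"
      by (simp add: E_def U_slice v_def v'_def algebra_simps power2_eq_square)
    then show ?thesis using 1 2 3 4 unfolding s_def[symmetric] add_divide_distrib by simp
  qed
  have "P z - E z = 0" by (rule mono_decay_zero[OF mono bd])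
  then show ?thesis by (simp add: E_def)
qed

text \<open>Since M' = - v_1, Q = 0 is the Riccati equation of the Landau solutions. The pressure
  formula reads P = z Q' - 2 Q + 2 v_1, and the nonlinear terms of the radial momentum equation are
  exactly those of Q''. Eliminating P thus leaves a linear homogeneous equation for Q.\<close>

lemma Q_zero: "(1 + z\<^sup>2) * v 1 z + (M z)\<^sup>2 / 2 - z * M z = 0"
proof -
  define Q where "Q = (\<lambda>z. (1 + z\<^sup>2) * v 1 z + (M z)\<^sup>2 / 2 - z * M z)"
  define Q1 where "Q1 = (\<lambda>z. (1 + z\<^sup>2) * v' 1 z + 3 * z * v 1 z - M z * v 1 z - M z)"
  define Q2 where "Q2 = (\<lambda>z. (1 + z\<^sup>2) * v'' 1 z + 5 * z * v' 1 z + 4 * v 1 z + (v 1 z)\<^sup>2 - M z * v' 1 z)"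
  have dQ: "(Q has_real_derivative Q1 z) (at z)" for z
    unfolding Q_def Q1_def
    by (auto intro!: derivative_eq_intros v_deriv M_deriv simp: algebra_simps)
  have dQ1: "(Q1 has_real_derivative Q2 z) (at z)" for z
    unfolding Q1_def Q2_def
    by (auto intro!: derivative_eq_intros v_deriv M_deriv simp: algebra_simps power2_eq_square)
  have v3: "v 3 z = M z + z * v 1 z" for z by (simp add: M_def)
  have P: "P z = z * Q1 z - 2 * Q z + 2 * v 1 z" for z
    unfolding P_eq Q_def Q1_def v3' v3 by (simp add: algebra_simps power2_eq_square)
  then have "P = (\<lambda>z. z * Q1 z - 2 * Q z + 2 * v 1 z)" by blast
  moreover have "((\<lambda>z. z * Q1 z - 2 * Q z + 2 * v 1 z) has_real_derivative
      Q1 z + z * Q2 z - 2 * Q1 z + 2 * v' 1 z) (at z)" for z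
    by (auto intro!: derivative_eq_intros dQ dQ1 v_deriv)
  ultimately have P': "P' z = z * Q2 z - Q1 z + 2 * v' 1 z" for z
    using DERIV_unique[OF P_deriv[of z]] by fastforce
  have "(1 + z\<^sup>2) * v'' 1 z + 3 * z * v' 1 z = M z * v' 1 z - (v 1 z)\<^sup>2 - 2 * P z - z * P' z" for z
    using ns_momentum[OF slice_nonzero, of 1 z] v2_zero[of z] partial1_p_slice[of z]
    by (simp add: U_slice v_def v'_def v''_def M_def algebra_simps power2_eq_square)
  then have "Q2 z = 2 * z * v' 1 z + 4 * v 1 z - 2 * (z * Q1 z - 2 * Q z + 2 * v 1 z)
      - z * (z * Q2 z - Q1 z + 2 * v' 1 z)" for z
    unfolding P P' using Q2_def by (simp add: algebra_simps)
  then have eq: "(1 + z\<^sup>2) * Q2 z + z * Q1 z - 4 * Q z = 0" for z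
    by (simp add: algebra_simps power2_eq_square)
  obtain C where C: "C > 0" "\<And>j z. \<bar>v j z\<bar> \<le> C / sqrt (1 + z\<^sup>2)" "\<And>z. \<bar>M z\<bar> \<le> C"
    using v_bound by metis
  have bd: "\<bar>Q z\<bar> \<le> (2 * C + C\<^sup>2) * sqrt (1 + z\<^sup>2)" for z
  proof -
    define s where "s = sqrt (1 + z\<^sup>2)"
    have s: "s \<ge> 1" "s\<^sup>2 = 1 + z\<^sup>2" "\<bar>z\<bar> \<le> s"
      using abs_le_sqrt_1_plus_square[of z] by (auto simp: s_def)
    have "\<bar>(1 + z\<^sup>2) * v 1 z\<bar> = s\<^sup>2 * \<bar>v 1 z\<bar>" using s(2) by (simp add: abs_mult)
    also have "\<dots> \<le> s\<^sup>2 * (C / s)" using C(2)[of 1 z] by (intro mult_left_mono) (auto simp: s_def)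
    also have "\<dots> = C * s" using s(1) by (simp add: power2_eq_square)
    finally have 1: "\<bar>(1 + z\<^sup>2) * v 1 z\<bar> \<le> C * s" .
    have "(M z)\<^sup>2 \<le> C\<^sup>2" using power_mono[OF C(3)[of z], of 2] by simp
    moreover have "C\<^sup>2 \<le> C\<^sup>2 * s" using s(1) by (simp add: mult_le_cancel_left1)
    moreover have "\<bar>(M z)\<^sup>2 / 2\<bar> = (M z)\<^sup>2 / 2" "(M z)\<^sup>2 \<ge> 0" by simp_all
    ultimately have 2: "\<bar>(M z)\<^sup>2 / 2\<bar> \<le> C\<^sup>2 * s" by linarith
    have 3: "\<bar>z * M z\<bar> \<le> s * C"
      unfolding abs_mult using s C(3)[of z] by (intro mult_mono) auto
    have "(2 * C + C\<^sup>2) * s = C * s + C\<^sup>2 * s + s * C" by (simp add: algebra_simps)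
    then show ?thesis using 1 2 3 unfolding Q_def s_def[symmetric] by linarith
  qed
  have "Q z = 0" by (rule second_order_max_principle[OF dQ dQ1 eq bd])
  then show ?thesis by (simp add: Q_def)
qed

lemma P_eq_2_v1: "P z = 2 * v 1 z"
proof -
  have "(\<lambda>z. (1 + z\<^sup>2) * v 1 z + (M z)\<^sup>2 / 2 - z * M z) = (\<lambda>_. 0)" using Q_zero by blast
  moreover have "((\<lambda>z. (1 + z\<^sup>2) * v 1 z + (M z)\<^sup>2 / 2 - z * M z) has_real_derivative
      (1 + z\<^sup>2) * v' 1 z + 3 * z * v 1 z - M z * v 1 z - M z) (at z)"
    by (auto intro!: derivative_eq_intros v_deriv M_deriv simp: algebra_simps)
  ultimately have *: "(1 + z\<^sup>2) * v' 1 z + 3 * z * v 1 z - M z * v 1 z - M z = 0"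
    using DERIV_unique[OF _ DERIV_const] by metis
  have v3: "v 3 z = M z + z * v 1 z" by (simp add: M_def)
  have "P z = z * ((1 + z\<^sup>2) * v' 1 z + 3 * z * v 1 z - M z * v 1 z - M z)
      - 2 * ((1 + z\<^sup>2) * v 1 z + (M z)\<^sup>2 / 2 - z * M z) + 2 * v 1 z"
    unfolding P_eq v3' v3 by (simp add: algebra_simps power2_eq_square)
  then show ?thesis unfolding * Q_zero by simp
qed

lemma M_cases: "(\<forall>z. M z = 0) \<or> (\<exists>a. \<bar>a\<bar> > 1 \<and> (\<forall>z. M z = 2 / (a * sqrt (1 + z\<^sup>2) - z)))"
proof -
  obtain C where C: "\<And>z. \<bar>M z\<bar> \<le> C" using v_bound by metis
  show ?thesis
  proof (rule landau_ode_solutions[OF M_deriv _ C])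
    show "(1 + z\<^sup>2) * - v 1 z = (M z)\<^sup>2 / 2 - z * M z" for z
      using Q_zero[of z] by simp
  qed
qed

lemma u_zero:
  assumes "\<And>z. M z = 0" "x \<noteq> 0"
  shows "u x = 0"
proof -
  have p: "1 + z\<^sup>2 > 0" for z :: real using add_pos_nonneg[of 1 "z\<^sup>2"] by auto
  have "v 1 z = 0" for z
  proof -
    have "(1 + z\<^sup>2) * v 1 z = 0" using Q_zero[of z] assms(1)[of z] by simp
    then show ?thesis using p[of z] by simp
  qed
  then have uz: "u (slice z) = 0" for z
    using assms(1)[of z] v2_zero[of z] by (simp add: vec3_eq_iff v_def M_def)
  have off: "u x = 0" if x12: "x $ 1 \<noteq> 0 \<or> x $ 2 \<noteq> 0" for x
  proof -
    define z where "z = x $ 3 / cyl_radius x"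
    obtain \<theta> where x: "x = cyl_radius x *\<^sub>R rot \<theta> (slice z)" "cyl_radius x > 0"
      using polar_slice[OF x12] unfolding z_def by blast
    have "u (rot \<theta> (slice z)) = 0"
      using axisymmetric_with_rot[OF axisym_u, of "slice z" \<theta>] uz by (simp add: vec3_eq_iff)
    then show ?thesis
      using homogeneousD[OF homogeneous_u x(2), of "rot \<theta> (slice z)"] x(1) by simp
  qed
  show ?thesis
  proof (cases "x $ 1 \<noteq> 0 \<or> x $ 2 \<noteq> 0")
    case False
    then have x0: "x $ 1 = 0" by simp
    have "isCont u x"
      using smooth_on_continuous[OF smooth_u] assms(2)
      by (simp add: continuous_on_eq_continuous_at open_Compl)
    \<comment> \<open>Rotational symmetry leaves the vertical component free on the axis, so the
      axis is reached by continuity from points displaced horizontally.\<close>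
    moreover have "((\<lambda>n. x + (1 / real (Suc n)) *\<^sub>R axis 1 1) \<longlongrightarrow> x + 0 *\<^sub>R axis 1 1) sequentially"
      using LIMSEQ_inverse_real_of_nat by (intro tendsto_intros) (simp add: inverse_eq_divide)
    ultimately have "((\<lambda>n. u (x + (1 / real (Suc n)) *\<^sub>R axis 1 1)) \<longlongrightarrow> u x) sequentially"
      using isCont_tendsto_compose[of x u] by simp
    moreover have "u (x + (1 / real (Suc n)) *\<^sub>R axis 1 1) = 0" for n
      using x0 by (intro off) (simp add: axis_def)
    ultimately show ?thesis by (simp add: tendsto_const_iff)
  qed (rule off)
qed

text \<open>\<open>d\<close> is \<open>a - cos \<phi>\<close> in the spherical coordinates of the Landau formulas.\<close>

lemma landau_formulas:
  fixes a :: real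
  assumes "\<bar>a\<bar> > 1" "\<And>z. M z = 2 / (a * sqrt (1 + z\<^sup>2) - z)" "x $ 1 \<noteq> 0 \<or> x $ 2 \<noteq> 0"
  defines "t \<equiv> x $ 3 / norm x"
  defines "d \<equiv> a - t"
  shows "\<bar>t\<bar> \<le> 1" "d \<noteq> 0"
    "norm x * U 3 x = 2 / d + 2 * t * (a * t - 1) / d\<^sup>2"
    "(norm x)\<^sup>2 * p x = 4 * (a * t - 1) / d\<^sup>2"
    "u x \<bullet> x = 2 * (a * a - 1) / d\<^sup>2 - 2"
proof -
  define z where "z = x $ 3 / cyl_radius x"
  obtain \<theta> where x: "x = cyl_radius x *\<^sub>R rot \<theta> (slice z)" "cyl_radius x > 0"
    using polar_slice[OF assms(3)] unfolding z_def by blast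
  define r s where "r = cyl_radius x" and "s = sqrt (1 + z\<^sup>2)"
  have s: "s \<ge> 1" "s\<^sup>2 = 1 + z\<^sup>2" "\<bar>z\<bar> \<le> s"
    using abs_le_sqrt_1_plus_square[of z] by (auto simp: s_def)
  have r: "r > 0" using x(2) by (simp add: r_def)
  have xr: "x = r *\<^sub>R rot \<theta> (slice z)" using x(1) by (simp add: r_def)
  have nx: "norm x = r * s" using r by (subst xr) (simp add: norm_slice s_def)
  have x3: "x $ 3 = r * z" by (subst xr) simp
  have t: "t = z / s" using r s(1) by (simp add: t_def nx x3)
  have zt: "z = s * t" using s(1) by (simp add: t)
  show t1: "\<bar>t\<bar> \<le> 1" using s by (simp add: t)
  show d: "d \<noteq> 0" using t1 assms(1) by (auto simp: d_def)
  \<comment> \<open>In spherical coordinates t is the cosine of the polar angle and s the inverse of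
    its sine.\<close>
  have st: "s\<^sup>2 * (1 - t\<^sup>2) = 1" using s(2) by (simp add: zt power_mult_distrib algebra_simps)
  have "a * s - z = s * d" by (simp add: d_def zt algebra_simps)
  then have M: "M z = 2 / (s * d)" using assms(2)[of z] by (simp add: s_def)
  have "s\<^sup>2 * v 1 z = z * M z - (M z)\<^sup>2 / 2" using Q_zero[of z] s(2) by simp
  also have "\<dots> = 2 * t / d - 2 / (s\<^sup>2 * d\<^sup>2)"
    using s(1) d unfolding M by (simp add: zt power_divide power_mult_distrib mult.commute)
  also have "\<dots> = 2 * t / d - 2 * (1 - t\<^sup>2) / d\<^sup>2"
  proof -
    have "1 / s\<^sup>2 = 1 - t\<^sup>2" using st s(1) by (simp add: field_simps)
    moreover have "2 / (s\<^sup>2 * d\<^sup>2) = 2 * (1 / s\<^sup>2) / d\<^sup>2" by simp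
    ultimately show ?thesis by (simp only:)
  qed
  also have "\<dots> = 2 * (a * t - 1) / d\<^sup>2"
    using d by (simp add: field_simps power2_eq_square) (simp add: d_def algebra_simps)
  finally have v1: "s\<^sup>2 * v 1 z = 2 * (a * t - 1) / d\<^sup>2" .
  have v3: "s * v 3 z = 2 / d + t * (s\<^sup>2 * v 1 z)"
  proof -
    have "s * v 3 z = s * M z + s * (z * v 1 z)" by (simp add: M_def algebra_simps)
    moreover have "s * M z = 2 / d" unfolding M using s(1) by simp
    moreover have "s * (z * v 1 z) = t * (s\<^sup>2 * v 1 z)" by (simp add: zt power2_eq_square)
    ultimately show ?thesis by (simp only:)
  qed
  have nzs: "rot \<theta> (slice z) \<noteq> 0" by simp
  have ux: "u x = inverse r *\<^sub>R rot \<theta> (u (slice z))"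
    using homogeneousD[OF homogeneous_u r nzs] xr axisymmetric_with_rot[OF axisym_u, of "slice z" \<theta>]
    by (simp add: power_int_minus)
  then have "U 3 x = v 3 z / r" by (simp add: v_def divide_inverse mult.commute)
  then have "norm x * U 3 x = s * v 3 z" using r by (simp add: nx)
  then show "norm x * U 3 x = 2 / d + 2 * t * (a * t - 1) / d\<^sup>2" by (simp add: v3 v1)
  have "p x = P z / r\<^sup>2"
    using homogeneousD[OF homogeneous_p r nzs] xr p_rot[of "slice z" \<theta>]
    by (simp add: power_int_minus P_def divide_inverse mult.commute)
  then have "(norm x)\<^sup>2 * p x = 2 * (s\<^sup>2 * v 1 z)"
    using r by (simp add: nx P_eq_2_v1 power_mult_distrib)
  then show "(norm x)\<^sup>2 * p x = 4 * (a * t - 1) / d\<^sup>2" by (simp add: v1)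
  have u2: "u (slice z) $ 2 = 0" using v2_zero[of z] by (simp add: v_def)
  have "u x \<bullet> x = (cos \<theta>)\<^sup>2 * v 1 z + (sin \<theta>)\<^sup>2 * v 1 z + z * v 3 z"
    using r unfolding ux by (subst xr)
      (simp add: inner_vec_def sum_3 u2 v_def power2_eq_square field_simps)
  also have "\<dots> = v 1 z + z * v 3 z"
    by (simp add: distrib_right[symmetric])
  also have "\<dots> = (1 - t\<^sup>2) * (s\<^sup>2 * v 1 z) + t * (s * v 3 z)"
  proof -
    have "(1 - t\<^sup>2) * (s\<^sup>2 * v 1 z) = (s\<^sup>2 * (1 - t\<^sup>2)) * v 1 z" by (simp add: algebra_simps)
    then show ?thesis by (simp add: st zt)
  qed
  also have "\<dots> = 2 * (a * t - 1) / d\<^sup>2 + 2 * t / d" 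
  proof -
    have "(1 - t\<^sup>2) * A + t * (2 / d + t * A) = A + 2 * t / d" for A
      by (simp add: algebra_simps power2_eq_square)
    from this[of "2 * (a * t - 1) / d\<^sup>2"] show ?thesis unfolding v3 v1 .
  qed
  also have "\<dots> = 2 * (a * a - 1) / d\<^sup>2 - 2"
    using d by (simp add: field_simps power2_eq_square) (simp add: d_def algebra_simps)
  finally show "u x \<bullet> x = 2 * (a * a - 1) / d\<^sup>2 - 2" .
qed

end

section \<open>Integrals of derivatives with a point singularity\<close>

lemma has_real_derivative_line_shift:
  fixes g :: "real^'n::finite \<Rightarrow> real"
  assumes "((\<lambda>h. g (x + s *\<^sub>R axis i 1 + h *\<^sub>R axis i 1)) has_real_derivative D) (at 0)"
  shows "((\<lambda>s. g (x + s *\<^sub>R axis i 1)) has_real_derivative D) (at s)"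
proof -
  have "((\<lambda>h. g (x + (h + s) *\<^sub>R axis i 1)) has_real_derivative D) (at 0)"
    using assms by (simp add: algebra_simps scaleR_add_left)
  then show ?thesis
    using DERIV_shift[of "\<lambda>s. g (x + s *\<^sub>R axis i 1)" D 0 s] by simp
qed

lemma borel_measurable_continuous_off_0:
  fixes f :: "real^3 \<Rightarrow> real"
  shows "continuous_on (- {0}) f \<Longrightarrow> f \<in> borel_measurable borel"
  by (rule borel_measurable_continuous_countable_exceptions[of "{0}"]) auto

text \<open>Dyadic decomposition: for R / 2^(k+1) < norm x \<le> R / 2^k the integrand is at most
  4^(k+1) / R^2, while the ball of radius R / 2^k has volume V R^3 / 8^k. The products form a
  geometric series of ratio 1/2.\<close>

lemma integrable_inverse_norm_square_cball:
  "integrable lborel (\<lambda>x::real^3. indicat_real (cball 0 R) x / (norm x)\<^sup>2)"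
proof (cases "R > 0")
  case False
  have "indicat_real (cball 0 R) x / (norm x)\<^sup>2 = 0" for x :: "real^3"
  proof (cases "x = 0")
    case False
    then have "norm x > 0" by simp
    with \<open>\<not> R > 0\<close> have "\<not> norm x \<le> R" by linarith
    then show ?thesis by simp
  qed simp
  then have "(\<lambda>x::real^3. indicat_real (cball 0 R) x / (norm x)\<^sup>2) = (\<lambda>x. 0)"
    by (rule ext)
  then show ?thesis by simp
next
  case R: True
  define V where "V = unit_ball_vol 3"
  have V: "V \<ge> 0" by (simp add: V_def)
  define g where "g k x = ennreal (4 ^ (k + 1) / R\<^sup>2) * indicator (cball (0::real^3) (R / 2 ^ k)) x" for k x
  have "(\<integral>\<^sup>+ x. ennreal (norm (indicat_real (cball 0 R) x / (norm x)\<^sup>2)) \<partial>(lborel :: (real^3) measure))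
      \<le> (\<integral>\<^sup>+ x. (\<Sum>k. g k x) \<partial>lborel)"
  proof (rule nn_integral_mono)
    fix x :: "real^3"
    show "ennreal (norm (indicat_real (cball 0 R) x / (norm x)\<^sup>2)) \<le> (\<Sum>k. g k x)"
    proof (cases "x \<noteq> 0 \<and> norm x \<le> R")
      case True
      have "\<exists>n. (1/2::real) ^ n < norm x / R"
        by (rule real_arch_pow_inv) (use True R in auto)
      then have ex: "\<exists>n. R / 2 ^ n < norm x" using R by (auto simp: field_simps)
      \<comment> \<open>The least n lies one past the wanted index: for k = n - 1 the point still
        belongs to the ball of radius R / 2^k.\<close>
      define n where "n = (LEAST n. R / 2 ^ n < norm x)"
      have n: "R / 2 ^ n < norm x" unfolding n_def using ex by (rule LeastI_ex)
      have "n \<noteq> 0" using n True by (intro notI) simp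
      then obtain k where k: "n = Suc k" by (cases n) auto
      have "\<not> R / 2 ^ k < norm x" using not_less_Least[of k "\<lambda>n. R / 2 ^ n < norm x"] k n_def by simp
      then have "g k x = ennreal (4 ^ (k + 1) / R\<^sup>2)" by (simp add: g_def)
      moreover have "1 / (norm x)\<^sup>2 \<le> 4 ^ (k + 1) / R\<^sup>2"
      proof -
        have "(R / 2 ^ n)\<^sup>2 \<le> (norm x)\<^sup>2" using n R by (intro power_mono) auto
        moreover have "(R / 2 ^ n)\<^sup>2 = R\<^sup>2 / 4 ^ n"
          by (simp add: power_divide power_mult[symmetric] mult.commute[of n] power_mult)
        ultimately have "1 / (norm x)\<^sup>2 \<le> 1 / (R\<^sup>2 / 4 ^ n)"
          using R True by (intro divide_left_mono) auto
        then show ?thesis using k by simp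
      qed
      ultimately have "ennreal (norm (indicat_real (cball 0 R) x / (norm x)\<^sup>2)) \<le> g k x"
        using True by (simp add: indicator_def ennreal_leI)
      also have "\<dots> = (\<Sum>i\<in>{k}. g i x)" by simp
      also have "\<dots> \<le> (\<Sum>k. g k x)" by (rule sum_le_suminf) auto
      finally show ?thesis .
    qed auto
  qed
  also have "\<dots> = (\<Sum>k. \<integral>\<^sup>+ x. g k x \<partial>lborel)"
    by (rule nn_integral_suminf)
      (auto simp: g_def intro!: borel_measurable_times_ennreal borel_measurable_indicator)
  also have "\<dots> = (\<Sum>k. ennreal (4 * V * R * (1/2) ^ k))"
  proof (rule suminf_cong)
    fix k
    have "(\<integral>\<^sup>+ x. g k x \<partial>lborel) = ennreal (4 ^ (k + 1) / R\<^sup>2) * emeasure lborel (cball (0::real^3) (R / 2 ^ k))"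
      unfolding g_def by (subst nn_integral_cmult_indicator) auto
    also have "emeasure lborel (cball (0::real^3) (R / 2 ^ k)) = ennreal (V * (R / 2 ^ k) ^ 3)"
      using R by (subst emeasure_cball) (auto simp: V_def)
    also have "ennreal (4 ^ (k + 1) / R\<^sup>2) * ennreal (V * (R / 2 ^ k) ^ 3)
        = ennreal (4 ^ (k + 1) / R\<^sup>2 * (V * (R / 2 ^ k) ^ 3))"
      using V R by (subst ennreal_mult) auto
    also have "4 ^ (k + 1) / R\<^sup>2 * (V * (R / 2 ^ k) ^ 3) = 4 * V * R * (1/2) ^ k"
    proof -
      have "(4::real) ^ k = 2 ^ k * 2 ^ k" by (simp add: power_mult_distrib[symmetric])
      then show ?thesis using R by (simp add: field_simps power3_eq_cube power2_eq_square)
    qed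
    finally show "(\<integral>\<^sup>+ x. g k x \<partial>lborel) = ennreal (4 * V * R * (1/2) ^ k)" .
  qed
  also have "\<dots> = ennreal (\<Sum>k. 4 * V * R * (1/2) ^ k)"
    using V R by (intro suminf_ennreal2) (auto intro!: summable_mult summable_geometric)
  also have "\<dots> < \<infinity>" by simp
  finally show ?thesis
    by (intro integrableI_bounded) (auto intro!: borel_measurable_divide borel_measurable_indicator)
qed

lemma integrable_inverse_square_bound:
  fixes f :: "real^3 \<Rightarrow> real"
  assumes "continuous_on (- {0}) f"
    and bd: "\<And>x. x \<noteq> 0 \<Longrightarrow> norm x \<le> R \<Longrightarrow> \<bar>f x\<bar> \<le> C / (norm x)\<^sup>2"
    and out: "\<And>x. norm x > R \<Longrightarrow> f x = 0"
  shows "integrable lborel f"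
proof (rule Bochner_Integration.integrable_bound)
  show "integrable lborel (\<lambda>x::real^3. \<bar>C\<bar> * (indicat_real (cball 0 R) x / (norm x)\<^sup>2))"
    by (intro integrable_mult_right integrable_inverse_norm_square_cball)
  show "f \<in> borel_measurable lborel" using borel_measurable_continuous_off_0[OF assms(1)] by simp
  show "AE x in lborel. norm (f x) \<le> norm (\<bar>C\<bar> * (indicat_real (cball 0 R) x / (norm x)\<^sup>2))"
    using AE_lborel_singleton[of "0 :: real^3"]
  proof eventually_elim
    case (elim x)
    have "C / (norm x)\<^sup>2 \<le> \<bar>C\<bar> / (norm x)\<^sup>2" by (rule divide_right_mono) auto
    then show ?case using bd[of x] out[of x] elim by (cases "norm x \<le> R") auto
  qed
qed

lemma AE_coordinate_nonzero: "AE x in lborel. (x :: real^3) $ j \<noteq> 0"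
proof -
  have "negligible {x :: real^3. x $ j = 0}" by (rule negligible_standard_hyperplane_cart)
  moreover have "{x :: real^3. x $ j = 0} \<in> sets borel"
    by (intro borel_closed closed_Collect_eq continuous_intros)
  ultimately have "{x :: real^3. x $ j = 0} \<in> null_sets lborel"
    by (simp add: negligible_iff_null_sets null_sets_completion_iff)
  then show ?thesis by (rule AE_I') auto
qed

lemma integral_translate:
  fixes f :: "real^3 \<Rightarrow> real"
  assumes "integrable lborel f"
  shows "integrable lborel (\<lambda>x. f (x + c))" "(\<integral>x. f (x + c) \<partial>lborel) = (\<integral>x. f x \<partial>lborel)"
proof -
  have "integrable (distr lborel borel ((+) c)) f" by (simp add: lborel_distr_plus assms)
  then have "integrable lborel (\<lambda>x. f (c + x))"
    by (subst (asm) integrable_distr_eq) (use assms in auto)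
  then show "integrable lborel (\<lambda>x. f (x + c))" by (simp add: add.commute)
  have "(\<integral>x. f x \<partial>lborel) = (\<integral>x. f x \<partial>(distr lborel borel ((+) c)))" by (simp add: lborel_distr_plus)
  also have "\<dots> = (\<integral>x. f (c + x) \<partial>lborel)"
    by (rule integral_distr) (use assms in auto)
  finally show "(\<integral>x. f (x + c) \<partial>lborel) = (\<integral>x. f x \<partial>lborel)" by (simp add: add.commute)
qed

text \<open>
  Averaging over translations along the \<open>i\<close>-th axis turns the integral of a derivative into the
  integral of an increment. Only almost every line matters, so a point singularity is harmless.
\<close>

lemma integral_partial_derivative_eq_0:
  fixes g g' :: "real^3 \<Rightarrow> real"
  assumes g: "integrable lborel g" and g': "integrable lborel g'"
    and cont: "continuous_on (- {0}) g'"
    and deriv: "\<And>x. x \<noteq> 0 \<Longrightarrow> ((\<lambda>s. g (x + s *\<^sub>R axis i 1)) has_real_derivative g' x) (at 0)"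
  shows "(\<integral>x. g' x \<partial>lborel) = 0"
proof -
  let ?e = "axis i 1 :: real^3"
  \<comment> \<open>A line in direction i through a point whose j-th coordinate is nonzero misses
    the origin, and almost every point is of this kind.\<close>
  obtain j where j: "j \<noteq> i" using exhaust_3 by (metis zero_neq_one)
  define F where "F = (\<lambda>s x. g' (x + s *\<^sub>R ?e) * indicat_real {0..1} s)"
  have [measurable]: "g' \<in> borel_measurable borel" using g' by auto
  have int_s: "integrable lborel (F s)" for s
    unfolding F_def using integral_translate(1)[OF g'] by simp
  have abs_s: "(\<integral>x. norm (F s x) \<partial>lborel) = indicat_real {0..1} s * (\<integral>x. \<bar>g' x\<bar> \<partial>lborel)" for s
  proof -
    have "(\<integral>x. norm (F s x) \<partial>lborel) = indicat_real {0..1} s * (\<integral>x. \<bar>g' (x + s *\<^sub>R ?e)\<bar> \<partial>lborel)"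
      unfolding F_def by (simp add: abs_mult mult.commute)
    also have "(\<integral>x. \<bar>g' (x + s *\<^sub>R ?e)\<bar> \<partial>lborel) = (\<integral>x. \<bar>g' x\<bar> \<partial>lborel)"
      using integral_translate(2)[of "\<lambda>x. \<bar>g' x\<bar>"] g' by simp
    finally show ?thesis .
  qed
  have "integrable (lborel \<Otimes>\<^sub>M lborel) (\<lambda>(s, x). F s x)"
  proof (rule lborel_pair.Fubini_integrable)
    show "(\<lambda>(s, x). F s x) \<in> borel_measurable (lborel \<Otimes>\<^sub>M lborel)"
      unfolding F_def by measurable
    show "integrable lborel (\<lambda>s. \<integral>x. norm (case (s, x) of (s, x) \<Rightarrow> F s x) \<partial>lborel)"
      unfolding prod.case abs_s
      by (intro integrable_mult_left integrable_real_indicator) auto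
    show "AE s in lborel. integrable lborel (\<lambda>x. case (s, x) of (s, x) \<Rightarrow> F s x)"
      using int_s by simp
  qed
  then have "(\<integral>x. (\<integral>s. F s x \<partial>lborel) \<partial>lborel) = (\<integral>s. (\<integral>x. F s x \<partial>lborel) \<partial>lborel)"
    by (rule lborel_pair.Fubini_integral)
  also have "\<dots> = (\<integral>s. indicat_real {0..1::real} s * (\<integral>x. g' x \<partial>lborel) \<partial>lborel)"
    unfolding F_def using integral_translate(2)[OF g'] by (simp add: mult.commute)
  also have "\<dots> = (\<integral>x. g' x \<partial>lborel)" by (simp add: content_real)
  finally have "(\<integral>x. g' x \<partial>lborel) = (\<integral>x. (\<integral>s. F s x \<partial>lborel) \<partial>lborel)" by simp
  also have "\<dots> = (\<integral>x. g (x + ?e) - g x \<partial>lborel)"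
  proof (rule integral_cong_AE)
    show "AE x in lborel. (\<integral>s. F s x \<partial>lborel) = g (x + ?e) - g x"
      using AE_coordinate_nonzero[of j]
    proof eventually_elim
      case (elim x)
      have nz: "x + s *\<^sub>R ?e \<noteq> 0" for s
      proof
        assume "x + s *\<^sub>R ?e = 0"
        then have "(x + s *\<^sub>R ?e) $ j = 0" by simp
        with elim j show False by (simp add: axis_def)
      qed
      have "(\<integral>s. F s x \<partial>lborel) = g (x + 1 *\<^sub>R ?e) - g (x + 0 *\<^sub>R ?e)"
        unfolding F_def
      proof (rule integral_FTC_Icc_real)
        show "((\<lambda>s. g (x + s *\<^sub>R ?e)) has_real_derivative g' (x + s *\<^sub>R ?e)) (at s)" for s
          by (rule has_real_derivative_line_shift[OF deriv[OF nz]])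
        show "isCont (\<lambda>s. g' (x + s *\<^sub>R ?e)) s" for s
        proof -
          have "isCont g' (x + s *\<^sub>R ?e)"
            using cont nz by (simp add: continuous_on_eq_continuous_at open_Compl)
          then show ?thesis
            by (intro isCont_o2[where g = g' and f = "\<lambda>s. x + s *\<^sub>R ?e"]) (auto intro!: continuous_intros)
        qed
      qed simp
      then show ?case by simp
    qed
    show "(\<lambda>x. \<integral>s. F s x \<partial>lborel) \<in> borel_measurable lborel"
      unfolding F_def by measurable
    show "(\<lambda>x. g (x + ?e) - g x) \<in> borel_measurable lborel"
      using integral_translate(1)[OF g] g by auto
  qed
  also have "\<dots> = 0"
    using integral_translate[OF g, of ?e] g by simp
  finally show ?thesis .
qed

text \<open>Order k means O(norm x ^ -k) near the origin; negative orders record vanishing there.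
  The bound is confined to the ball of radius R, outside which the integrands vanish. Orders add
  under products, and order 2 is integrable in dimension 3.\<close>

definition singular_order :: "real \<Rightarrow> int \<Rightarrow> (real^3 \<Rightarrow> real) \<Rightarrow> bool" where
  "singular_order R k f \<longleftrightarrow> continuous_on (- {0}) f \<and>
     (\<exists>C\<ge>0. \<forall>x. x \<noteq> 0 \<longrightarrow> norm x \<le> R \<longrightarrow> \<bar>f x\<bar> \<le> C * norm x powi - k)"

lemma singular_orderI:
  "continuous_on (- {0}) f \<Longrightarrow> (\<And>x. x \<noteq> 0 \<Longrightarrow> norm x \<le> R \<Longrightarrow> \<bar>f x\<bar> \<le> C * norm x powi - k) \<Longrightarrow> C \<ge> 0
    \<Longrightarrow> singular_order R k f"
  unfolding singular_order_def by blast

lemma singular_order_mult: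
  assumes "singular_order R k f" "singular_order R l g"
  shows "singular_order R (k + l) (\<lambda>x. f x * g x)"
proof -
  obtain C where C: "C \<ge> 0" "\<And>x. x \<noteq> 0 \<Longrightarrow> norm x \<le> R \<Longrightarrow> \<bar>f x\<bar> \<le> C * norm x powi - k"
    using assms(1) unfolding singular_order_def by blast
  obtain D where D: "D \<ge> 0" "\<And>x. x \<noteq> 0 \<Longrightarrow> norm x \<le> R \<Longrightarrow> \<bar>g x\<bar> \<le> D * norm x powi - l"
    using assms(2) unfolding singular_order_def by blast
  show ?thesis
  proof (rule singular_orderI)
    show "continuous_on (- {0}) (\<lambda>x. f x * g x)"
      using assms unfolding singular_order_def by (intro continuous_intros) auto
    show "\<bar>f x * g x\<bar> \<le> C * D * norm x powi - (k + l)" if "x \<noteq> 0" "norm x \<le> R" for x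
    proof -
      have "\<bar>f x * g x\<bar> \<le> (C * norm x powi - k) * (D * norm x powi - l)"
        unfolding abs_mult using C(2)[OF that] D(2)[OF that] C(1) by (intro mult_mono) auto
      also have "\<dots> = C * D * norm x powi (- k + - l)"
        using that(1) by (subst power_int_add) (auto simp: algebra_simps)
      finally show ?thesis by simp
    qed
  qed (use C(1) D(1) in simp)
qed

lemma singular_order_add:
  assumes "singular_order R k f" "singular_order R k g"
  shows "singular_order R k (\<lambda>x. f x + g x)"
proof -
  obtain C where C: "C \<ge> 0" "\<And>x. x \<noteq> 0 \<Longrightarrow> norm x \<le> R \<Longrightarrow> \<bar>f x\<bar> \<le> C * norm x powi - k"
    using assms(1) unfolding singular_order_def by blast
  obtain D where D: "D \<ge> 0" "\<And>x. x \<noteq> 0 \<Longrightarrow> norm x \<le> R \<Longrightarrow> \<bar>g x\<bar> \<le> D * norm x powi - k"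
    using assms(2) unfolding singular_order_def by blast
  show ?thesis
  proof (rule singular_orderI)
    show "continuous_on (- {0}) (\<lambda>x. f x + g x)"
      using assms unfolding singular_order_def by (intro continuous_intros) auto
    show "\<bar>f x + g x\<bar> \<le> (C + D) * norm x powi - k" if "x \<noteq> 0" "norm x \<le> R" for x
      using C(2)[OF that] D(2)[OF that] abs_triangle_ineq[of "f x" "g x"]
      unfolding distrib_right by linarith
  qed (use C(1) D(1) in simp)
qed

lemma singular_order_mono:
  assumes "singular_order R k f" "k \<le> l"
  shows "singular_order R l f"
proof -
  obtain C where C: "C \<ge> 0" "\<And>x. x \<noteq> 0 \<Longrightarrow> norm x \<le> R \<Longrightarrow> \<bar>f x\<bar> \<le> C * norm x powi - k"
    using assms(1) unfolding singular_order_def by blast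
  show ?thesis
  proof (rule singular_orderI)
    show "continuous_on (- {0}) f" using assms unfolding singular_order_def by blast
    show "\<bar>f x\<bar> \<le> C * \<bar>R\<bar> ^ nat (l - k) * norm x powi - l" if "x \<noteq> 0" "norm x \<le> R" for x
    proof -
      have "norm x powi - k = norm x powi (int (nat (l - k)) + - l)" using assms(2) by simp
      also have "\<dots> = norm x ^ nat (l - k) * norm x powi - l"
        using that(1) assms(2) by (subst power_int_add) (auto simp: power_int_def)
      also have "\<dots> \<le> \<bar>R\<bar> ^ nat (l - k) * norm x powi - l"
        using that(2) by (intro mult_right_mono power_mono) auto
      finally have "C * norm x powi - k \<le> C * (\<bar>R\<bar> ^ nat (l - k) * norm x powi - l)"
        using C(1) by (rule mult_left_mono)
      then show ?thesis using C(2)[OF that] by (simp add: mult.assoc)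
    qed
  qed (use C(1) in simp)
qed

lemma singular_order_const: "singular_order R 0 (\<lambda>x. c)"
  by (rule singular_orderI[where C = "\<bar>c\<bar>"]) auto

lemma singular_order_uminus: "singular_order R k f \<Longrightarrow> singular_order R k (\<lambda>x. - f x)"
  using singular_order_mult[OF singular_order_const[of R "-1"]] by simp

lemma singular_order_diff:
  "singular_order R k f \<Longrightarrow> singular_order R k g \<Longrightarrow> singular_order R k (\<lambda>x. f x - g x)"
  using singular_order_add[OF _ singular_order_uminus, of R k f g] by simp

lemma singular_order_sum:
  "finite I \<Longrightarrow> I \<noteq> {} \<Longrightarrow> (\<And>i. i \<in> I \<Longrightarrow> singular_order R k (f i)) \<Longrightarrow> singular_order R k (\<lambda>x. \<Sum>i\<in>I. f i x)"
  by (induction rule: finite_ne_induct) (auto intro: singular_order_add)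

lemma singular_order_homogeneous:
  assumes "homogeneous (- k) f" "continuous_on (- {0}) f"
  shows "singular_order R k f"
  using homogeneous_bound[OF assms] by (metis assms(2) less_imp_le singular_orderI)

lemma singular_order_continuous:
  assumes "continuous_on UNIV f"
  shows "singular_order R 0 f"
proof -
  have "bounded (f ` cball 0 R)"
    using assms by (intro compact_imp_bounded compact_continuous_image)
      (auto intro: continuous_on_subset)
  then obtain C where "C > 0" "\<And>x. norm x \<le> R \<Longrightarrow> \<bar>f x\<bar> \<le> C"
    unfolding bounded_pos by (auto simp: dist_norm)
  then show ?thesis
    by (intro singular_orderI[where C = C]) (use assms in \<open>auto intro: continuous_on_subset\<close>)
qed

text \<open>Differentiability at a zero gives a linear bound near the origin; farther out,
  boundedness on the ball divided by the distance d suffices. This gain of one order is what makes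
  the fluxes in the weak equation harmless.\<close>

lemma singular_order_vanishing:
  fixes f :: "real^3 \<Rightarrow> real"
  assumes cont: "continuous_on UNIV f" and "f differentiable (at 0)" "f 0 = 0"
  shows "singular_order R (-1) f"
proof -
  obtain f' where f': "(f has_derivative f') (at 0)" using assms(2) unfolding differentiable_def by blast
  then obtain K where K: "K > 0" "\<And>x. norm (f' x) \<le> norm x * K"
    using bounded_linear.pos_bounded[OF has_derivative_bounded_linear[OF f']] by blast
  obtain d where d: "d > 0" "\<And>x. norm x < d \<Longrightarrow> norm (f x - f' x) \<le> norm x"
    using f'[unfolded has_derivative_at_alt] assms(3) by (metis diff_zero mult_1 zero_less_one)
  have "bounded (f ` cball 0 R)"
    using cont by (intro compact_imp_bounded compact_continuous_image)
      (auto intro: continuous_on_subset)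
  then obtain C where C: "C > 0" "\<And>x. norm x \<le> R \<Longrightarrow> \<bar>f x\<bar> \<le> C"
    unfolding bounded_pos by (auto simp: dist_norm)
  show ?thesis
  proof (rule singular_orderI)
    show "continuous_on (- {0}) f" using cont continuous_on_subset by blast
    show "\<bar>f x\<bar> \<le> (1 + K + C / d) * norm x powi - (- 1)" if "x \<noteq> 0" "norm x \<le> R" for x
    proof (cases "norm x < d")
      case True
      have "\<bar>f x\<bar> \<le> norm (f x - f' x) + norm (f' x)" by simp
      also have "\<dots> \<le> norm x + norm x * K" using d(2)[OF True] K(2)[of x] by linarith
      also have "\<dots> \<le> (1 + K + C / d) * norm x" using C(1) d(1) by (simp add: algebra_simps)
      finally show ?thesis by simp
    next
      case False
      have "\<bar>f x\<bar> \<le> C" by (rule C(2)[OF that(2)])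
      also have "C \<le> C / d * norm x" using False C(1) d(1) by (simp add: field_simps)
      also have "\<dots> \<le> (1 + K + C / d) * norm x" using K(1) by (simp add: distrib_right)
      finally show ?thesis by simp
    qed
  qed (use K(1) C(1) d(1) in simp)
qed

lemma singular_order_2_integrable:
  assumes "singular_order R 2 f" "\<And>x. norm x > R \<Longrightarrow> f x = 0"
  shows "integrable lborel f"
proof -
  obtain C where C: "\<And>x. x \<noteq> 0 \<Longrightarrow> norm x \<le> R \<Longrightarrow> \<bar>f x\<bar> \<le> C * norm x powi - 2"
    using assms(1) unfolding singular_order_def by blast
  show ?thesis
    by (rule integrable_inverse_square_bound[of f R C])
      (use assms C in \<open>auto simp: singular_order_def power_int_minus divide_inverse\<close>)
qed

lemma has_bochner_integral_partial_derivative: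
  fixes g g' :: "real^3 \<Rightarrow> real"
  assumes "singular_order R 1 g" "singular_order R 2 g'"
    and "\<And>x. norm x > R \<Longrightarrow> g x = 0" "\<And>x. norm x > R \<Longrightarrow> g' x = 0"
    and "\<And>x. x \<noteq> 0 \<Longrightarrow> ((\<lambda>s. g (x + s *\<^sub>R axis i 1)) has_real_derivative g' x) (at 0)"
  shows "has_bochner_integral lborel g' 0"
proof -
  have "integrable lborel g'" by (rule singular_order_2_integrable[OF assms(2,4)])
  moreover have "integrable lborel g"
    by (rule singular_order_2_integrable[OF singular_order_mono[OF assms(1)] assms(3)]) simp
  ultimately show ?thesis
    using integral_partial_derivative_eq_0[of g g' i] assms(2,5)
    by (simp add: has_bochner_integral_iff singular_order_def)
qed

section \<open>The weak equation\<close>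

text \<open>
  \<open>d i\<close> and \<open>dd i\<close> are the first and the pure second partial derivatives; mixed ones are never needed.
\<close>

definition C2_test :: "real \<Rightarrow> (real^3 \<Rightarrow> real) \<Rightarrow> (3 \<Rightarrow> real^3 \<Rightarrow> real) \<Rightarrow> (3 \<Rightarrow> real^3 \<Rightarrow> real) \<Rightarrow> bool" where
  "C2_test R f d dd \<longleftrightarrow> continuous_on UNIV f \<and> (\<forall>i. continuous_on UNIV (d i)) \<and> (\<forall>i. continuous_on UNIV (dd i))
    \<and> (\<forall>i x. ((\<lambda>s. f (x + s *\<^sub>R axis i 1)) has_real_derivative d i x) (at 0))
    \<and> (\<forall>i x. ((\<lambda>s. d i (x + s *\<^sub>R axis i 1)) has_real_derivative dd i x) (at 0))
    \<and> (\<forall>x. norm x > R \<longrightarrow> f x = 0 \<and> (\<forall>i. d i x = 0 \<and> dd i x = 0))"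

lemma C2_testD:
  assumes "C2_test R f d dd"
  shows "continuous_on UNIV f" "continuous_on UNIV (d i)" "continuous_on UNIV (dd i)"
    "((\<lambda>s. f (x + s *\<^sub>R axis i 1)) has_real_derivative d i x) (at 0)"
    "((\<lambda>s. d i (x + s *\<^sub>R axis i 1)) has_real_derivative dd i x) (at 0)"
    "norm x > R \<Longrightarrow> f x = 0" "norm x > R \<Longrightarrow> d i x = 0" "norm x > R \<Longrightarrow> dd i x = 0"
  using assms unfolding C2_test_def by blast+

lemma C2_test_diff_scaled:
  assumes "C2_test R f d dd" "C2_test R g e ee"
  shows "C2_test R (\<lambda>x. f x - c * g x) (\<lambda>i x. d i x - c * e i x) (\<lambda>i x. dd i x - c * ee i x)"
  using assms unfolding C2_test_def
  by (auto intro!: continuous_intros derivative_eq_intros)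

lemma test_function_C2_test:
  fixes f :: "real^3 \<Rightarrow> real"
  assumes "smooth_on UNIV f" and out: "\<And>x. norm x > R \<Longrightarrow> f x = 0"
  shows "C2_test R f (\<lambda>i. partial i f) (\<lambda>i. partial i (partial i f))"
proof -
  note s = assms(1) smooth_on_partial[OF assms(1)] smooth_on_partial[OF smooth_on_partial[OF assms(1)]]
  have "partial i g x = 0" if "norm x > R" "\<And>x. norm x > R \<Longrightarrow> g x = 0" for g :: "real^3 \<Rightarrow> real" and i x
  proof -
    have "open {x :: real^3. norm x > R}" by (intro open_Collect_less continuous_intros)
    then have "partial i g x = partial i (\<lambda>_. 0) x"
      by (rule partial_cong_open) (use that in auto)
    then show ?thesis using partial_eqI[OF has_derivative_const, of i 0 x] by simp
  qed
  then have "partial i f x = 0" "partial i (partial i f) x = 0" if "norm x > R" for i x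
    using that out by blast+
  moreover have "((\<lambda>s. f (x + s *\<^sub>R axis i 1)) has_real_derivative partial i f x) (at 0)" for i x
    using has_real_derivative_partial[of f x 0 i] smooth_on_differentiable[OF s(1)] by simp
  moreover have "((\<lambda>s. partial i f (x + s *\<^sub>R axis i 1)) has_real_derivative partial i (partial i f) x) (at 0)" for i x
    using has_real_derivative_partial[of "partial i f" x 0 i] smooth_on_differentiable[OF s(2)] by simp
  ultimately show ?thesis
    unfolding C2_test_def using s smooth_on_continuous out by blast
qed

lemma test_function_bounded_support:
  assumes "test_function f"
  obtains R where "R \<ge> 1" "\<And>x. norm x > R \<Longrightarrow> f x = 0"
proof -
  have "bounded (closure {x. f x \<noteq> 0})"
    using assms compact_imp_bounded unfolding test_function_def by blast
  then obtain K where K: "\<And>x. x \<in> closure {x. f x \<noteq> 0} \<Longrightarrow> norm x \<le> K"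
    unfolding bounded_iff by blast
  have "f x = 0" if "norm x > max K 1" for x
    using K[of x] that closure_subset[of "{x. f x \<noteq> 0}"] by (cases "f x = 0") auto
  then show ?thesis using that[of "max K 1"] by auto
qed

section \<open>The truncated bump (1 - norm x ^ 2)^3\<close>

lemma has_real_derivative_max_0_power:
  "((\<lambda>t::real. max 0 t ^ Suc (Suc n)) has_real_derivative real (Suc (Suc n)) * max 0 t ^ Suc n) (at t)"
proof -
  consider "t > 0" | "t < 0" | "t = 0" by linarith
  then show ?thesis
  proof cases
    case 1
    then have "max 0 t = t" by simp
    then have "((\<lambda>t. t ^ Suc (Suc n)) has_real_derivative real (Suc (Suc n)) * max 0 t ^ Suc n) (at t)"
      using DERIV_pow[of "Suc (Suc n)" t UNIV] by (simp only: diff_Suc_Suc diff_zero)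
    then show ?thesis
      by (rule has_field_derivative_transform_within_open[OF _ open_greaterThan[of 0]])
        (use 1 in \<open>simp_all only: greaterThan_iff max.absorb2 less_imp_le\<close>)
  next
    case 2
    then have "max 0 t = 0" by simp
    then have "((\<lambda>t. 0) has_real_derivative real (Suc (Suc n)) * max 0 t ^ Suc n) (at t)"
      by simp
    then show ?thesis
      by (rule has_field_derivative_transform_within_open[OF _ open_lessThan[of 0]])
        (use 2 in \<open>simp_all add: max.absorb1\<close>)
  next
    case 3
    have "max 0 h ^ Suc (Suc n) / h = max 0 h ^ Suc n" if "h \<noteq> 0" for h :: real
    proof (cases "h > 0")
      case True
      then have m: "max 0 h = h" by simp
      show ?thesis unfolding m using that by simp
    next
      case False
      then have m: "max 0 h = 0" by simp
      show ?thesis unfolding m by simp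
    qed
    then have eq: "((\<lambda>h::real. max 0 h ^ Suc (Suc n) / h) \<longlongrightarrow> 0) (at 0) \<longleftrightarrow> ((\<lambda>h::real. max 0 h ^ Suc n) \<longlongrightarrow> 0) (at 0)"
      by (rule LIM_equal[rule_format])
    have "((\<lambda>h::real. max 0 h ^ Suc n) \<longlongrightarrow> max 0 0 ^ Suc n) (at 0)"
      by (intro tendsto_intros)
    moreover have "max 0 0 ^ Suc n = (0::real)" by simp
    ultimately have "((\<lambda>h::real. max 0 h ^ Suc (Suc n) / h) \<longlongrightarrow> 0) (at 0)"
      unfolding eq by (simp only:)
    moreover have "(max 0 (0 + h) ^ Suc (Suc n) - max 0 0 ^ Suc (Suc n)) / h = max 0 h ^ Suc (Suc n) / h"
      for h :: real by simp
    moreover have "real (Suc (Suc n)) * max 0 0 ^ Suc n = 0" by simp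
    ultimately show ?thesis unfolding DERIV_def 3 by (simp only:)
  qed
qed

text \<open>The cube of \<open>hat\<close> is the reference test function with value 1 at the
  origin. The third power is the smallest that is C^2 across the unit sphere, and its derivatives
  are polynomials in the coordinates and \<open>hat\<close>, so that the density of the force has a
  closed form.\<close>

definition hat :: "real^3 \<Rightarrow> real" where
  "hat x = max 0 (1 - (norm x)\<^sup>2)"

lemma continuous_on_hat: "continuous_on S hat"
  unfolding hat_def by (intro continuous_intros)

lemma hat_outside: "norm x > R \<Longrightarrow> R \<ge> 1 \<Longrightarrow> hat x = 0"
  unfolding hat_def using one_le_power[of "norm x" 2] by simp

lemma has_real_derivative_hat_power:
  "((\<lambda>s. hat (x + s *\<^sub>R axis i 1) ^ Suc (Suc n)) has_real_derivative
    - 2 * x $ i * (real (Suc (Suc n)) * hat x ^ Suc n)) (at 0)"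
proof -
  have q: "(norm (x + s *\<^sub>R axis i 1))\<^sup>2 = (norm x)\<^sup>2 + 2 * s * x $ i + s\<^sup>2" for s
    unfolding power2_norm_eq_inner
    by (simp add: inner_add_left inner_add_right inner_axis inner_axis' power2_eq_square algebra_simps)
  have "((\<lambda>s. 1 - (norm (x + s *\<^sub>R axis i 1))\<^sup>2) has_real_derivative - 2 * x $ i) (at 0)"
    unfolding q by (auto intro!: derivative_eq_intros)
  from DERIV_chain2[OF has_real_derivative_max_0_power[of n] this] show ?thesis
    by (simp add: hat_def mult.commute)
qed

definition bump_d :: "3 \<Rightarrow> real^3 \<Rightarrow> real" where
  "bump_d i x = - 6 * x $ i * hat x ^ 2"

definition bump_dd :: "3 \<Rightarrow> real^3 \<Rightarrow> real" where
  "bump_dd i x = - 6 * hat x ^ 2 + 24 * (x $ i)\<^sup>2 * hat x"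

lemma C2_test_bump:
  assumes "R \<ge> 1"
  shows "C2_test R (\<lambda>x. hat x ^ 3) bump_d bump_dd"
  unfolding C2_test_def
proof (intro conjI allI impI)
  show "((\<lambda>s. hat (x + s *\<^sub>R axis i 1) ^ 3) has_real_derivative bump_d i x) (at 0)" for i x
    using has_real_derivative_hat_power[of x i 1] by (simp add: bump_d_def eval_nat_numeral algebra_simps)
  show "((\<lambda>s. bump_d i (x + s *\<^sub>R axis i 1)) has_real_derivative bump_dd i x) (at 0)" for i x
  proof -
    have "((\<lambda>s. hat (x + s *\<^sub>R axis i 1) ^ 2) has_real_derivative - 4 * x $ i * hat x) (at 0)"
      using has_real_derivative_hat_power[of x i 0] by (simp add: eval_nat_numeral algebra_simps)
    moreover have "((\<lambda>s. - 6 * (x + s *\<^sub>R axis i 1) $ i) has_real_derivative - 6) (at 0)"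
      by (auto intro!: derivative_eq_intros)
    ultimately have "((\<lambda>s. (- 6 * (x + s *\<^sub>R axis i 1) $ i) * hat (x + s *\<^sub>R axis i 1) ^ 2) has_real_derivative
        (- 6) * hat (x + 0 *\<^sub>R axis i 1) ^ 2 + (- 4 * x $ i * hat x) * (- 6 * (x + 0 *\<^sub>R axis i 1) $ i)) (at 0)"
      by (rule DERIV_mult[rotated])
    then show ?thesis by (simp add: bump_d_def bump_dd_def power2_eq_square algebra_simps)
  qed
  show "continuous_on UNIV (bump_d i)" "continuous_on UNIV (bump_dd i)" "continuous_on UNIV (\<lambda>x. hat x ^ 3)" for i
    unfolding bump_d_def bump_dd_def by (intro continuous_intros continuous_on_hat)+
qed (use assms hat_outside in \<open>auto simp: bump_d_def bump_dd_def\<close>)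

lemma bump_differentiable: "(\<lambda>x. hat x ^ 3) differentiable (at x)"
proof -
  have "((\<lambda>x :: real^3. 1 - x \<bullet> x) has_derivative (\<lambda>h. - (x \<bullet> h + h \<bullet> x))) (at x)"
    by (auto intro!: derivative_eq_intros)
  from has_derivative_compose[OF this
      has_field_derivative_imp_has_derivative[OF has_real_derivative_max_0_power[of 1]]]
  show ?thesis
    unfolding differentiable_def hat_def power2_norm_eq_inner by (simp add: eval_nat_numeral) blast
qed

context self_similar_ns
begin

text \<open>This is the integrand of the momentum part of \<open>distributional_ns\<close> for the
  test field f e_j, written in terms of the derivatives \<open>d\<close> and \<open>dd\<close> of f
  so that it is also available for C^2 functions.\<close>

definition weak :: "3 \<Rightarrow> (3 \<Rightarrow> real^3 \<Rightarrow> real) \<Rightarrow> (3 \<Rightarrow> real^3 \<Rightarrow> real) \<Rightarrow> real^3 \<Rightarrow> real" where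
  "weak j d dd x = - U j x * (\<Sum>i\<in>UNIV. dd i x) - (\<Sum>i\<in>UNIV. U i x * U j x * d i x) - p x * d j x"

lemma singular_order_U: "singular_order R 1 (U j)"
  by (intro singular_order_homogeneous homogeneous_U smooth_on_continuous smooth_U)

lemma singular_order_partial_U: "singular_order R 2 (partial i (U j))"
proof -
  have "homogeneous (- 2) (partial i (U j))"
    using homogeneous_partial[OF homogeneous_U differentiable(1)] by simp
  then show ?thesis
    by (intro singular_order_homogeneous smooth_on_continuous smooth_on_partial smooth_U)
qed

lemma singular_order_partial_partial_U: "singular_order R 3 (partial i (partial i (U j)))"
proof -
  have "homogeneous (- 1 - 1 - 1) (partial i (partial i (U j)))"
    by (rule homogeneous_partial[OF homogeneous_partial[OF homogeneous_U differentiable(1)] differentiable(4)])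
  then have "homogeneous (- 3) (partial i (partial i (U j)))" by simp
  then show ?thesis
    by (intro singular_order_homogeneous smooth_on_continuous smooth_on_partial smooth_U)
qed

lemma singular_order_p: "singular_order R 2 p"
  by (intro singular_order_homogeneous homogeneous_p smooth_on_continuous smooth_p)

lemma singular_order_partial_p: "singular_order R 3 (partial i p)"
proof -
  have "homogeneous (- 3) (partial i p)"
    using homogeneous_partial[OF homogeneous_p differentiable(3)] by simp
  then show ?thesis
    by (intro singular_order_homogeneous smooth_on_continuous smooth_on_partial smooth_p)
qed

lemma singular_order_weak:
  assumes "C2_test R f d dd"
  shows "singular_order R 2 (weak j d dd)"
proof -
  note c = singular_order_continuous[OF C2_testD(2)[OF assms]] singular_order_continuous[OF C2_testD(3)[OF assms]]
  have 1: "singular_order R 2 (\<lambda>x. - U j x * (\<Sum>i\<in>UNIV. dd i x))"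
    using singular_order_mult[OF singular_order_uminus[OF singular_order_U]
        singular_order_sum[of UNIV R 0 dd, OF finite_class.finite_UNIV UNIV_not_empty c(2)]]
    by (rule singular_order_mono) simp
  have 2: "singular_order R 2 (\<lambda>x. \<Sum>i\<in>UNIV. U i x * U j x * d i x)"
    using singular_order_mult[OF singular_order_mult[OF singular_order_U singular_order_U] c(1)]
    by (intro singular_order_sum) auto
  have 3: "singular_order R 2 (\<lambda>x. p x * d j x)"
    using singular_order_mult[OF singular_order_p c(1)] by simp
  show ?thesis
    unfolding weak_def[abs_def] by (intro singular_order_diff 1 2 3)
qed

lemma weak_outside: "C2_test R f d dd \<Longrightarrow> norm x > R \<Longrightarrow> weak j d dd x = 0"
  unfolding weak_def by (simp add: C2_testD)

lemma weak_integrable: "C2_test R f d dd \<Longrightarrow> integrable lborel (weak j d dd)"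
  by (rule singular_order_2_integrable[OF singular_order_weak weak_outside])

lemma line_derivatives:
  assumes "x \<noteq> 0"
  shows "((\<lambda>s. U j (x + s *\<^sub>R axis i 1)) has_real_derivative partial i (U j) x) (at 0)"
    "((\<lambda>s. partial i (U j) (x + s *\<^sub>R axis i 1)) has_real_derivative partial i (partial i (U j)) x) (at 0)"
    "((\<lambda>s. p (x + s *\<^sub>R axis i 1)) has_real_derivative partial i p x) (at 0)"
  using has_real_derivative_partial[of "U j" x 0 i] has_real_derivative_partial[of "partial i (U j)" x 0 i]
    has_real_derivative_partial[of p x 0 i] differentiable[OF assms] by simp_all

text \<open>Off the origin the density is the divergence of W, as the remaining terms are the
  equations of motion multiplied by f or by U_j f. In general U_i U_j f, p f and f times a
  derivative of U_j are of order 2, and their flux through small spheres would persist. With f 0 = 0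
  they drop to order 1, and the terms of order 3 in the derivatives drop to the integrable order
  2.\<close>

lemma weak_vanishing:
  assumes f: "C2_test R f d dd" and "f differentiable (at 0)" "f 0 = 0"
  shows "has_bochner_integral lborel (weak j d dd) 0"
proof -
  define W where "W i x = - U j x * d i x + partial i (U j) x * f x - U i x * U j x * f x
    - (if i = j then 1 else 0) * (p x * f x)" for i x
  define W' where "W' i x = - (partial i (U j) x * d i x + U j x * dd i x)
    + (partial i (partial i (U j)) x * f x + partial i (U j) x * d i x)
    - ((partial i (U i) x * U j x + U i x * partial i (U j) x) * f x + U i x * U j x * d i x)
    - (if i = j then 1 else 0) * (partial i p x * f x + p x * d i x)" for i x
  note of = singular_order_vanishing[OF C2_testD(1)[OF f] assms(2,3)]
  note od = singular_order_continuous[OF C2_testD(2)[OF f]] singular_order_continuous[OF C2_testD(3)[OF f]]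
  note mult = singular_order_mult[of R _ _ _ _]
  have int: "has_bochner_integral lborel (W' i) 0" for i
  proof (rule has_bochner_integral_partial_derivative)
    have "singular_order R 1 (\<lambda>x. - U j x * d i x)"
      using mult[OF singular_order_uminus[OF singular_order_U] od(1)] by simp
    moreover have "singular_order R 1 (\<lambda>x. partial i (U j) x * f x)"
      using mult[OF singular_order_partial_U of] by simp
    moreover have "singular_order R 1 (\<lambda>x. U i x * U j x * f x)"
      using mult[OF mult[OF singular_order_U singular_order_U] of] by simp
    moreover have "singular_order R 1 (\<lambda>x. (if i = j then 1 else 0) * (p x * f x))"
      using mult[OF singular_order_const mult[OF singular_order_p of]] by simp
    ultimately show "singular_order R 1 (W i)"
      unfolding W_def[abs_def] by (intro singular_order_diff singular_order_add)
    have 1: "singular_order R 2 (\<lambda>x. partial i (U j) x * d i x)"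
      using mult[OF singular_order_partial_U od(1)] by simp
    have 2: "singular_order R 2 (\<lambda>x. U j x * dd i x)"
      using mult[OF singular_order_U od(2)] by (rule singular_order_mono) simp
    have 3: "singular_order R 2 (\<lambda>x. partial i (partial i (U j)) x * f x)"
      using mult[OF singular_order_partial_partial_U of] by simp
    have "singular_order R 3 (\<lambda>x. partial i (U i) x * U j x)"
      using mult[OF singular_order_partial_U singular_order_U] by simp
    moreover have "singular_order R 3 (\<lambda>x. U i x * partial i (U j) x)"
      using mult[OF singular_order_U singular_order_partial_U] by simp
    ultimately have "singular_order R 3 (\<lambda>x. partial i (U i) x * U j x + U i x * partial i (U j) x)"
      by (rule singular_order_add)
    then have 4: "singular_order R 2 (\<lambda>x. (partial i (U i) x * U j x + U i x * partial i (U j) x) * f x)"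
      using mult[OF _ of] by fastforce
    have 5: "singular_order R 2 (\<lambda>x. U i x * U j x * d i x)"
      using mult[OF mult[OF singular_order_U singular_order_U] od(1)] by simp
    have "singular_order R 2 (\<lambda>x. partial i p x * f x)"
      using mult[OF singular_order_partial_p of] by simp
    moreover have "singular_order R 2 (\<lambda>x. p x * d i x)"
      using mult[OF singular_order_p od(1)] by simp
    ultimately have "singular_order R 2 (\<lambda>x. partial i p x * f x + p x * d i x)"
      by (rule singular_order_add)
    from mult[OF singular_order_const[of R "if i = j then 1 else 0"] this]
    have 6: "singular_order R 2 (\<lambda>x. (if i = j then 1 else 0) * (partial i p x * f x + p x * d i x))"
      by simp
    show "singular_order R 2 (W' i)"
      unfolding W'_def[abs_def]
      by (intro singular_order_diff singular_order_add singular_order_uminus 1 2 3 4 5 6)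
    show "W i x = 0" "W' i x = 0" if "norm x > R" for x
      by (simp_all add: W_def W'_def C2_testD(6-8)[OF f that])
    show "((\<lambda>s. W i (x + s *\<^sub>R axis i 1)) has_real_derivative W' i x) (at 0)" if "x \<noteq> 0" for x
      unfolding W_def W'_def
      by (auto intro!: derivative_eq_intros line_derivatives[OF that] C2_testD(4,5)[OF f]
          simp: algebra_simps)
  qed
  have "has_bochner_integral lborel (\<lambda>x. \<Sum>i\<in>UNIV. W' i x) (\<Sum>i\<in>(UNIV :: 3 set). 0)"
    by (intro has_bochner_integral_sum int)
  moreover have "(\<Sum>i\<in>UNIV. W' i x) = weak j d dd x" if "x \<noteq> 0" for x
  proof -
    have e: "partial 3 (U 3) x = - partial 1 (U 1) x - partial 2 (U 2) x"
      using incompressible[OF that] by linarith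
    have "(\<Sum>i\<in>UNIV. (if i = j then 1 else 0) * (partial i p x * f x + p x * d i x)) = partial j p x * f x + p x * d j x"
      by (simp add: if_distrib[of "\<lambda>u. u * _"] cong: if_cong)
    then have "(\<Sum>i\<in>UNIV. W' i x) = (\<Sum>i\<in>UNIV. - (partial i (U j) x * d i x + U j x * dd i x)
        + (partial i (partial i (U j)) x * f x + partial i (U j) x * d i x)
        - ((partial i (U i) x * U j x + U i x * partial i (U j) x) * f x + U i x * U j x * d i x))
        - (partial j p x * f x + p x * d j x)"
      unfolding W'_def by (simp add: sum_subtractf)
    also have "\<dots> = - U j x * (\<Sum>i\<in>UNIV. dd i x) - (\<Sum>i\<in>UNIV. U i x * U j x * d i x) - p x * d j x
      + (laplacian (U j) x - (U 1 x * partial 1 (U j) x + U 2 x * partial 2 (U j) x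
         + U 3 x * partial 3 (U j) x) - partial j p x) * f x
      - (partial 1 (U 1) x + partial 2 (U 2) x + partial 3 (U 3) x) * U j x * f x"
      unfolding sum_3 laplacian_def by (simp add: algebra_simps)
    also have "\<dots> = weak j d dd x"
      by (simp add: ns_momentum[OF that, of j] incompressible[OF that] weak_def)
    finally show ?thesis .
  qed
  then have "AE x in lborel. (\<Sum>i\<in>UNIV. W' i x) = weak j d dd x"
    using AE_lborel_singleton[of "0 :: real^3"] by (auto elim!: eventually_mono)
  moreover have "(\<lambda>x. \<Sum>i\<in>UNIV. W' i x) \<in> borel_measurable lborel"
    using calculation(1) by (simp only: has_bochner_integral_iff) (rule borel_measurable_integrable, simp)
  moreover have "weak j d dd \<in> borel_measurable lborel"
    using weak_integrable[OF f] by (rule borel_measurable_integrable)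
  ultimately show ?thesis
    using has_bochner_integral_cong_AE[of "\<lambda>x. \<Sum>i\<in>UNIV. W' i x" lborel "weak j d dd" 0] by simp
qed

text \<open>The value of the functional on a function equal to 1 at the origin, hence the
  coefficient of the delta function.\<close>

definition force :: "real^3" where
  "force = (\<chi> j. \<integral>x. weak j bump_d bump_dd x \<partial>lborel)"

text \<open>The functional is linear, and f - f 0 * hat ^ 3 vanishes at the origin.\<close>

lemma weak_C2_test:
  assumes f: "C2_test R f d dd" and "R \<ge> 1" "f differentiable (at 0)"
  shows "has_bochner_integral lborel (weak j d dd) (force $ j * f 0)"
proof -
  let ?c = "f 0"
  have hat0: "hat 0 = 1" by (simp add: hat_def)
  have "has_bochner_integral lborel (weak j (\<lambda>i x. d i x - ?c * bump_d i x) (\<lambda>i x. dd i x - ?c * bump_dd i x)) 0"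
    by (rule weak_vanishing[OF C2_test_diff_scaled[OF f C2_test_bump[OF assms(2)]]])
      (auto intro!: differentiable_diff differentiable_mult assms(3) bump_differentiable simp: hat0)
  moreover have "has_bochner_integral lborel (weak j bump_d bump_dd) (force $ j)"
    using weak_integrable[OF C2_test_bump[OF assms(2)]] by (simp add: has_bochner_integral_iff force_def)
  then have "has_bochner_integral lborel (\<lambda>x. ?c * weak j bump_d bump_dd x) (?c * force $ j)"
    by (rule has_bochner_integral_mult_right)
  ultimately have "has_bochner_integral lborel (\<lambda>x. weak j (\<lambda>i x. d i x - ?c * bump_d i x) (\<lambda>i x. dd i x - ?c * bump_dd i x) x
      + ?c * weak j bump_d bump_dd x) (0 + ?c * force $ j)"
    by (rule has_bochner_integral_add)
  also have "(\<lambda>x. weak j (\<lambda>i x. d i x - ?c * bump_d i x) (\<lambda>i x. dd i x - ?c * bump_dd i x) x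
      + ?c * weak j bump_d bump_dd x) = weak j d dd"
    by (rule ext) (simp add: weak_def sum_3 algebra_simps)
  finally show ?thesis by (simp add: mult.commute)
qed

text \<open>The flux U_i f has order 1 for every bounded f, so no point mass arises at the origin,
  whatever the value f 0 is.\<close>

lemma weak_divergence:
  assumes f: "C2_test R f d dd"
  shows "has_bochner_integral lborel (\<lambda>x. \<Sum>i\<in>UNIV. U i x * d i x) 0"
proof -
  note of = singular_order_continuous[OF C2_testD(1)[OF f]] singular_order_continuous[OF C2_testD(2)[OF f]]
  define W' where "W' i x = partial i (U i) x * f x + U i x * d i x" for i x
  have int: "has_bochner_integral lborel (W' i) 0" for i
  proof (rule has_bochner_integral_partial_derivative)
    show "singular_order R 1 (\<lambda>x. U i x * f x)"
      using singular_order_mult[OF singular_order_U of(1)] by simp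
    have "singular_order R 2 (\<lambda>x. U i x * d i x)"
      using singular_order_mult[OF singular_order_U of(2)] by (rule singular_order_mono) simp
    moreover have "singular_order R 2 (\<lambda>x. partial i (U i) x * f x)"
      using singular_order_mult[OF singular_order_partial_U of(1)] by simp
    ultimately show "singular_order R 2 (W' i)"
      unfolding W'_def[abs_def] by (intro singular_order_add)
    show "U i x * f x = 0" "W' i x = 0" if "norm x > R" for x
      by (simp_all add: W'_def C2_testD(6,7)[OF f that])
    show "((\<lambda>s. U i (x + s *\<^sub>R axis i 1) * f (x + s *\<^sub>R axis i 1)) has_real_derivative W' i x) (at 0)" if "x \<noteq> 0" for x
      unfolding W'_def
      by (auto intro!: derivative_eq_intros line_derivatives[OF that] C2_testD(4)[OF f])
  qed
  have "has_bochner_integral lborel (\<lambda>x. \<Sum>i\<in>UNIV. W' i x) (\<Sum>i\<in>(UNIV :: 3 set). 0)"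
    by (intro has_bochner_integral_sum int)
  moreover have "(\<Sum>i\<in>UNIV. W' i x) = (\<Sum>i\<in>UNIV. U i x * d i x)" if "x \<noteq> 0" for x
  proof -
    have "(\<Sum>i\<in>UNIV. W' i x) = (partial 1 (U 1) x + partial 2 (U 2) x + partial 3 (U 3) x) * f x
      + (\<Sum>i\<in>UNIV. U i x * d i x)" unfolding W'_def sum_3 by (simp add: algebra_simps)
    then show ?thesis by (simp add: incompressible[OF that])
  qed
  then have "AE x in lborel. (\<Sum>i\<in>UNIV. W' i x) = (\<Sum>i\<in>UNIV. U i x * d i x)"
    using AE_lborel_singleton[of "0 :: real^3"] by (auto elim!: eventually_mono)
  moreover have "(\<lambda>x. \<Sum>i\<in>UNIV. W' i x) \<in> borel_measurable lborel"
    using calculation(1) by (simp only: has_bochner_integral_iff) (rule borel_measurable_integrable, simp)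
  moreover have "singular_order R 1 (\<lambda>x. \<Sum>i\<in>UNIV. U i x * d i x)"
    using singular_order_mult[OF singular_order_U of(2)] by (intro singular_order_sum) auto
  then have "(\<lambda>x. \<Sum>i\<in>UNIV. U i x * d i x) \<in> borel_measurable lborel"
    using borel_measurable_continuous_off_0 by (simp add: singular_order_def)
  ultimately show ?thesis
    using has_bochner_integral_cong_AE[of "\<lambda>x. \<Sum>i\<in>UNIV. W' i x" lborel "\<lambda>x. \<Sum>i\<in>UNIV. U i x * d i x" 0] by simp
qed

lemma distributional_ns_force: "distributional_ns force u p"
  unfolding distributional_ns_def
proof (intro conjI allI impI)
  fix \<phi> :: "real^3 \<Rightarrow> real^3" assume t: "test_function \<phi>"
  then obtain R where R: "R \<ge> 1" "\<And>x. norm x > R \<Longrightarrow> \<phi> x = 0"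
    by (rule test_function_bounded_support) blast
  have s: "smooth_on UNIV \<phi>" using t by (simp add: test_function_def)
  define f where "f j x = \<phi> x $ j" for j x
  have sf: "smooth_on UNIV (f j)" for j
    unfolding f_def by (rule smooth_on_component[OF open_UNIV s])
  have C2: "C2_test R (f j) (\<lambda>i. partial i (f j)) (\<lambda>i. partial i (partial i (f j)))" for j
    by (rule test_function_C2_test[OF sf]) (simp add: f_def R(2))
  have "has_bochner_integral lborel (\<lambda>x. \<Sum>j\<in>UNIV. weak j (\<lambda>i. partial i (f j)) (\<lambda>i. partial i (partial i (f j))) x)
    (\<Sum>j\<in>UNIV. force $ j * f j 0)"
    by (intro has_bochner_integral_sum weak_C2_test[OF C2 R(1)] smooth_on_differentiable[OF sf]) simp
  moreover have "(\<Sum>j\<in>UNIV. force $ j * f j 0) = force \<bullet> \<phi> 0"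
    by (simp add: inner_vec_def f_def)
  moreover have "(\<Sum>j\<in>UNIV. weak j (\<lambda>i. partial i (f j)) (\<lambda>i. partial i (partial i (f j))) x)
    = - (u x \<bullet> laplacian \<phi> x) - advect u \<phi> x \<bullet> u x - p x * divergence \<phi> x" for x
  proof -
    have pf: "partial i \<phi> x $ j = partial i (f j) x" for i j
      unfolding f_def by (rule partial_component[symmetric]) (rule smooth_on_differentiable[OF s UNIV_I])
    have lf: "laplacian \<phi> x $ j = laplacian (f j) x" for j
      unfolding f_def by (rule laplacian_component[OF open_UNIV UNIV_I s, symmetric])
    have "u x \<bullet> laplacian \<phi> x = (\<Sum>j\<in>UNIV. U j x * (\<Sum>i\<in>UNIV. partial i (partial i (f j)) x))"
      by (simp add: inner_vec_def lf) (simp add: laplacian_def)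
    moreover have "advect u \<phi> x \<bullet> u x = (\<Sum>j\<in>UNIV. \<Sum>i\<in>UNIV. U i x * U j x * partial i (f j) x)"
      by (simp add: inner_vec_def advect_def pf sum_distrib_right sum_distrib_left mult_ac)
    moreover have "p x * divergence \<phi> x = (\<Sum>j\<in>UNIV. p x * partial j (f j) x)"
      by (simp add: divergence_def pf sum_distrib_left)
    ultimately show ?thesis
      by (simp add: weak_def sum_subtractf sum_negf)
  qed
  ultimately show "has_bochner_integral lborel
      (\<lambda>x. - (u x \<bullet> laplacian \<phi> x) - advect u \<phi> x \<bullet> u x - p x * divergence \<phi> x) (force \<bullet> \<phi> 0)"
    by simp
next
  fix \<psi> :: "real^3 \<Rightarrow> real" assume t: "test_function \<psi>"
  then obtain R where R: "R \<ge> 1" "\<And>x. norm x > R \<Longrightarrow> \<psi> x = 0"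
    by (rule test_function_bounded_support) blast
  have s: "smooth_on UNIV \<psi>" using t by (simp add: test_function_def)
  have "has_bochner_integral lborel (\<lambda>x. \<Sum>i\<in>UNIV. U i x * partial i \<psi> x) 0"
    by (rule weak_divergence[OF test_function_C2_test[OF s R(2)]])
  then show "has_bochner_integral lborel (\<lambda>x. u x \<bullet> gradient \<psi> x) 0"
    by (simp add: inner_vec_def gradient_def)
qed

lemma landau_solution_if_force: "force \<noteq> 0 \<Longrightarrow> landau_solution u"
  unfolding landau_solution_def
  using homogeneous_u homogeneous_p smooth_u smooth_p distributional_ns_force by blast

end

section \<open>The force of a Landau solution\<close>

text \<open>Found by integration: (1 - t^2) psi' - 2 t psi is the derivative of (1 - t^2) psi, to be
  equated with the desired right-hand side minus the density. The part (t^2 - 1) / (2 (a - t)^2) of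
  the target reproduces the 1 / (a - t) and constant terms of the density, so no logarithm appears.
  The constant 4 / (3 (a^2 - 1)) is the one for which the antiderivative can vanish at both t = 1
  and t = -1, hence is divisible by 1 - t^2. It is also the rational term in the relation between
  \<beta> and a.\<close>

definition psi :: "real \<Rightarrow> real \<Rightarrow> real" where
  "psi a t = 4 / (3 * (a\<^sup>2 - 1)) * (a * (a\<^sup>2 - 1)\<^sup>2 / (a - t) ^ 3 + (a\<^sup>2 - 1) * (3 - a\<^sup>2) / (a - t)\<^sup>2 + 4 * a / (a - t))"

definition psi' :: "real \<Rightarrow> real \<Rightarrow> real" where
  "psi' a t = 4 / (3 * (a\<^sup>2 - 1)) * (3 * (a * (a\<^sup>2 - 1)\<^sup>2) / (a - t) ^ 4 + 2 * ((a\<^sup>2 - 1) * (3 - a\<^sup>2)) / (a - t) ^ 3 + 4 * a / (a - t)\<^sup>2)"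

lemma has_real_derivative_psi:
  assumes "a - t \<noteq> 0"
  shows "(psi a has_real_derivative psi' a t) (at t)"
proof -
  have 1: "((\<lambda>t. c / (a - t) ^ Suc n) has_real_derivative real (Suc n) * c / (a - t) ^ Suc (Suc n)) (at t)" for c n
  proof -
    have "((\<lambda>t. a - t) has_real_derivative - 1) (at t)" by (auto intro!: derivative_eq_intros)
    from DERIV_divide[OF DERIV_const DERIV_power_Suc[OF this, of n], of c] assms
    have D: "((\<lambda>t. c / (a - t) ^ Suc n) has_real_derivative
      (0 * (a - t) ^ Suc n - c * ((1 + real n) * (- 1 * (a - t) ^ n))) / ((a - t) ^ Suc n * (a - t) ^ Suc n)) (at t)"
      by simp
    have eq: "(0 * e ^ Suc n - c * ((1 + m) * (- 1 * e ^ n))) / (e ^ Suc n * e ^ Suc n)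
      = (1 + m) * c / e ^ Suc (Suc n)" if "e \<noteq> 0" for e m :: real
      using that by (simp add: field_simps)
    show ?thesis using D unfolding eq[OF assms] of_nat_Suc .
  qed
  have "((\<lambda>t. 4 / (3 * (a\<^sup>2 - 1)) * (a * (a\<^sup>2 - 1)\<^sup>2 / (a - t) ^ Suc 2 + (a\<^sup>2 - 1) * (3 - a\<^sup>2) / (a - t) ^ Suc 1 + 4 * a / (a - t) ^ Suc 0))
    has_real_derivative 4 / (3 * (a\<^sup>2 - 1)) * (real (Suc 2) * (a * (a\<^sup>2 - 1)\<^sup>2) / (a - t) ^ Suc (Suc 2)
      + real (Suc 1) * ((a\<^sup>2 - 1) * (3 - a\<^sup>2)) / (a - t) ^ Suc (Suc 1) + real (Suc 0) * (4 * a) / (a - t) ^ Suc (Suc 0))) (at t)"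
    by (intro DERIV_cmult DERIV_add 1)
  then show ?thesis
    unfolding psi_def[abs_def] psi'_def by (simp add: eval_nat_numeral mult.assoc)
qed

text \<open>
  The left-hand side is \<open>|x|\<close> times the divergence-corrected density of the third component of the
  force; \<open>psi\<close> solves the linear equation that makes the right-hand side of one sign.
\<close>

lemma landau_density_identity:
  fixes a t :: real
  assumes "\<bar>a\<bar> > 1" "a - t \<noteq> 0"
  defines "d \<equiv> a - t"
  defines "Z \<equiv> 2 / d + 2 * t * (a * t - 1) / d\<^sup>2"
  shows "Z + Z * (2 * (a * a - 1) / d\<^sup>2 - 2) + 4 * (a * t - 1) / d\<^sup>2 * t
    + ((1 - t\<^sup>2) * psi' a t - 2 * t * psi a t)
    = 4 * a * ((t\<^sup>2 - 1) / (2 * d\<^sup>2) + 4 / (3 * (a\<^sup>2 - 1)))"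
proof -
  have "a\<^sup>2 > 1" using assms(1) by (metis abs_ge_zero one_less_power pos2 power2_abs)
  then have N: "a\<^sup>2 - 1 \<noteq> 0" by simp
  define N where "N = a\<^sup>2 - 1"
  have a2: "a\<^sup>2 = N + 1" "a * a = N + 1" by (simp_all add: N_def power2_eq_square)
  have t: "t = a - d" by (simp add: d_def)
  have d: "d \<noteq> 0" using assms(2) by (simp add: d_def)
  have N0: "N \<noteq> 0" using N by (simp add: N_def)
  have at: "a * t - 1 = N - a * d" by (simp add: t N_def algebra_simps power2_eq_square)
  have t2: "1 - t\<^sup>2 = - N + 2 * a * d - d\<^sup>2" by (simp add: t N_def algebra_simps power2_eq_square)
  have Z: "Z = 2 * a - 4 * N / d + 2 * a * N / d\<^sup>2"
    unfolding Z_def at using d by (simp add: t field_simps power2_eq_square) (simp add: N_def algebra_simps power2_eq_square)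
  have "Z + Z * (2 * (a * a - 1) / d\<^sup>2 - 2) + 4 * (a * t - 1) / d\<^sup>2 * t
      = 4 * a * N\<^sup>2 / d ^ 4 - 8 * N\<^sup>2 / d ^ 3 + 6 * a * N / d\<^sup>2 - 4 * a\<^sup>2 / d + 2 * a"
    unfolding Z at a2 using d
    by (simp add: t field_simps power2_eq_square eval_nat_numeral) (simp add: N_def algebra_simps power2_eq_square)
  moreover have "(1 - t\<^sup>2) * psi' a t - 2 * t * psi a t
      = 4 * a * ((t\<^sup>2 - 1) / (2 * d\<^sup>2) + 4 / (3 * N))
        - (4 * a * N\<^sup>2 / d ^ 4 - 8 * N\<^sup>2 / d ^ 3 + 6 * a * N / d\<^sup>2 - 4 * a\<^sup>2 / d + 2 * a)"
  proof -
    have p: "psi a t = 4 / (3 * N) * (a * N\<^sup>2 / d ^ 3 + N * (2 - N) / d\<^sup>2 + 4 * a / d)"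
      "psi' a t = 4 / (3 * N) * (3 * a * N\<^sup>2 / d ^ 4 + 2 * N * (2 - N) / d ^ 3 + 4 * a / d\<^sup>2)"
      unfolding psi_def psi'_def d_def[symmetric] N_def[symmetric] by (simp_all add: N_def)
    have t2': "t\<^sup>2 - 1 = N - 2 * a * d + d\<^sup>2" using t2 by linarith
    show ?thesis
      unfolding p t2 t2' unfolding t using d N0
      by (simp add: field_simps power2_eq_square eval_nat_numeral) (use a2 in algebra)
  qed
  ultimately show ?thesis unfolding N_def[symmetric] by linarith
qed

text \<open>The identity (a - t)^2 - (1 - t^2) (a^2 - 1) = (1 - a t)^2 bounds the negative term by
  half of 1 / (a^2 - 1), and 4/3 exceeds 1/2.\<close>

lemma landau_density_positive:
  fixes a t :: real
  assumes "\<bar>a\<bar> > 1" "a - t \<noteq> 0"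
  shows "(t\<^sup>2 - 1) / (2 * (a - t)\<^sup>2) + 4 / (3 * (a\<^sup>2 - 1)) > 0"
proof -
  have a: "a\<^sup>2 - 1 > 0" using assms(1) by (metis abs_ge_zero one_less_power pos2 power2_abs diff_gt_0_iff_gt)
  have d: "(a - t)\<^sup>2 > 0" using assms(2) by simp
  have "(1 - t\<^sup>2) * (a\<^sup>2 - 1) \<le> (a - t)\<^sup>2"
  proof -
    have "(a - t)\<^sup>2 - (1 - t\<^sup>2) * (a\<^sup>2 - 1) = (1 - a * t)\<^sup>2" by (simp add: power2_eq_square algebra_simps)
    then show ?thesis by (smt (verit) zero_le_power2)
  qed
  then have "(1 - t\<^sup>2) / (a - t)\<^sup>2 \<le> 1 / (a\<^sup>2 - 1)"
    using a d by (simp add: field_simps)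
  moreover have "1 / (a\<^sup>2 - 1) > 0" using a by simp
  moreover have "- x / 2 + 4 / 3 * y > 0" if "x \<le> y" "y > 0" for x y :: real
    using that by linarith
  ultimately have "- ((1 - t\<^sup>2) / (a - t)\<^sup>2) / 2 + 4 / 3 * (1 / (a\<^sup>2 - 1)) > 0" by blast
  moreover have "(t\<^sup>2 - 1) / (2 * (a - t)\<^sup>2) = - ((1 - t\<^sup>2) / (a - t)\<^sup>2) / 2"
    using d by (simp add: field_simps)
  moreover have "4 / (3 * (a\<^sup>2 - 1)) = 4 / 3 * (1 / (a\<^sup>2 - 1))" by simp
  ultimately show ?thesis by (simp only:)
qed

lemma has_real_derivative_norm_axis:
  fixes x :: "real^3"
  assumes "x \<noteq> 0"
  shows "((\<lambda>s. norm (x + s *\<^sub>R axis i 1)) has_real_derivative x $ i / norm x) (at 0)"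
proof -
  have q: "norm (x + s *\<^sub>R axis i 1) = sqrt ((norm x)\<^sup>2 + 2 * s * x $ i + s\<^sup>2)" for s
    unfolding norm_eq_sqrt_inner[of "x + s *\<^sub>R axis i 1"] power2_norm_eq_inner
    by (simp add: inner_add_left inner_add_right inner_axis inner_axis' power2_eq_square algebra_simps)
  show ?thesis unfolding q
    using assms by (auto intro!: derivative_eq_intros simp: field_simps)
qed

section \<open>Direction cosines and the tangential flux\<close>

definition dir :: "3 \<Rightarrow> real^3 \<Rightarrow> real" where
  "dir j x = x $ j / norm x"

lemma has_real_derivative_dir:
  assumes "x \<noteq> 0"
  shows "((\<lambda>s. dir j (x + s *\<^sub>R axis i 1)) has_real_derivative
    (axis i 1 $ j - dir i x * dir j x) / norm x) (at 0)"
proof -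
  have "((\<lambda>s. (x + s *\<^sub>R axis i 1) $ j) has_real_derivative axis i 1 $ j) (at 0)"
    by (auto intro!: derivative_eq_intros)
  from DERIV_divide[OF this has_real_derivative_norm_axis[OF assms]] assms
  have "((\<lambda>s. dir j (x + s *\<^sub>R axis i 1)) has_real_derivative
    (axis i 1 $ j * norm x - x $ j * (x $ i / norm x)) / (norm x * norm x)) (at 0)"
    by (simp add: dir_def)
  moreover have "(axis i 1 $ j * norm x - x $ j * (x $ i / norm x)) / (norm x * norm x)
    = (axis i 1 $ j - dir i x * dir j x) / norm x"
    using assms by (simp add: dir_def field_simps)
  ultimately show ?thesis by simp
qed

lemma dir_square_sum:
  assumes "x \<noteq> 0"
  shows "(dir 1 x)\<^sup>2 + (dir 2 x)\<^sup>2 + (dir 3 x)\<^sup>2 = 1"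
proof -
  have "(x $ 1)\<^sup>2 + (x $ 2)\<^sup>2 + (x $ 3)\<^sup>2 = (norm x)\<^sup>2" by (simp add: norm3)
  then show ?thesis
    using assms unfolding dir_def power_divide add_divide_distrib[symmetric] by simp
qed

lemma abs_dir_le_1: "\<bar>dir j x\<bar> \<le> 1"
  unfolding dir_def using component_le_norm_cart[of x j] by (simp add: divide_le_eq_1)

lemma dir_scaleR: "c > 0 \<Longrightarrow> dir j (c *\<^sub>R x) = dir j x"
  by (simp add: dir_def)

lemma continuous_on_dir: "continuous_on (- {0}) (dir j)"
  unfolding dir_def[abs_def] by (intro continuous_intros) auto

text \<open>This is norm x * psi t * grad t for t = \<open>dir 3 x\<close>: psi times the projection
  of e_z to the tangent plane of the sphere. Being tangential it is orthogonal to the gradient of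
  any radial factor, and norm x times its divergence is the derivative of (1 - t^2) psi.\<close>

definition flux :: "real \<Rightarrow> 3 \<Rightarrow> real^3 \<Rightarrow> real" where
  "flux a i x = psi a (dir 3 x) * (axis i 1 $ 3 - dir i x * dir 3 x)"

text \<open>The factor 1 / norm x of the derivative is split off, which leaves a 0-homogeneous and
  therefore bounded function.\<close>

definition flux_d :: "real \<Rightarrow> 3 \<Rightarrow> real^3 \<Rightarrow> real" where
  "flux_d a i x = psi' a (dir 3 x) * (axis i 1 $ 3 - dir i x * dir 3 x)\<^sup>2
    - psi a (dir 3 x) * (dir i x * (axis i 1 $ 3 - dir i x * dir 3 x) + dir 3 x * (1 - (dir i x)\<^sup>2))"

lemma dir_neq: "\<bar>a\<bar> > 1 \<Longrightarrow> a - dir j x \<noteq> 0"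
  using abs_dir_le_1[of j x] by auto

lemma has_real_derivative_flux:
  assumes "\<bar>a\<bar> > 1" "x \<noteq> 0"
  shows "((\<lambda>s. flux a i (x + s *\<^sub>R axis i 1)) has_real_derivative inverse (norm x) * flux_d a i x) (at 0)"
proof -
  have ps: "((\<lambda>s. psi a (dir 3 (x + s *\<^sub>R axis i 1))) has_real_derivative
      psi' a (dir 3 x) * ((axis i 1 $ 3 - dir i x * dir 3 x) / norm x)) (at 0)"
    using DERIV_chain2[OF has_real_derivative_psi has_real_derivative_dir[OF assms(2)]] dir_neq[OF assms(1)]
    by simp
  have "((\<lambda>s. flux a i (x + s *\<^sub>R axis i 1)) has_real_derivative
      psi' a (dir 3 x) * ((axis i 1 $ 3 - dir i x * dir 3 x) / norm x) * (axis i 1 $ 3 - dir i x * dir 3 x)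
      + (0 - ((axis i 1 $ i - dir i x * dir i x) / norm x * dir 3 x
          + (axis i 1 $ 3 - dir i x * dir 3 x) / norm x * dir i x)) * psi a (dir 3 x)) (at 0)"
    unfolding flux_def
    using DERIV_mult[OF ps DERIV_diff[OF DERIV_const DERIV_mult[OF has_real_derivative_dir[OF assms(2), of i i]
        has_real_derivative_dir[OF assms(2), of 3 i]]], of "axis i 1 $ 3"] by simp
  moreover have "psi' a (dir 3 x) * ((axis i 1 $ 3 - dir i x * dir 3 x) / norm x) * (axis i 1 $ 3 - dir i x * dir 3 x)
      + (0 - ((axis i 1 $ i - dir i x * dir i x) / norm x * dir 3 x
          + (axis i 1 $ 3 - dir i x * dir 3 x) / norm x * dir i x)) * psi a (dir 3 x)
      = inverse (norm x) * flux_d a i x"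
    unfolding flux_d_def using assms(2) by (simp add: axis_def field_simps power2_eq_square)
  ultimately show ?thesis by (simp only:)
qed

lemma continuous_on_psi_dir:
  assumes "\<bar>a\<bar> > 1"
  shows "continuous_on (- {0}) (\<lambda>x. psi a (dir 3 x))" "continuous_on (- {0}) (\<lambda>x. psi' a (dir 3 x))"
  unfolding psi_def psi'_def
  by (intro continuous_intros continuous_on_dir; use dir_neq[OF assms] in simp)+

lemma singular_order_flux:
  assumes "\<bar>a\<bar> > 1"
  shows "singular_order R 0 (flux a i)" "singular_order R 0 (flux_d a i)"
proof -
  show "singular_order R 0 (flux a i)"
    by (rule singular_order_homogeneous)
      (auto simp: homogeneous_def flux_def[abs_def] dir_scaleR
        intro!: continuous_intros continuous_on_dir continuous_on_psi_dir[OF assms])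
  show "singular_order R 0 (flux_d a i)"
    by (rule singular_order_homogeneous)
      (auto simp: homogeneous_def flux_d_def[abs_def] dir_scaleR
        intro!: continuous_intros continuous_on_dir continuous_on_psi_dir[OF assms])
qed

lemma flux_sums:
  assumes "x \<noteq> 0"
  shows "(\<Sum>i\<in>UNIV. x $ i * flux a i x) = 0"
    "(\<Sum>i\<in>UNIV. flux_d a i x) = (1 - (dir 3 x)\<^sup>2) * psi' a (dir 3 x) - 2 * dir 3 x * psi a (dir 3 x)"
proof -
  have ax: "axis 1 1 $ (3::3) = (0::real)" "axis 2 1 $ (3::3) = (0::real)" "axis 3 1 $ (3::3) = (1::real)"
    by (simp_all add: axis_def)
  have xd: "x $ i = norm x * dir i x" for i using assms by (simp add: dir_def)
  have "(\<Sum>i\<in>UNIV. x $ i * flux a i x)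
      = norm x * psi a (dir 3 x) * dir 3 x * (1 - ((dir 1 x)\<^sup>2 + (dir 2 x)\<^sup>2 + (dir 3 x)\<^sup>2))"
    unfolding sum_3 flux_def ax xd by (simp add: algebra_simps power2_eq_square)
  then show "(\<Sum>i\<in>UNIV. x $ i * flux a i x) = 0" unfolding dir_square_sum[OF assms] by simp
  have id: "P' * (0 - y1 * z)\<^sup>2 - P * (y1 * (0 - y1 * z) + z * (1 - y1\<^sup>2))
      + (P' * (0 - y2 * z)\<^sup>2 - P * (y2 * (0 - y2 * z) + z * (1 - y2\<^sup>2)))
      + (P' * (1 - z * z)\<^sup>2 - P * (z * (1 - z * z) + z * (1 - z\<^sup>2)))
      = (1 - z\<^sup>2) * P' - 2 * z * P + (y1\<^sup>2 + y2\<^sup>2 + z\<^sup>2 - 1) * (P' * z\<^sup>2 + 2 * z * P)"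
    for P P' y1 y2 z :: real
    by (simp add: power2_eq_square algebra_simps)
  show "(\<Sum>i\<in>UNIV. flux_d a i x) = (1 - (dir 3 x)\<^sup>2) * psi' a (dir 3 x) - 2 * dir 3 x * psi a (dir 3 x)"
    unfolding sum_3 flux_d_def ax id dir_square_sum[OF assms] by simp
qed

lemma singular_order_coordinate: "singular_order R (-1) (\<lambda>x. x $ i)"
  by (rule singular_orderI[where C = 1]) (auto intro!: continuous_intros simp: component_le_norm_cart)

lemma singular_order_inverse_norm: "singular_order R 1 (\<lambda>x. inverse (norm x))"
  by (rule singular_orderI[where C = 1]) (auto intro!: continuous_intros simp: power_int_minus)

context self_similar_ns
begin

text \<open>By symmetry the force can only point along the axis, so its third component decides. The
  density of that component is replaced by one with the same integral and a definite sign.\<close>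

lemma force_nonzero:
  assumes a: "\<bar>a\<bar> > 1" and M: "\<And>z. M z = 2 / (a * sqrt (1 + z\<^sup>2) - z)"
  shows "force \<noteq> 0"
proof
  assume "force = 0"
  \<comment> \<open>The divergence of 6 hat^2 U_3 x contains the same term - 24 hat * norm x ^ 2 *
    U_3 as the density; after subtraction only hat^2 / norm x times a function of the polar angle is
    left. The flux then redistributes this function over the angle without touching the radial
    factor.\<close>
  define F where "F i x = 6 * hat x ^ 2 * (U 3 x * x $ i - flux a i x)" for i x
  define F' where "F' i x = - 24 * x $ i * hat x * (U 3 x * x $ i - flux a i x)
    + 6 * hat x ^ 2 * (partial i (U 3) x * x $ i + U 3 x - inverse (norm x) * flux_d a i x)" for i x
  have int: "has_bochner_integral lborel (F' i) 0" for i
  proof (rule has_bochner_integral_partial_derivative[where R = 1])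
    have ch: "singular_order 1 0 (\<lambda>x. 6 * hat x ^ 2)" "singular_order 1 0 (\<lambda>x. - 24 * x $ i * hat x)"
      by (intro singular_order_continuous continuous_intros continuous_on_hat)+
    have "singular_order 1 0 (\<lambda>x. U 3 x * x $ i)"
      using singular_order_mult[OF singular_order_U singular_order_coordinate] by simp
    then have 1: "singular_order 1 0 (\<lambda>x. U 3 x * x $ i - flux a i x)"
      by (rule singular_order_diff[OF _ singular_order_flux(1)[OF a]])
    show "singular_order 1 1 (F i)"
      unfolding F_def[abs_def] using singular_order_mult[OF ch(1) 1] by (rule singular_order_mono) simp
    have "singular_order 1 1 (\<lambda>x. partial i (U 3) x * x $ i)"
      using singular_order_mult[OF singular_order_partial_U singular_order_coordinate] by simp
    moreover have "singular_order 1 1 (\<lambda>x. inverse (norm x) * flux_d a i x)"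
      using singular_order_mult[OF singular_order_inverse_norm singular_order_flux(2)[OF a]] by simp
    ultimately have 2: "singular_order 1 1 (\<lambda>x. partial i (U 3) x * x $ i + U 3 x - inverse (norm x) * flux_d a i x)"
      by (intro singular_order_diff singular_order_add singular_order_U)
    have 3: "singular_order 1 2 (\<lambda>x. - 24 * x $ i * hat x * (U 3 x * x $ i - flux a i x))"
      using singular_order_mult[OF ch(2) 1] by (rule singular_order_mono) simp
    have 4: "singular_order 1 2 (\<lambda>x. 6 * hat x ^ 2 * (partial i (U 3) x * x $ i + U 3 x - inverse (norm x) * flux_d a i x))"
      using singular_order_mult[OF ch(1) 2] by (rule singular_order_mono) simp
    show "singular_order 1 2 (F' i)"
      unfolding F'_def[abs_def] by (rule singular_order_add[OF 3 4])
    show "F i x = 0" "F' i x = 0" if "norm x > 1" for x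
      using hat_outside[OF that] by (simp_all add: F_def F'_def)
    show "((\<lambda>s. F i (x + s *\<^sub>R axis i 1)) has_real_derivative F' i x) (at 0)" if "x \<noteq> 0" for x
    proof -
      have h: "((\<lambda>s. 6 * hat (x + s *\<^sub>R axis i 1) ^ 2) has_real_derivative - 24 * x $ i * hat x) (at 0)"
        using DERIV_cmult[OF has_real_derivative_hat_power[of x i 0], of 6]
        by (simp add: eval_nat_numeral algebra_simps)
      have c: "((\<lambda>s. (x + s *\<^sub>R axis i 1) $ i) has_real_derivative 1) (at 0)"
        by (auto intro!: derivative_eq_intros simp: axis_def)
      from DERIV_mult[OF h DERIV_diff[OF DERIV_mult[OF line_derivatives(1)[OF that, of i 3] c]
          has_real_derivative_flux[OF a that, of i]]]
      show ?thesis unfolding F_def F'_def by (simp add: algebra_simps)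
    qed
  qed
  define D where "D x = weak 3 bump_d bump_dd x - (\<Sum>i\<in>UNIV. F' i x)" for x
  have "has_bochner_integral lborel (\<lambda>x. \<Sum>i\<in>UNIV. F' i x) (\<Sum>i\<in>(UNIV :: 3 set). 0)"
    by (intro has_bochner_integral_sum int)
  moreover have "has_bochner_integral lborel (weak 3 bump_d bump_dd) (force $ 3)"
    using weak_integrable[OF C2_test_bump[OF order_refl]] by (simp add: has_bochner_integral_iff force_def)
  ultimately have "has_bochner_integral lborel D (force $ 3 - 0)"
    unfolding D_def[abs_def] by (intro has_bochner_integral_diff) simp_all
  \<comment> \<open>The density D has the sign of a; the extra factor turns a into a^2 and covers
    both signs at once.\<close>
  then have "has_bochner_integral lborel (\<lambda>x. a * D x) 0"
    using has_bochner_integral_mult_right[of a lborel D 0] \<open>force = 0\<close> by simp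
  then have aD: "integrable lborel (\<lambda>x. a * D x)" "(\<integral>x. a * D x \<partial>lborel) = 0"
    by (simp_all add: has_bochner_integral_iff)
  have sign: "\<exists>c>0. a * D x = c * hat x ^ 2" if x12: "x $ 1 \<noteq> 0 \<or> x $ 2 \<noteq> 0" for x
  proof -
    have x0: "x \<noteq> 0" using x12 by auto
    define t d \<rho> where "t = dir 3 x" and "d = a - t" and "\<rho> = norm x"
    have rho: "\<rho> > 0" using x0 by (simp add: \<rho>_def)
    have tx: "t = x $ 3 / norm x" by (simp add: t_def dir_def)
    note L = landau_formulas[OF a M x12, folded tx, folded d_def]
    have r2: "(\<Sum>i\<in>UNIV. (x $ i)\<^sup>2) = \<rho>\<^sup>2"
      by (simp add: \<rho>_def norm3 sum_3)
    have ux: "(\<Sum>i\<in>UNIV. U i x * x $ i) = u x \<bullet> x" by (simp add: inner_vec_def)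
    have eul: "(\<Sum>i\<in>UNIV. partial i (U 3) x * x $ i) = - U 3 x"
      using euler_homogeneous[OF homogeneous_U differentiable(1)[OF x0] x0, of 3] by (simp add: sum_3 mult.commute)
    have w: "weak 3 bump_d bump_dd x = U 3 x * (18 * hat x ^ 2 - 24 * (\<Sum>i\<in>UNIV. (x $ i)\<^sup>2) * hat x)
        + 6 * hat x ^ 2 * U 3 x * (\<Sum>i\<in>UNIV. U i x * x $ i) + 6 * hat x ^ 2 * p x * x $ 3"
      unfolding weak_def bump_d_def bump_dd_def sum_3 by (simp add: algebra_simps)
    have f: "(\<Sum>i\<in>UNIV. F' i x) = - 24 * hat x * (U 3 x * (\<Sum>i\<in>UNIV. (x $ i)\<^sup>2) - (\<Sum>i\<in>UNIV. x $ i * flux a i x))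
        + 6 * hat x ^ 2 * ((\<Sum>i\<in>UNIV. partial i (U 3) x * x $ i) + 3 * U 3 x - inverse (norm x) * (\<Sum>i\<in>UNIV. flux_d a i x))"
      unfolding F'_def sum_3 by (simp add: algebra_simps power2_eq_square)
    have "D x = 6 * hat x ^ 2 * (U 3 x + U 3 x * (u x \<bullet> x) + p x * x $ 3
        + inverse (norm x) * (\<Sum>i\<in>UNIV. flux_d a i x))"
      unfolding D_def w f flux_sums(1)[OF x0] eul ux by (simp add: algebra_simps)
    also have "\<dots> = 6 * hat x ^ 2 / \<rho> * (\<rho> * U 3 x + \<rho> * U 3 x * (u x \<bullet> x) + \<rho>\<^sup>2 * p x * t
        + (\<Sum>i\<in>UNIV. flux_d a i x))"
      using rho tx by (simp add: \<rho>_def field_simps power2_eq_square)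
    also have "\<dots> = 6 * hat x ^ 2 / \<rho> * (4 * a * ((t\<^sup>2 - 1) / (2 * d\<^sup>2) + 4 / (3 * (a\<^sup>2 - 1))))"
      unfolding flux_sums(2)[OF x0] \<rho>_def L(3-5) t_def[symmetric]
      unfolding d_def landau_density_identity[OF a L(2)[unfolded d_def]] by (rule refl)
    finally have "a * D x = (24 * a\<^sup>2 / \<rho> * ((t\<^sup>2 - 1) / (2 * d\<^sup>2) + 4 / (3 * (a\<^sup>2 - 1)))) * hat x ^ 2"
      by (simp add: power2_eq_square mult_ac)
    moreover have "24 * a\<^sup>2 / \<rho> * ((t\<^sup>2 - 1) / (2 * d\<^sup>2) + 4 / (3 * (a\<^sup>2 - 1))) > 0"
    proof -
      have "24 * a\<^sup>2 / \<rho> > 0" using rho a by auto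
      then show ?thesis
        using landau_density_positive[OF a, of t] L(2) unfolding d_def by (intro mult_pos_pos) auto
    qed
    ultimately show ?thesis by blast
  qed
  have off: "AE x in lborel. (x :: real^3) $ 1 \<noteq> 0 \<or> x $ 2 \<noteq> 0"
    using AE_coordinate_nonzero[of 1] by (auto elim!: eventually_mono)
  then have "AE x in lborel. a * D x \<ge> 0"
  proof eventually_elim
    case (elim x)
    then obtain c where "c > 0" "a * D x = c * hat x ^ 2" using sign by blast
    then show ?case by simp
  qed
  then have "AE x in lborel. a * D x = 0"
    using integral_nonneg_eq_0_iff_AE[OF aD(1)] aD(2) by blast
  \<comment> \<open>As \<open>hat\<close> is positive inside the unit ball, a density that vanishes
    almost everywhere would make the ball a null set.\<close>
  then have "AE x in lborel. (x :: real^3) \<notin> ball 0 1"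
    using off
  proof eventually_elim
    case (elim x)
    then obtain c where "c > 0" "a * D x = c * hat x ^ 2" using sign by blast
    with elim(1) have "hat x = 0" by simp
    then have "(norm x)\<^sup>2 \<ge> 1" by (simp add: hat_def max_def split: if_splits)
    then have "norm x \<ge> 1" using power2_le_imp_le[of 1 "norm x"] by simp
    then show ?case by simp
  qed
  then have "emeasure lborel {x \<in> space lborel. x \<in> ball (0 :: real^3) 1} = 0"
    by (subst (asm) AE_iff_measurable[OF _ refl]) auto
  moreover have "emeasure lborel (ball (0 :: real^3) 1) > 0"
    by (subst emeasure_ball) (auto simp: unit_ball_vol_pos)
  moreover have "{x \<in> space lborel. x \<in> ball (0 :: real^3) 1} = ball 0 1" by auto
  ultimately show False by (metis less_irrefl)
qed

end

theorem corollary1p1: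
  fixes u B :: "real^3 \<Rightarrow> real^3" and p :: "real^3 \<Rightarrow> real"
    and ur ut uz Bt :: "real \<Rightarrow> real \<Rightarrow> real" and \<alpha> :: real
  assumes "smooth_on (- {0}) u" and "smooth_on (- {0}) B" and "smooth_on (- {0}) p"
    and "stationary_mhd u B p"
    and "self_similar u B p"
    and "axisymmetric_with ur ut uz u"
    and "axisymmetric_with (\<lambda>r z. 0) Bt (\<lambda>r z. 0) B"
    and "\<forall>x \<in> sphere 0 1. ur (cyl_radius x) (x $ 3) \<le> \<alpha>"
    and "\<alpha> < 2 * sqrt 2 / 3"
  shows "(landau_solution u \<or> (\<forall>x. x \<noteq> 0 \<longrightarrow> u x = 0)) \<and> (\<forall>x. x \<noteq> 0 \<longrightarrow> B x = 0)"
proof -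
  interpret self_similar_mhd u B p ur ut uz Bt
    using assms by unfold_locales
  have B: "B x = 0" if "x \<noteq> 0" for x
    using B_zero[OF H2_slice_zero[OF assms(8,9)] that] .
  interpret self_similar_ns u B p ur ut uz Bt
    using B by unfold_locales
  \<comment> \<open>M = 0 yields the trivial flow, which belongs to b = 0 and is therefore the
    separate alternative; every other M has nonzero force.\<close>
  from M_cases show ?thesis
  proof
    assume "\<forall>z. M z = 0"
    then show ?thesis using u_zero B by blast
  next
    assume "\<exists>a. \<bar>a\<bar> > 1 \<and> (\<forall>z. M z = 2 / (a * sqrt (1 + z\<^sup>2) - z))"
    then show ?thesis using force_nonzero landau_solution_if_force B by blast
  qed
qed

end
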